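(* Let $p>1$ and $r\ge1$ be integers and $K=\frac p2+\frac1{p+1}$. Let $\omega[(z,w),d(z,w)]$ denote the holomorphic sectional curvature of $Y_{II}(r,p;K)$ with respect to its complete Einstein–Kähler metric, at the point $(z,w)$ in the nonzero direction $d(z,w)$. Then for every point $(z,w)\in Y_{II}(r,p;K)$ and every nonzero direction $d(z,w)$, $$-2K\le\omega[(z,w),d(z,w)]\le-\frac{2K}{p},$$ and this estimate is sharp: each of the values $-2K$ and $-\frac{2K}p$ is attained at some point and direction.
   Context: $R_{II}(p)$ is the classical symmetric domain of the second type: the set of complex symmetric $p\times p$ matrices $Z$ with $I-Z\overline Z$ positive definite. Its coordinates are $z=(z_{11},z_{12},\dots,z_{1p},z_{22},\dots,z_{2p},\dots,z_{pp})$, where the diagonal entries of $Z$ are $z_{kk}$ and the off-diagonal entries (in positions $(k,l)$ and $(l,k)$, $k<l$) are $\frac1{\sqrt2}z_{kl}$. For $K>0$, $$Y_{II}(r,p;K)=\{(Z,w): w\in\mathbb{C}^r,\ Z\in R_{II}(p),\ |w|^2<\det(I-Z\overline Z)^{1/K}\},$$ a domain of dimension $N=\frac{p(p+1)}2+r$ with coordinates $(z,w)=(z_1,\dots,z_N)$. When $K=\frac p2+\frac1{p+1}$, the complete Einstein–Kähler metric of $Y_{II}(r,p;K)$ is $\sum_{\alpha,\beta}\frac{\partial^2 g}{\partial z_\alpha\partial\overline z_\beta}dz_\alpha\overline{dz_\beta}$ with $$g=\log\Big[\frac1{1-X}\det(I-Z\overline Z)^{-\frac1K}K^{\frac{r-N}{1+N}}\Big],\qquad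 X=|w|^2\det(I-Z\overline Z)^{-1/K}.$$ Put $T=\big(\frac{\partial^2g}{\partial z_\alpha\partial\overline z_\beta}\big)_{1\le\alpha,\beta\le N}$. The holomorphic sectional curvature is $$\omega[(z,w),d(z,w)]=\frac{d(z,w)\,[-\overline d dT+dT\,T^{-1}\,\overline{dT}^{\,t}]\,\overline{d(z,w)}^{\,t}}{[d(z,w)\,T\,\overline{d(z,w)}^{\,t}]^2},$$ where $d(z,w)=(dz_1,\dots,dz_N)$ is a nonzero row vector in $\mathbb{C}^N$, $d=\sum_\alpha\frac{\partial}{\partial z_\alpha}dz_\alpha$ and $\overline d=\sum_\alpha\frac{\partial}{\partial\overline z_\alpha}\overline{dz_\alpha}$ act entrywise on $T$, and $^t$ denotes transpose. *)

theory Defs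
  imports "HOL-Analysis.Analysis" "HOL-Library.Uprod"
begin

text \<open>
  The integers \<open>p\<close> and \<open>r\<close> are the cardinalities of the finite types \<open>'p\<close> and \<open>'r\<close>.
  The coordinates \<open>(z, w)\<close> are indexed by \<open>'p uprod + 'r\<close>: the unordered pair \<open>Upair k l\<close>
  (with \<open>k = l\<close> allowed) indexes \<open>z_kl\<close>, and \<open>'r\<close> indexes the components of \<open>w\<close>.
  No formula below depends on the order in which the coordinates are listed.
\<close>

instance uprod :: (finite) finite
  by standard simp

lemma card_coordinates:
  "CARD('p::finite uprod + 'r::finite) = CARD('p) * (CARD('p) + 1) div 2 + CARD('r)"
  by (simp add: card_UNIV_uprod)


subsection \<open>The domains\<close>

definition positive_definite :: "complex ^ 'n ^ 'n \<Rightarrow> bool" where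
  "positive_definite A \<longleftrightarrow>
     transpose (map_matrix cnj A) = A \<and>
     (\<forall>v. v \<noteq> 0 \<longrightarrow> 0 < Re (\<Sum>i\<in>UNIV. \<Sum>j\<in>UNIV. v $ i * A $ i $ j * cnj (v $ j)))"

definition R_II :: "(complex ^ 'p ^ 'p) set" where
  "R_II = {Z. transpose Z = Z \<and> positive_definite (mat 1 - Z ** map_matrix cnj Z)}"

text \<open>For symmetric \<open>Z\<close> the determinant of \<open>I - Z \<cdot> cnj Z\<close> is real, so nothing is lost by \<open>Re\<close>.\<close>

definition detI :: "complex ^ 'p ^ 'p \<Rightarrow> real" where
  "detI Z = Re (det (mat 1 - Z ** map_matrix cnj Z))"

definition Y_II :: "real \<Rightarrow> ((complex ^ 'p ^ 'p) \<times> (complex ^ 'r)) set" where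
  "Y_II K = {(Z, w). Z \<in> R_II \<and> (norm w)\<^sup>2 < detI Z powr (1 / K)}"


subsection \<open>Coordinates\<close>

definition Zmat :: "complex ^ ('p::finite uprod + 'r::finite) \<Rightarrow> complex ^ 'p ^ 'p" where
  "Zmat \<zeta> = (\<chi> k l. if k = l then \<zeta> $ Inl (Upair k k)
                       else 1 / complex_of_real (sqrt 2) * \<zeta> $ Inl (Upair k l))"

definition wvec :: "complex ^ ('p::finite uprod + 'r::finite) \<Rightarrow> complex ^ 'r" where
  "wvec \<zeta> = (\<chi> j. \<zeta> $ Inr j)"

definition point_of :: "complex ^ ('p::finite uprod + 'r::finite) \<Rightarrow> (complex ^ 'p ^ 'p) \<times> (complex ^ 'r)" where
  "point_of \<zeta> = (Zmat \<zeta>, wvec \<zeta>)"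

lemma bij_betw_point_of:
  "bij_betw point_of (UNIV :: (complex ^ ('p::finite uprod + 'r::finite)) set) {(Z, w). transpose Z = Z}"
  unfolding bij_betw_def
proof
  show "inj (point_of :: complex ^ ('p uprod + 'r) \<Rightarrow> _)"
  proof (rule injI)
    fix \<zeta> \<xi> :: "complex ^ ('p uprod + 'r)"
    assume eq: "point_of \<zeta> = point_of \<xi>"
    then have Z: "Zmat \<zeta> $ k $ l = Zmat \<xi> $ k $ l" and w: "wvec \<zeta> $ j = wvec \<xi> $ j" for k l j
      by (simp_all add: point_of_def)
    have "\<zeta> $ Inl (Upair k l) = \<xi> $ Inl (Upair k l)" for k l
      using Z[of k l] by (cases "k = l") (simp_all add: Zmat_def)
    then have "\<zeta> $ Inl u = \<xi> $ Inl u" for u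
      by (cases u) simp
    moreover have "\<zeta> $ Inr j = \<xi> $ Inr j" for j
      using w[of j] by (simp add: wvec_def)
    ultimately show "\<zeta> = \<xi>"
      by (metis vec_eq_iff sum.exhaust)
  qed
  show "range (point_of :: complex ^ ('p uprod + 'r) \<Rightarrow> _) = {(Z, w). transpose Z = Z}"
  proof (intro equalityI subsetI)
    fix q :: "(complex ^ 'p ^ 'p) \<times> (complex ^ 'r)"
    assume "q \<in> range point_of"
    then obtain \<zeta> where "q = point_of \<zeta>" by blast
    then show "q \<in> {(Z, w). transpose Z = Z}"
      by (auto simp: point_of_def Zmat_def transpose_def vec_eq_iff)
         (metis Upair_inject)
  next
    fix q :: "(complex ^ 'p ^ 'p) \<times> (complex ^ 'r)"
    assume "q \<in> {(Z, w). transpose Z = Z}"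
    then obtain Z w where q: "q = (Z, w)" and "transpose Z = Z" by blast
    then have sym: "Z $ k $ l = Z $ l $ k" for k l
      by (metis transpose_def vec_lambda_beta)
    have ex: "\<exists>c. \<forall>k l. u = Upair k l \<longrightarrow> Z $ k $ l = (if k = l then c else 1 / complex_of_real (sqrt 2) * c)"
      for u
    proof (cases u)
      case (Upair a b)
      show ?thesis
        by (rule exI[of _ "if a = b then Z $ a $ a else complex_of_real (sqrt 2) * Z $ a $ b"])
           (auto simp: Upair sym)
    qed
    then obtain c where c: "\<And>u k l. u = Upair k l \<Longrightarrow>
        Z $ k $ l = (if k = l then c u else 1 / complex_of_real (sqrt 2) * c u)"
      by metis
    have "q = point_of (\<chi> i. case i of Inl u \<Rightarrow> c u | Inr j \<Rightarrow> w $ j)"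
      by (auto simp: q point_of_def Zmat_def wvec_def vec_eq_iff c)
    then show "q \<in> range point_of" by blast
  qed
qed


subsection \<open>Wirtinger derivatives\<close>

definition real_partial :: "complex \<Rightarrow> 'n \<Rightarrow> (complex ^ 'n::finite \<Rightarrow> complex) \<Rightarrow> complex ^ 'n \<Rightarrow> complex" where
  "real_partial c \<alpha> f \<zeta> = vector_derivative (\<lambda>t::real. f (\<zeta> + t *\<^sub>R axis \<alpha> c)) (at 0)"

definition wirt :: "'n \<Rightarrow> (complex ^ 'n::finite \<Rightarrow> complex) \<Rightarrow> complex ^ 'n \<Rightarrow> complex" where
  "wirt \<alpha> f \<zeta> = (real_partial 1 \<alpha> f \<zeta> - \<i> * real_partial \<i> \<alpha> f \<zeta>) / 2"

definition wirt_bar :: "'n \<Rightarrow> (complex ^ 'n::finite \<Rightarrow> complex) \<Rightarrow> complex ^ 'n \<Rightarrow> complex" where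
  "wirt_bar \<alpha> f \<zeta> = (real_partial 1 \<alpha> f \<zeta> + \<i> * real_partial \<i> \<alpha> f \<zeta>) / 2"

text \<open>
  The operators \<open>d\<close> and \<open>d-bar\<close>, applied entrywise to a matrix function; \<open>v\<close> is the constant
  vector \<open>(dz_1, ..., dz_N)\<close>.
\<close>

definition d_op :: "complex ^ 'n \<Rightarrow> (complex ^ 'n::finite \<Rightarrow> complex ^ 'm ^ 'k) \<Rightarrow> complex ^ 'n \<Rightarrow> complex ^ 'm ^ 'k" where
  "d_op v F \<zeta> = (\<chi> i j. \<Sum>\<alpha>\<in>UNIV. wirt \<alpha> (\<lambda>\<xi>. F \<xi> $ i $ j) \<zeta> * v $ \<alpha>)"

definition dbar_op :: "complex ^ 'n \<Rightarrow> (complex ^ 'n::finite \<Rightarrow> complex ^ 'm ^ 'k) \<Rightarrow> complex ^ 'n \<Rightarrow> complex ^ 'm ^ 'k" where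
  "dbar_op v F \<zeta> = (\<chi> i j. \<Sum>\<alpha>\<in>UNIV. wirt_bar \<alpha> (\<lambda>\<xi>. F \<xi> $ i $ j) \<zeta> * cnj (v $ \<alpha>))"


subsection \<open>The metric and its holomorphic sectional curvature\<close>

definition Xfun :: "real \<Rightarrow> complex ^ ('p::finite uprod + 'r::finite) \<Rightarrow> real" where
  "Xfun K \<zeta> = (norm (wvec \<zeta>))\<^sup>2 * detI (Zmat \<zeta>) powr (- 1 / K)"

text \<open>
  For \<open>K = p / 2 + 1 / (p + 1)\<close> the function \<open>gfun K\<close> is the potential of the complete
  Einstein-Kaehler metric of \<open>Y_II K\<close>, and \<open>Tmat K\<close> is the matrix of that metric.
\<close>

definition gfun :: "real \<Rightarrow> complex ^ ('p::finite uprod + 'r::finite) \<Rightarrow> real" where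
  "gfun K \<zeta> =
     (let r = real CARD('r); N = real CARD('p uprod + 'r)
      in ln (1 / (1 - Xfun K \<zeta>) * detI (Zmat \<zeta>) powr (- 1 / K) * K powr ((r - N) / (1 + N))))"

definition Tmat :: "real \<Rightarrow> complex ^ ('p::finite uprod + 'r::finite)
    \<Rightarrow> complex ^ ('p uprod + 'r) ^ ('p uprod + 'r)" where
  "Tmat K \<zeta> = (\<chi> \<alpha> \<beta>. wirt \<alpha> (wirt_bar \<beta> (\<lambda>\<xi>. complex_of_real (gfun K \<xi>))) \<zeta>)"

text \<open>The product of the row vector \<open>v\<close>, the matrix \<open>A\<close> and the conjugate transpose of \<open>v\<close>.\<close>

definition row_form :: "complex ^ 'n::finite \<Rightarrow> complex ^ 'n ^ 'n \<Rightarrow> complex" where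
  "row_form v A = (\<Sum>\<beta>\<in>UNIV. (v v* A) $ \<beta> * cnj (v $ \<beta>))"

definition omega :: "real \<Rightarrow> complex ^ ('p::finite uprod + 'r::finite)
    \<Rightarrow> complex ^ ('p uprod + 'r) \<Rightarrow> complex" where
  "omega K \<zeta> v =
     (let T = Tmat K \<zeta>; dT = d_op v (Tmat K) \<zeta>; dbar_dT = dbar_op v (d_op v (Tmat K)) \<zeta>
      in row_form v (- dbar_dT + dT ** matrix_inv T ** transpose (map_matrix cnj dT))
           / (row_form v T)\<^sup>2)"

end

theory Submission
  imports Defs
begin

text \<open>
  Up to a constant the potential is \<open>g = \<kappa> \<phi> - Ln (1 - Y)\<close> with \<open>\<kappa> = 1 / K\<close>,
  \<open>\<phi> = - Ln det (I - Z cnj Z)\<close> and \<open>Y = |w|\<^sup>2 exp (\<kappa> \<phi>)\<close>.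
  Differentiating \<open>g\<close> twice in \<open>t\<close> and twice in \<open>cnj t\<close> along a holomorphic curve with velocity \<open>v\<close>
  and second derivative \<open>b\<close> gives a quadratic polynomial in \<open>b\<close> with leading form \<open>T\<close>; its minimum
  over \<open>b\<close> is minus the numerator of the curvature.  The derivatives are explicit at every point of the
  domain, and completing squares in \<open>b\<close> yields
  \<open>\<omega> = - 2 - 2 c (\<kappa> S - \<kappa>\<^sup>2 F\<^sup>2) / G\<^sup>2\<close>.
  Here \<open>c = 1 / (1 - Y)\<close>, \<open>G = v T v\<^sup>*\<close>, and \<open>F = tr H\<close>, \<open>S = tr H\<^sup>2\<close>
  for a positive semidefinite \<open>p \<times> p\<close> matrix \<open>H\<close>.  The bounds follow from
  \<open>F\<^sup>2 / p \<le> S \<le> F\<^sup>2\<close>, \<open>G \<ge> c \<kappa> F\<close>, \<open>c \<ge> 1\<close> and \<open>1 \<le> K \<le> p\<close>;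
  they are attained at the origin where \<open>H\<close> has rank one or is a multiple of the identity.
\<close>

section \<open>Wirtinger derivatives in one variable\<close>

text \<open>The obstacle is the factor T^{-1}: T mixes the \<open>Z\<close> and \<open>w\<close>
  directions and has no convenient inverse at a general point. With \<xi> = v dT and X = v (dbar d
  T) v^* this is minus the numerator of the curvature, so an explicit lower bound that is attained
  replaces the computation of the inverse. The curves are quadratic because the jet of order two in
  \<open>t\<close> and two in \<open>cnj t\<close> sees nothing of a holomorphic curve beyond its
  velocity and its second derivative b, and b enters through dT, its conjugate counterpart and T
  alone. The passage from coordinates to \<open>(Z, w)\<close> is linear, so a quadratic curve in
  coordinates is a quadratic curve of symmetric matrices and vectors, and the factors sqrt 2 stay
  out of the differentiation. In these terms b enters the jet through one symmetric matrix and one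
  vector, both affine in b, which can be made zero together; that is where the minimum is
  attained.\<close>

definition has_wirt :: "(complex \<Rightarrow> complex) \<Rightarrow> complex \<Rightarrow> complex \<Rightarrow> complex \<Rightarrow> bool" where
  "has_wirt f P Q t \<longleftrightarrow> (f has_derivative (\<lambda>\<tau>. P * \<tau> + Q * cnj \<tau>)) (at t)"

lemma has_wirt_rhs: "has_wirt f P Q t \<Longrightarrow> P = P' \<Longrightarrow> Q = Q' \<Longrightarrow> has_wirt f P' Q' t"
  by simp

text \<open>The increments 1 and \<i> separate the two coefficients. Uniqueness is the means by
  which two computations of the same derivative are compared later on.\<close>

lemma has_wirt_unique:
  assumes "has_wirt f P Q t" "has_wirt f P' Q' t"
  shows "P = P'" "Q = Q'"
proof -
  have eq: "(\<lambda>\<tau>. P * \<tau> + Q * cnj \<tau>) = (\<lambda>\<tau>. P' * \<tau> + Q' * cnj \<tau>)"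
    using assms has_derivative_unique unfolding has_wirt_def by blast
  have 1: "P + Q = P' + Q'" using fun_cong[OF eq, of 1] by simp
  have "(P - Q) * \<i> = (P' - Q') * \<i>" using fun_cong[OF eq, of \<i>] by (simp add: algebra_simps)
  then have 2: "P - Q = P' - Q'" by simp
  have "2 * P = (P + Q) + (P - Q)" by simp
  also have "\<dots> = 2 * P'" unfolding 1 2 by simp
  finally show "P = P'" by simp
  with 1 show "Q = Q'" by simp
qed

lemma has_wirt_transform:
  assumes "has_wirt f P Q t" "open U" "t \<in> U" "\<And>s. s \<in> U \<Longrightarrow> f s = g s"
  shows "has_wirt g P Q t"
  using has_derivative_transform_within_open[OF assms(1)[unfolded has_wirt_def] assms(2-4)]
  unfolding has_wirt_def by simp

lemma has_wirt_const: "has_wirt (\<lambda>t. c) 0 0 t"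
  unfolding has_wirt_def by simp

lemma has_wirt_ident: "has_wirt (\<lambda>t. t) 1 0 t"
  unfolding has_wirt_def by simp

lemma has_wirt_add:
  assumes "has_wirt f P Q t" "has_wirt g P' Q' t"
  shows "has_wirt (\<lambda>t. f t + g t) (P + P') (Q + Q') t"
  using has_derivative_add[OF assms[unfolded has_wirt_def]]
  unfolding has_wirt_def by (simp add: algebra_simps)

lemma has_wirt_minus:
  assumes "has_wirt f P Q t"
  shows "has_wirt (\<lambda>t. - f t) (- P) (- Q) t"
  using has_derivative_minus[OF assms[unfolded has_wirt_def]]
  unfolding has_wirt_def by (simp add: algebra_simps)

lemma has_wirt_diff:
  assumes "has_wirt f P Q t" "has_wirt g P' Q' t"
  shows "has_wirt (\<lambda>t. f t - g t) (P - P') (Q - Q') t"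
  using has_wirt_add[OF assms(1) has_wirt_minus[OF assms(2)]] by simp

lemma has_wirt_mult:
  assumes "has_wirt f P Q t" "has_wirt g P' Q' t"
  shows "has_wirt (\<lambda>t. f t * g t) (P * g t + f t * P') (Q * g t + f t * Q') t"
  using has_derivative_mult[OF assms[unfolded has_wirt_def]]
  unfolding has_wirt_def by (simp add: algebra_simps)

lemma has_wirt_cnj:
  assumes "has_wirt f P Q t"
  shows "has_wirt (\<lambda>t. cnj (f t)) (cnj Q) (cnj P) t"
  using has_derivative_cnj[OF assms[unfolded has_wirt_def]]
  unfolding has_wirt_def by (simp add: algebra_simps)

lemma has_wirt_sum:
  assumes "\<And>i. i \<in> I \<Longrightarrow> has_wirt (f i) (P i) (Q i) t"
  shows "has_wirt (\<lambda>t. \<Sum>i\<in>I. f i t) (\<Sum>i\<in>I. P i) (\<Sum>i\<in>I. Q i) t"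
proof -
  have "((\<lambda>t. \<Sum>i\<in>I. f i t) has_derivative (\<lambda>\<tau>. \<Sum>i\<in>I. P i * \<tau> + Q i * cnj \<tau>)) (at t)"
    using assms unfolding has_wirt_def by (intro has_derivative_sum) auto
  then show ?thesis
    unfolding has_wirt_def by (simp add: sum.distrib sum_distrib_right)
qed

lemma has_wirt_prod:
  assumes "\<And>i. i \<in> I \<Longrightarrow> has_wirt (f i) (P i) (Q i) t"
  shows "has_wirt (\<lambda>t. \<Prod>i\<in>I. f i t) (\<Sum>i\<in>I. P i * (\<Prod>j\<in>I - {i}. f j t)) (\<Sum>i\<in>I. Q i * (\<Prod>j\<in>I - {i}. f j t)) t"
proof -
  have "((\<lambda>t. \<Prod>i\<in>I. f i t) has_derivative
      (\<lambda>\<tau>. \<Sum>i\<in>I. (P i * \<tau> + Q i * cnj \<tau>) * (\<Prod>j\<in>I - {i}. f j t))) (at t)"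
    using assms unfolding has_wirt_def by (intro has_derivative_prod) auto
  then show ?thesis
    unfolding has_wirt_def by (simp add: sum.distrib sum_distrib_left sum_distrib_right algebra_simps)
qed

lemma has_wirt_chain:
  assumes "has_wirt f P Q t" "(g has_field_derivative g') (at (f t))"
  shows "has_wirt (\<lambda>t. g (f t)) (g' * P) (g' * Q) t"
  using has_derivative_compose[OF assms(1)[unfolded has_wirt_def] assms(2)[unfolded has_field_derivative_def]]
  unfolding has_wirt_def by (simp add: algebra_simps)

section \<open>Derivatives of matrix-valued functions\<close>

definition has_mwirt :: "(complex \<Rightarrow> complex ^ 'n ^ 'm) \<Rightarrow> complex ^ 'n ^ 'm \<Rightarrow> complex ^ 'n ^ 'm \<Rightarrow> complex \<Rightarrow> bool" where
  "has_mwirt M P Q t \<longleftrightarrow> (\<forall>i j. has_wirt (\<lambda>t. M t $ i $ j) (P $ i $ j) (Q $ i $ j) t)"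

lemma has_mwirt_rhs: "has_mwirt f P Q t \<Longrightarrow> P = P' \<Longrightarrow> Q = Q' \<Longrightarrow> has_mwirt f P' Q' t"
  by simp

lemma has_mwirt_unique:
  assumes "has_mwirt f P Q t" "has_mwirt f P' Q' t"
  shows "P = P'" "Q = Q'"
  using assms has_wirt_unique unfolding has_mwirt_def vec_eq_iff by blast+

lemma has_mwirt_const: "has_mwirt (\<lambda>t. M) 0 0 t"
  unfolding has_mwirt_def by (simp add: has_wirt_const)

lemma has_mwirt_add:
  assumes "has_mwirt M P Q t" "has_mwirt N P' Q' t"
  shows "has_mwirt (\<lambda>t. M t + N t) (P + P') (Q + Q') t"
  using assms unfolding has_mwirt_def by (simp add: has_wirt_add)

lemma has_mwirt_diff:
  assumes "has_mwirt M P Q t" "has_mwirt N P' Q' t"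
  shows "has_mwirt (\<lambda>t. M t - N t) (P - P') (Q - Q') t"
  using assms unfolding has_mwirt_def by (simp add: has_wirt_diff)

lemma has_mwirt_mult:
  assumes "has_mwirt M P Q t" "has_mwirt N P' Q' t"
  shows "has_mwirt (\<lambda>t. M t ** N t) (P ** N t + M t ** P') (Q ** N t + M t ** Q') t"
  unfolding has_mwirt_def
proof (intro allI)
  fix i j
  have "has_wirt (\<lambda>t. \<Sum>k\<in>UNIV. M t $ i $ k * N t $ k $ j)
     (\<Sum>k\<in>UNIV. P $ i $ k * N t $ k $ j + M t $ i $ k * P' $ k $ j)
     (\<Sum>k\<in>UNIV. Q $ i $ k * N t $ k $ j + M t $ i $ k * Q' $ k $ j) t"
    using assms unfolding has_mwirt_def by (intro has_wirt_sum has_wirt_mult) auto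
  then show "has_wirt (\<lambda>t. (M t ** N t) $ i $ j) ((P ** N t + M t ** P') $ i $ j)
        ((Q ** N t + M t ** Q') $ i $ j) t"
    by (simp add: matrix_matrix_mult_def sum.distrib)
qed

lemma has_mwirt_cnj:
  assumes "has_mwirt M P Q t"
  shows "has_mwirt (\<lambda>t. map_matrix cnj (M t)) (map_matrix cnj Q) (map_matrix cnj P) t"
  using assms unfolding has_mwirt_def by (simp add: has_wirt_cnj)

lemma has_wirt_trace:
  assumes "has_mwirt M P Q t"
  shows "has_wirt (\<lambda>t. trace (M t)) (trace P) (trace Q) t"
  using assms unfolding has_mwirt_def trace_def by (intro has_wirt_sum) auto

section \<open>Derivatives of determinants and of inverse matrices\<close>

lemma det_replace_row_expand:
  fixes A X :: "'a::comm_ring_1 ^ 'n ^ 'n"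
  shows "det (\<chi> i. if i = k then X $ i else A $ i) =
    (\<Sum>p\<in>{p. p permutes (UNIV :: 'n set)}. of_int (sign p) * (X $ k $ p k * (\<Prod>j\<in>UNIV - {k}. A $ j $ p j)))"
proof -
  have "(\<Prod>i\<in>UNIV. (\<chi> i. if i = k then X $ i else A $ i) $ i $ p i) =
     X $ k $ p k * (\<Prod>j\<in>UNIV - {k}. A $ j $ p j)" for p :: "'n \<Rightarrow> 'n"
    by (subst prod.remove[of _ k]) (auto intro!: prod.cong)
  then show ?thesis by (simp add: det_def)
qed

text \<open>Since X = (X B) A, row k of X is the combination of the rows of A with coefficients from
  row k of X B; only the k-th of them survives in the determinant (Cramer's rule for rows).\<close>

lemma det_replace_row:
  fixes A X :: "'a::field ^ 'n ^ 'n"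
  assumes "B ** A = mat 1"
  shows "det (\<chi> i. if i = k then X $ i else A $ i) = (X ** B) $ k $ k * det A"
proof -
  define x where "x = (X ** B) $ k"
  have XBA: "X ** B ** A = X"
    by (simp add: matrix_mul_assoc[symmetric] assms matrix_mul_rid)
  have "(\<Sum>i\<in>UNIV. x $ i * A $ i $ j) = (X ** B ** A) $ k $ j" for j
    unfolding x_def matrix_matrix_mult_def[of "X ** B" A] by simp
  then have "X $ k = (\<Sum>i\<in>UNIV. x $ i *s row i A)"
    unfolding XBA by (simp add: vec_eq_iff row_def)
  then have "(\<chi> i. if i = k then X $ i else A $ i) = (\<chi> i. if i = k then \<Sum>i\<in>UNIV. x $ i *s row i A else row i A)"
    by (auto simp: vec_eq_iff row_def)
  then show ?thesis
    using cramer_lemma_transpose[of k x A] by (simp add: x_def)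
qed

text \<open>The product rule in the Leibniz formula. This form also covers singular matrices, such
  as the Cramer numerators in \<open>has_mwirt_matrix_inv\<close> may be.\<close>

lemma has_wirt_det_expand:
  assumes "has_mwirt M P Q t"
  shows "has_wirt (\<lambda>t. det (M t)) (\<Sum>k\<in>UNIV. det (\<chi> i. if i = k then P $ i else M t $ i))
     (\<Sum>k\<in>UNIV. det (\<chi> i. if i = k then Q $ i else M t $ i)) t"
proof -
  have "has_wirt (\<lambda>t. \<Sum>p\<in>{p. p permutes UNIV}. of_int (sign p) * (\<Prod>i\<in>UNIV. M t $ i $ p i))
     (\<Sum>p\<in>{p. p permutes UNIV}. 0 * (\<Prod>i\<in>UNIV. M t $ i $ p i) + of_int (sign p) * (\<Sum>k\<in>UNIV. P $ k $ p k * (\<Prod>j\<in>UNIV - {k}. M t $ j $ p j)))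
     (\<Sum>p\<in>{p. p permutes UNIV}. 0 * (\<Prod>i\<in>UNIV. M t $ i $ p i) + of_int (sign p) * (\<Sum>k\<in>UNIV. Q $ k $ p k * (\<Prod>j\<in>UNIV - {k}. M t $ j $ p j))) t"
    using assms unfolding has_mwirt_def
    by (intro has_wirt_sum has_wirt_mult has_wirt_const has_wirt_prod) auto
  then show ?thesis
    unfolding det_replace_row_expand
    by (simp add: det_def sum_distrib_left sum.swap[of _ _ UNIV])
qed

text \<open>Jacobi's formula, obtained from the row-by-row expansion by Cramer's rule.\<close>

lemma has_wirt_det:
  fixes M :: "complex \<Rightarrow> complex ^ 'n ^ 'n"
  assumes "has_mwirt M P Q t" "B ** M t = mat 1"
  shows "has_wirt (\<lambda>t. det (M t)) (det (M t) * trace (B ** P)) (det (M t) * trace (B ** Q)) t"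
proof (rule has_wirt_rhs[OF has_wirt_det_expand[OF assms(1)]])
  have "(\<Sum>k\<in>UNIV. det (\<chi> i. if i = k then X $ i else M t $ i)) = det (M t) * trace (B ** X)" for X
    unfolding det_replace_row[OF assms(2)] trace_mul_sym[of B X] by (simp add: trace_def sum_distrib_left mult.commute)
  then show "(\<Sum>k\<in>UNIV. det (\<chi> i. if i = k then P $ i else M t $ i)) = det (M t) * trace (B ** P)"
    "(\<Sum>k\<in>UNIV. det (\<chi> i. if i = k then Q $ i else M t $ i)) = det (M t) * trace (B ** Q)"
    by blast+
qed

lemma matrix_inv_eq:
  fixes A :: "complex ^ 'n ^ 'n"
  assumes "det A \<noteq> 0"
  shows "matrix_inv A ** A = mat 1" "A ** matrix_inv A = mat 1"
proof -
  have "\<exists>B. A ** B = mat 1 \<and> B ** A = mat 1"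
    using assms by (simp add: invertible_det_nz[symmetric] invertible_def)
  from someI_ex[OF this] show "matrix_inv A ** A = mat 1" "A ** matrix_inv A = mat 1"
    unfolding matrix_inv_def by blast+
qed

lemma matrix_inv_cramer:
  fixes A :: "complex ^ 'n ^ 'n"
  assumes "det A \<noteq> 0"
  shows "matrix_inv A $ k $ l = det (\<chi> i j. if j = k then (if i = l then 1 else 0) else A $ i $ j) / det A"
proof -
  have "A *v (\<chi> k. matrix_inv A $ k $ l) = axis l 1"
    using matrix_inv_eq(2)[OF assms]
    by (simp add: vec_eq_iff matrix_matrix_mult_def matrix_vector_mult_def mat_def axis_def eq_commute)
  then have "(\<chi> k. matrix_inv A $ k $ l) = (\<chi> k. det (\<chi> i j. if j = k then axis l 1 $ i else A $ i $ j) / det A)"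
    using cramer[OF assms] by blast
  then have "matrix_inv A $ k $ l = det (\<chi> i j. if j = k then axis l 1 $ i else A $ i $ j) / det A"
    by (simp add: vec_eq_iff)
  then show ?thesis
    by (simp add: axis_def cong: if_cong)
qed

text \<open>Cramer's rule writes each entry of the inverse as a quotient of determinants, which
  gives differentiability with unknown derivatives. These are then found by differentiating the
  product of the inverse with \<open>M t\<close>, which is constantly \<open>mat 1\<close> on the
  open set \<open>U\<close>.\<close>

lemma has_mwirt_matrix_inv:
  fixes M :: "complex \<Rightarrow> complex ^ 'n ^ 'n"
  assumes M: "has_mwirt M P Q t" and U: "open U" "t \<in> U" "\<And>s. s \<in> U \<Longrightarrow> det (M s) \<noteq> 0"
  shows "has_mwirt (\<lambda>t. matrix_inv (M t)) (- (matrix_inv (M t) ** P ** matrix_inv (M t)))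
     (- (matrix_inv (M t) ** Q ** matrix_inv (M t))) t"
proof -
  have "\<exists>X Y. has_wirt (\<lambda>t. matrix_inv (M t) $ k $ l) X Y t" for k l
  proof -
    obtain d1 d2 where d: "has_wirt (\<lambda>t. det (M t)) d1 d2 t"
      using has_wirt_det_expand[OF M] by iprover
    have M1: "has_mwirt (\<lambda>t. \<chi> i j. if j = k then (if i = l then 1 else 0) else M t $ i $ j)
       (\<chi> i j. if j = k then 0 else P $ i $ j) (\<chi> i j. if j = k then 0 else Q $ i $ j) t"
      unfolding has_mwirt_def
    proof (intro allI)
      fix i j
      show "has_wirt (\<lambda>t. (\<chi> i j. if j = k then (if i = l then 1 else 0) else M t $ i $ j) $ i $ j)
        ((\<chi> i j. if j = k then 0 else P $ i $ j) $ i $ j) ((\<chi> i j. if j = k then 0 else Q $ i $ j) $ i $ j) t"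
        using M[unfolded has_mwirt_def, rule_format, of i j] by (cases "j = k") (simp_all add: has_wirt_const)
    qed
    obtain e1 e2 where e: "has_wirt (\<lambda>t. det (\<chi> i j. if j = k then (if i = l then 1 else 0) else M t $ i $ j)) e1 e2 t"
      by (rule that[OF has_wirt_det_expand[OF M1]])
    obtain i1 i2 where i: "has_wirt (\<lambda>t. inverse (det (M t))) i1 i2 t"
      using has_wirt_chain[OF d DERIV_inverse[OF U(3)[OF U(2)]]] by iprover
    have "has_wirt (\<lambda>t. matrix_inv (M t) $ k $ l)
        (e1 * inverse (det (M t)) + det (\<chi> i j. if j = k then (if i = l then 1 else 0) else M t $ i $ j) * i1)
        (e2 * inverse (det (M t)) + det (\<chi> i j. if j = k then (if i = l then 1 else 0) else M t $ i $ j) * i2) t"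
      by (rule has_wirt_transform[OF has_wirt_mult[OF e i] U(1,2)])
         (simp add: matrix_inv_cramer[OF U(3)] divide_inverse)
    then show ?thesis by blast
  qed
  then obtain X Y where XY: "\<And>k l. has_wirt (\<lambda>t. matrix_inv (M t) $ k $ l) (X k l) (Y k l) t"
    by metis
  define X' :: "complex ^ 'n ^ 'n" where "X' = (\<chi> k l. X k l)"
  define Y' :: "complex ^ 'n ^ 'n" where "Y' = (\<chi> k l. Y k l)"
  have I: "has_mwirt (\<lambda>t. matrix_inv (M t)) X' Y' t"
    unfolding has_mwirt_def X'_def Y'_def using XY by simp
  let ?B = "matrix_inv (M t)"
  have 1: "?B ** M t = mat 1" "M t ** ?B = mat 1"
    using matrix_inv_eq[OF U(3)[OF U(2)]] by this
  have A: "has_mwirt (\<lambda>t. matrix_inv (M t) ** M t) (X' ** M t + ?B ** P) (Y' ** M t + ?B ** Q) t"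
    by (rule has_mwirt_mult[OF I M])
  have "has_mwirt (\<lambda>t. matrix_inv (M t) ** M t) 0 0 t"
    unfolding has_mwirt_def
  proof (intro allI)
    fix i j
    show "has_wirt (\<lambda>t. (matrix_inv (M t) ** M t) $ i $ j) (0 $ i $ j) (0 $ i $ j) t"
      by (rule has_wirt_transform[OF _ U(1,2), of "\<lambda>t. mat 1 $ i $ j"])
         (simp_all add: matrix_inv_eq[OF U(3)] has_wirt_const)
  qed
  then have "X' ** M t + ?B ** P = 0" "Y' ** M t + ?B ** Q = 0"
    using has_mwirt_unique[OF A] by auto
  then have "X' ** M t = - (?B ** P)" "Y' ** M t = - (?B ** Q)"
    by (simp_all add: eq_neg_iff_add_eq_0)
  then have "X' ** M t ** ?B = - (?B ** P) ** ?B" "Y' ** M t ** ?B = - (?B ** Q) ** ?B"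
    by simp_all
  moreover have "- C ** D = - (C ** D)" for C D :: "complex ^ 'n ^ 'n"
    by (simp add: matrix_matrix_mult_def vec_eq_iff sum_negf)
  ultimately have "X' = - (?B ** P ** ?B)" "Y' = - (?B ** Q ** ?B)"
    by (simp_all add: matrix_mul_assoc[symmetric] 1 matrix_mul_rid)
  with I show ?thesis by simp
qed

section \<open>Hermitian forms and matrices\<close>

abbreviation cj :: "complex ^ 'n ^ 'm \<Rightarrow> complex ^ 'n ^ 'm" where
  "cj \<equiv> map_matrix cnj"

abbreviation adj :: "complex ^ 'n ^ 'm \<Rightarrow> complex ^ 'm ^ 'n" where
  "adj M \<equiv> transpose (cj M)"

lemma cj_mult: "cj (A ** B) = cj A ** cj B"
  by (simp add: matrix_matrix_mult_def vec_eq_iff)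

lemma cj_add: "cj (A + B) = cj A + cj B"
  by (simp add: vec_eq_iff)

lemma cj_diff: "cj (A - B) = cj A - cj B"
  by (simp add: vec_eq_iff)

lemma cj_mat_1 [simp]: "cj (mat 1) = mat 1"
  by (simp add: mat_def vec_eq_iff)

lemma cj_cj [simp]: "cj (cj A) = A"
  by (simp add: vec_eq_iff)

lemma cj_transpose: "cj (transpose A) = transpose (cj A)"
  by (simp add: vec_eq_iff transpose_def)

lemma det_cj: "det (cj A) = cnj (det A)"
  by (simp add: det_def)

lemma trace_cj: "trace (cj A) = cnj (trace A)"
  by (simp add: trace_def)

lemma matrix_inv_unique:
  fixes A :: "complex ^ 'n ^ 'n"
  assumes "B ** A = mat 1"
  shows "matrix_inv A = B"
proof -
  have "det B * det A = 1"
    using assms by (metis det_I det_mul)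
  then have "det A \<noteq> 0" by auto
  then have "A ** matrix_inv A = mat 1" by (rule matrix_inv_eq)
  then have "B ** (A ** matrix_inv A) = B" by (simp add: matrix_mul_rid)
  then show ?thesis
    by (simp add: matrix_mul_assoc assms matrix_mul_lid)
qed

definition sesq :: "complex ^ 'n ^ 'n \<Rightarrow> complex ^ 'n \<Rightarrow> complex ^ 'n \<Rightarrow> complex" where
  "sesq A v u = (\<Sum>i\<in>UNIV. \<Sum>j\<in>UNIV. v $ i * A $ i $ j * cnj (u $ j))"

lemma sesq_add_left: "sesq A (v + v') u = sesq A v u + sesq A v' u"
  by (simp add: sesq_def algebra_simps sum.distrib)

lemma sesq_add_right: "sesq A v (u + u') = sesq A v u + sesq A v u'"
  by (simp add: sesq_def algebra_simps sum.distrib)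

lemma sesq_scale_left: "sesq A (c *s v) u = c * sesq A v u"
  by (simp add: sesq_def sum_distrib_left mult.assoc)

lemma sesq_scale_right: "sesq A v (c *s u) = cnj c * sesq A v u"
  by (simp add: sesq_def sum_distrib_left mult_ac)

lemma sesq_minus_left: "sesq A (- v) u = - sesq A v u"
  by (simp add: sesq_def sum_negf)

lemma sesq_minus_right: "sesq A v (- u) = - sesq A v u"
  by (simp add: sesq_def sum_negf)

lemma sesq_matrix_add: "sesq (A + B) v u = sesq A v u + sesq B v u"
  by (simp add: sesq_def algebra_simps sum.distrib)

lemma sesq_matrix_minus: "sesq (- A) v u = - sesq A v u"
  by (simp add: sesq_def sum_negf)

lemma sum_axis_left: "(\<Sum>i\<in>UNIV. axis k c $ i * f i) = c * (f k :: 'a::semiring_1)"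
proof -
  have "(\<Sum>i\<in>UNIV. axis k c $ i * f i) = (\<Sum>i\<in>UNIV. if i = k then c * f i else 0)"
    by (rule sum.cong) (auto simp: axis_def)
  then show ?thesis by simp
qed

lemma sesq_axis_left: "sesq A (axis k c) u = c * (\<Sum>j\<in>UNIV. A $ k $ j * cnj (u $ j))"
  unfolding sesq_def by (simp add: mult.assoc sum_distrib_left[symmetric] sum_axis_left)

lemma sesq_eq_vector_matrix: "sesq A v u = (\<Sum>j\<in>UNIV. (v v* A) $ j * cnj (u $ j))"
  unfolding sesq_def vector_matrix_mult_def
  by (subst sum.swap) (simp add: sum_distrib_left sum_distrib_right mult_ac)

lemma sesq_eq_matrix_vector: "sesq A v u = (\<Sum>i\<in>UNIV. v $ i * (A *v (\<chi> j. cnj (u $ j))) $ i)"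
  unfolding sesq_def matrix_vector_mult_def
  by (simp add: sum_distrib_left mult_ac)

lemma row_form_eq_sesq: "row_form v A = sesq A v v"
  by (simp add: row_form_def sesq_eq_vector_matrix)

lemma cnj_sesq:
  assumes "\<And>i j. A $ j $ i = cnj (A $ i $ j)"
  shows "cnj (sesq A v u) = sesq A u v"
  unfolding sesq_def by (subst (2) sum.swap) (simp add: assms[symmetric] mult_ac)

lemma cnj_eqI:
  assumes "a + b \<in> \<real>" "\<i> * b - \<i> * a \<in> \<real>"
  shows "b = cnj a"
  using assms by (auto simp: complex_is_Real_iff complex_eq_iff)

text \<open>Polarisation: reality of the form at v + u and at v + \<i> u gives the two conditions of
  \<open>cnj_eqI\<close>.\<close>

lemma sesq_real_hermitian:
  assumes "\<And>v. sesq A v v \<in> \<real>"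
  shows "sesq A u v = cnj (sesq A v u)"
proof (rule cnj_eqI)
  have "sesq A v v + sesq A u u \<in> \<real>" for v u
    using assms by auto
  moreover have "sesq A (v + u) (v + u) - (sesq A v v + sesq A u u) = sesq A v u + sesq A u v" for v u
    by (simp add: sesq_add_left sesq_add_right)
  ultimately have r: "sesq A v u + sesq A u v \<in> \<real>" for u v
    using assms[of "v + u"] by (metis Reals_diff)
  show "sesq A v u + sesq A u v \<in> \<real>" by (rule r)
  show "\<i> * sesq A u v - \<i> * sesq A v u \<in> \<real>"
    using r[of v "\<i> *s u"] by (simp add: sesq_scale_left sesq_scale_right)
qed

text \<open>Completing the square around the critical point \<open>b0\<close> gives D b = X - b0 T
  b0^* + (b - b0) T (b - b0)^*. A lower bound \<open>m\<close> that is attained must therefore be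
  the value X - b0 T b0^*, and b0 T b0^* is the form of the inverse at \<open>\<xi>\<close>. In the
  application the left side of the conclusion is the numerator of the curvature.\<close>

lemma hermitian_quadratic_min:
  fixes T :: "complex ^ 'n ^ 'n" and \<xi> \<eta> :: "complex ^ 'n"
  assumes T: "\<And>b. b \<noteq> 0 \<Longrightarrow> sesq T b b \<in> \<real> \<and> 0 < Re (sesq T b b)"
    and D: "\<And>b. D b = X + (\<Sum>j\<in>UNIV. \<xi> $ j * cnj (b $ j)) + (\<Sum>i\<in>UNIV. b $ i * \<eta> $ i) + sesq T b b"
    and m: "\<And>b. D b \<in> \<real> \<and> m \<le> Re (D b)" "\<exists>b. D b = of_real m"
  shows "sesq (matrix_inv T) \<xi> \<xi> - X = - of_real m"
proof -
  have real: "sesq T b b \<in> \<real>" for b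
    using T[of b] by (cases "b = 0") (auto simp: sesq_def)
  have nonneg: "0 \<le> Re (sesq T b b)" for b
    using T[of b] by (cases "b = 0") (auto simp: sesq_def)
  have ker: "x = 0" if "T *v x = 0" for x
  proof (rule ccontr)
    assume "x \<noteq> 0"
    define b where "b = (\<chi> j. cnj (x $ j))"
    have "b \<noteq> 0" using \<open>x \<noteq> 0\<close> by (simp add: b_def vec_eq_iff)
    moreover have "sesq T b b = 0"
      using that by (simp add: sesq_eq_matrix_vector b_def)
    ultimately show False using T[of b] by simp
  qed
  then have "invertible T"
    using matrix_left_invertible_ker invertible_left_inverse by blast
  then have inv: "matrix_inv T ** T = mat 1"
    using matrix_inv_eq invertible_det_nz by blast
  define f where "f b = (\<Sum>j\<in>UNIV. \<xi> $ j * cnj (b $ j))" for b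
  define h where "h b = (\<Sum>i\<in>UNIV. b $ i * \<eta> $ i)" for b
  have D': "D b = X + f b + h b + sesq T b b" for b
    by (simp add: D f_def h_def)
  have "X \<in> \<real>"
    using m(1)[of 0] by (simp add: D sesq_def)
  have fh: "f b + h b \<in> \<real>" for b
  proof -
    have "f b + h b = D b - X - sesq T b b" by (simp add: D')
    then show ?thesis using m(1)[of b] real[of b] \<open>X \<in> \<real>\<close> by auto
  qed
  \<comment> \<open>Reality of \<open>f + h\<close> at \<open>b\<close> and at
    \<open>\<i> *s b\<close> makes the two linear terms conjugate, so \<open>\<eta>\<close> need not
    be identified explicitly.\<close>
  have hf: "h b = cnj (f b)" for b
  proof (rule cnj_eqI[OF fh])
    have "f (\<i> *s b) + h (\<i> *s b) = \<i> * h b - \<i> * f b"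
      by (simp add: f_def h_def sum_distrib_left sum_negf mult_ac)
    then show "\<i> * h b - \<i> * f b \<in> \<real>" using fh[of "\<i> *s b"] by simp
  qed
  \<comment> \<open>The critical point of \<open>D\<close>: it is the solution of
    \<open>b0 v* T = - \<xi>\<close>.\<close>
  define b0 where "b0 = - (\<xi> v* matrix_inv T)"
  have "b0 v* T = - (\<xi> v* (matrix_inv T ** T))"
    unfolding b0_def vector_matrix_mul_assoc[symmetric]
    by (simp add: vector_matrix_mult_def vec_eq_iff sum_negf)
  then have "b0 v* T = - \<xi>"
    by (simp add: inv)
  then have b0: "sesq T b0 b = - f b" for b
    by (simp add: sesq_eq_vector_matrix f_def sum_negf)
  have b0': "sesq T b b0 = - cnj (f b)" for b
    using sesq_real_hermitian[OF real, of b b0] by (simp add: b0)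
  have Db: "D b = X + sesq T (b + - b0) (b + - b0) - sesq T b0 b0" for b
    unfolding sesq_add_left sesq_add_right sesq_minus_left sesq_minus_right b0[of b] b0'[of b] D' hf by simp
  obtain b where b: "D b = of_real m" using m(2) by blast
  have Db0: "D b0 = X - sesq T b0 b0"
    unfolding Db[of b0] by (simp add: sesq_def)
  have "Re (D b) \<ge> Re (D b0)"
    using nonneg[of "b + - b0"] by (simp add: Db Db0 sesq_def)
  then have "Re (D b0) = m"
    using m(1)[of b0] b by simp
  then have "D b0 = of_real m"
    using m(1)[of b0] by (metis of_real_Re)
  then have m: "of_real m = X - sesq T b0 b0"
    by (simp add: Db0)
  have "sesq (matrix_inv T) \<xi> \<xi> = - cnj (f b0)"
    by (simp add: sesq_eq_vector_matrix f_def b0_def sum_negf mult_ac)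
  also have "\<dots> = sesq T b0 b0"
    by (simp add: b0')
  finally show ?thesis by (simp add: m)
qed

section \<open>Gram factorisation of positive semidefinite matrices\<close>

lemma psd_zero_diagonal:
  assumes herm: "\<And>i j. A $ j $ i = cnj (A $ i $ j)" and psd: "\<And>v. 0 \<le> Re (sesq A v v)"
    and "A $ s $ s = 0"
  shows "A $ s $ i = 0"
proof (rule ccontr)
  assume nz: "A $ s $ i \<noteq> 0"
  \<comment> \<open>The test vector is x times the s-th unit vector plus the i-th one. The form
    there equals A_ii - 2 r |A_si|^2, and \<open>r\<close> is chosen to make this -1.\<close>
  define r where "r = (Re (A $ i $ i) + 1) / (2 * (cmod (A $ s $ i))\<^sup>2)"
  define x where "x = - complex_of_real r * cnj (A $ s $ i)"
  have ax: "sesq A (axis k c) (axis l d) = c * A $ k $ l * cnj d" for k l c d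
  proof -
    have "(\<Sum>j\<in>UNIV. A $ k $ j * cnj (axis l d $ j)) = (\<Sum>j\<in>UNIV. if j = l then A $ k $ j * cnj d else 0)"
      by (rule sum.cong) (auto simp: axis_def)
    then show ?thesis by (simp add: sesq_axis_left)
  qed
  have x: "x * A $ s $ i = - complex_of_real (r * (cmod (A $ s $ i))\<^sup>2)"
    by (simp add: x_def complex_norm_square mult_ac del: of_real_power)
  have "sesq A (axis s x + axis i 1) (axis s x + axis i 1)
      = x * A $ s $ i + cnj (x * A $ s $ i) + A $ i $ i"
    by (simp add: sesq_add_left sesq_add_right ax assms(3) herm[of s i])
  then have "0 \<le> Re (A $ i $ i) - 2 * (r * (cmod (A $ s $ i))\<^sup>2)"
    using psd[of "axis s x + axis i 1"] by (simp add: x)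
  moreover have "2 * (r * (cmod (A $ s $ i))\<^sup>2) = Re (A $ i $ i) + 1"
    using nz by (simp add: r_def)
  ultimately show False by simp
qed

text \<open>Cholesky: the column \<open>s\<close> of the factor is the normalised column \<open>s\<close> of \<open>A\<close>, and subtracting its
  contribution (a Schur complement) clears row and column \<open>s\<close>.\<close>

lemma psd_factor_aux:
  assumes "finite S"
  shows "(\<And>i j. A $ j $ i = cnj (A $ i $ j)) \<Longrightarrow> (\<And>v. 0 \<le> Re (sesq A v v)) \<Longrightarrow> (\<And>i j. i \<notin> S \<Longrightarrow> A $ i $ j = 0)
    \<Longrightarrow> \<exists>C :: complex ^ 'n ^ 'n. (\<forall>i k. k \<notin> S \<longrightarrow> C $ i $ k = 0) \<and> A = C ** adj C"
  using assms
proof (induction S arbitrary: A rule: finite_induct)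
  case empty
  then have "A = 0" by (simp add: vec_eq_iff)
  then show ?case by (intro exI[of _ 0]) (simp add: matrix_matrix_mult_def vec_eq_iff)
next
  case (insert s S)
  note herm = insert.prems(1) and psd = insert.prems(2) and supp = insert.prems(3)
  define a where "a = Re (A $ s $ s)"
  have Ass: "A $ s $ s = of_real a"
    using herm[of s s] by (simp add: a_def complex_eq_iff)
  show ?case
  proof (cases "a = 0")
    case True
    then have "A $ s $ j = 0" for j
      using psd_zero_diagonal[OF herm psd] Ass by simp
    then have "A $ i $ j = 0" if "i \<notin> S" for i j
      using supp[of i j] that by (cases "i = s") auto
    from insert.IH[OF herm psd this] show ?thesis by blast
  next
    case False
    have "0 \<le> a"
    proof -
      have "(\<Sum>j\<in>UNIV. A $ s $ j * cnj (axis s 1 $ j)) = (\<Sum>j\<in>UNIV. if j = s then A $ s $ j else 0)"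
        by (rule sum.cong) (auto simp: axis_def)
      then have "sesq A (axis s 1) (axis s 1) = of_real a"
        by (simp add: sesq_axis_left Ass)
      then show ?thesis using psd[of "axis s 1"] by simp
    qed
    with False have a: "0 < a" by simp
    define c where "c i = A $ i $ s / of_real (sqrt a)" for i
    have cc: "c i * cnj (c j) = A $ i $ s * A $ s $ j / of_real a" for i j
      using a by (simp add: c_def herm[of j s] flip: of_real_mult)
    define B :: "complex ^ 'n ^ 'n" where "B = (\<chi> i j. A $ i $ j - c i * cnj (c j))"
    have B_herm: "B $ j $ i = cnj (B $ i $ j)" for i j
      by (simp add: B_def herm[of i j] mult.commute)
    have B_psd: "0 \<le> Re (sesq B v v)" for v
    proof -
      define y where "y = (\<Sum>i\<in>UNIV. v $ i * A $ i $ s)"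
      have y': "cnj y = (\<Sum>j\<in>UNIV. A $ s $ j * cnj (v $ j))"
        by (simp add: y_def herm[of s] mult.commute)
      \<comment> \<open>This \<open>x\<close> minimises the form of \<open>A\<close> over v + x e_s.
        The minimum is the form of the Schur complement \<open>B\<close> at \<open>v\<close>, so
        \<open>B\<close> inherits semidefiniteness.\<close>
      define x where "x = - y / of_real a"
      have x1: "x * of_real a = - y" using a by (simp add: x_def)
      have ax: "sesq A (axis s x) u = x * (\<Sum>j\<in>UNIV. A $ s $ j * cnj (u $ j))" for u
        by (rule sesq_axis_left)
      have sx: "(\<Sum>j\<in>UNIV. A $ s $ j * cnj (axis s x $ j)) = of_real a * cnj x"
      proof -
        have "(\<Sum>j\<in>UNIV. A $ s $ j * cnj (axis s x $ j)) = (\<Sum>j\<in>UNIV. if j = s then A $ s $ j * cnj x else 0)"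
          by (rule sum.cong) (auto simp: axis_def)
        then show ?thesis by (simp add: Ass)
      qed
      have "sesq A v (axis s x) = cnj (sesq A (axis s x) v)"
        by (rule cnj_sesq[OF herm, symmetric])
      then have "sesq A (v + axis s x) (v + axis s x)
          = sesq A v v + cnj (x * cnj y) + x * cnj y + x * of_real a * cnj x"
        by (simp add: sesq_add_left sesq_add_right ax sx y')
      also have "\<dots> = sesq A v v + x * cnj y"
        by (simp add: x1)
      also have "x * cnj y = - (y * cnj y / of_real a)"
        by (simp add: x_def mult.commute)
      also have "sesq A v v + - (y * cnj y / of_real a) = sesq B v v"
      proof -
        have "sesq B v v = sesq A v v - (\<Sum>i\<in>UNIV. \<Sum>j\<in>UNIV. v $ i * (c i * cnj (c j)) * cnj (v $ j))"
          by (simp add: sesq_def B_def sum_subtractf algebra_simps)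
        moreover have "(\<Sum>i\<in>UNIV. \<Sum>j\<in>UNIV. v $ i * (c i * cnj (c j)) * cnj (v $ j)) = y * cnj y / of_real a"
          unfolding cc y_def y'[unfolded y_def]
          by (simp add: sum_product sum_divide_distrib mult_ac)
        ultimately show ?thesis by simp
      qed
      finally show ?thesis
        using psd[of "v + axis s x"] by simp
    qed
    have B_supp: "B $ i $ j = 0" if "i \<notin> S" for i j
    proof (cases "i = s")
      case True
      then show ?thesis using a by (simp add: B_def cc Ass)
    next
      case False
      with that have "A $ i $ j = 0" for j using supp by blast
      then show ?thesis by (simp add: B_def c_def)
    qed
    obtain C where C: "\<And>i k. k \<notin> S \<Longrightarrow> C $ i $ k = 0" "B = C ** adj C"
      using insert.IH[OF B_herm B_psd B_supp] by blast
    define C' :: "complex ^ 'n ^ 'n" where "C' = (\<chi> i k. if k = s then c i else C $ i $ k)"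
    have "A = C' ** adj C'"
    proof -
      have "A $ i $ j = (C' ** adj C') $ i $ j" for i j
      proof -
        have "(C' ** adj C') $ i $ j = (\<Sum>k\<in>UNIV. C' $ i $ k * cnj (C' $ j $ k))"
          by (simp add: matrix_matrix_mult_def transpose_def)
        also have "\<dots> = c i * cnj (c j) + (\<Sum>k\<in>UNIV - {s}. C $ i $ k * cnj (C $ j $ k))"
          by (subst sum.remove[of _ s]) (auto simp: C'_def intro!: sum.cong)
        also have "(\<Sum>k\<in>UNIV - {s}. C $ i $ k * cnj (C $ j $ k)) = (\<Sum>k\<in>UNIV. C $ i $ k * cnj (C $ j $ k))"
          using C(1)[of s] insert.hyps(2) by (subst (2) sum.remove[of _ s]) auto
        also have "\<dots> = B $ i $ j"
          by (simp add: C(2) matrix_matrix_mult_def transpose_def)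
        finally show ?thesis by (simp add: B_def)
      qed
      then show ?thesis by (simp add: vec_eq_iff)
    qed
    moreover have "\<forall>i k. k \<notin> insert s S \<longrightarrow> C' $ i $ k = 0"
      by (auto simp: C'_def C(1))
    ultimately show ?thesis by blast
  qed
qed

text \<open>Semidefiniteness yields the factor; definiteness gives \<open>A\<close> a trivial
  kernel, and then the factor is invertible because \<open>A\<close> is.\<close>

lemma positive_definite_factor:
  fixes A :: "complex ^ 'n ^ 'n"
  assumes "positive_definite A"
  obtains C :: "complex ^ 'n ^ 'n" where "A = C ** adj C" "det C \<noteq> 0"
proof -
  have herm: "A $ j $ i = cnj (A $ i $ j)" for i j
    using assms unfolding positive_definite_def transpose_def vec_eq_iff by simp
  have pd: "0 < Re (sesq A v v)" if "v \<noteq> 0" for v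
    using assms that unfolding positive_definite_def sesq_def by blast
  then have psd: "0 \<le> Re (sesq A v v)" for v
    by (cases "v = 0") (auto simp: sesq_def less_imp_le)
  have "\<exists>C :: complex ^ 'n ^ 'n. (\<forall>i k. k \<notin> UNIV \<longrightarrow> C $ i $ k = 0) \<and> A = C ** adj C"
  proof (rule psd_factor_aux)
    show "A $ j $ i = cnj (A $ i $ j)" for i j by (rule herm)
    show "0 \<le> Re (sesq A v v)" for v by (rule psd)
  qed simp_all
  then obtain C :: "complex ^ 'n ^ 'n" where C: "A = C ** adj C" by blast
  have "x = 0" if "A *v x = 0" for x
  proof (rule ccontr)
    assume "x \<noteq> 0"
    define b where "b = (\<chi> j. cnj (x $ j))"
    have "b \<noteq> 0" using \<open>x \<noteq> 0\<close> by (simp add: b_def vec_eq_iff)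
    moreover have "sesq A b b = 0"
      using that by (simp add: sesq_eq_matrix_vector b_def)
    ultimately show False using pd[of b] by simp
  qed
  then have "invertible A"
    using matrix_left_invertible_ker invertible_left_inverse by blast
  then have "det A \<noteq> 0" by (simp add: invertible_det_nz)
  then have "det C \<noteq> 0" by (auto simp: C det_mul)
  with C that show ?thesis by blast
qed

lemma trace_mult_adj: "trace (Q ** adj Q) = of_real (\<Sum>i\<in>UNIV. \<Sum>j\<in>UNIV. (cmod (Q $ i $ j))\<^sup>2)"
  by (simp add: trace_def matrix_matrix_mult_def transpose_def complex_norm_square del: of_real_power)

text \<open>For H = Q Q^* the number S is the sum of all |H_ij|^2. Cauchy-Schwarz on the rows of Q
  gives |H_ij|^2 \<le> H_ii H_jj, hence S \<le> F^2. Keeping only the diagonal and applying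
  Cauchy-Schwarz to it gives the other bound. No eigenvalues are involved.\<close>

lemma trace_gram_square_bounds:
  fixes Q :: "complex ^ 'n ^ 'n"
  defines "F \<equiv> (\<Sum>i\<in>UNIV. \<Sum>j\<in>UNIV. (cmod (Q $ i $ j))\<^sup>2)"
  obtains S where "trace (Q ** adj Q ** (Q ** adj Q)) = of_real S"
    "F\<^sup>2 \<le> real CARD('n) * S" "S \<le> F\<^sup>2"
proof -
  define H where "H i j = (\<Sum>k\<in>UNIV. Q $ i $ k * cnj (Q $ j $ k))" for i j
  define n where "n i = (\<Sum>j\<in>UNIV. (cmod (Q $ i $ j))\<^sup>2)" for i
  define S where "S = (\<Sum>i\<in>UNIV. \<Sum>j\<in>UNIV. (cmod (H i j))\<^sup>2)"
  have Hji: "H j i = cnj (H i j)" for i j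
    by (simp add: H_def mult.commute)
  have Hii: "H i i = of_real (n i)" for i
    by (simp add: H_def n_def complex_norm_square del: of_real_power)
  have "(Q ** adj Q) $ i $ j = H i j" for i j
    by (simp add: H_def matrix_matrix_mult_def transpose_def)
  then have "trace (Q ** adj Q ** (Q ** adj Q)) = (\<Sum>i\<in>UNIV. \<Sum>j\<in>UNIV. H i j * H j i)"
    unfolding trace_def by (subst matrix_matrix_mult_def) simp
  also have "\<dots> = of_real S"
  proof -
    have "H i j * H j i = of_real ((cmod (H i j))\<^sup>2)" for i j
      by (subst Hji[of j i]) (rule complex_norm_square[symmetric])
    then show ?thesis by (simp add: S_def)
  qed
  finally have 1: "trace (Q ** adj Q ** (Q ** adj Q)) = of_real S" .
  have "(cmod (H i j))\<^sup>2 \<le> n i * n j" for i j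
  proof -
    have "cmod (H i j) \<le> (\<Sum>k\<in>UNIV. cmod (Q $ i $ k) * cmod (Q $ j $ k))"
      unfolding H_def by (rule order_trans[OF norm_sum]) (simp add: norm_mult)
    then have "(cmod (H i j))\<^sup>2 \<le> (\<Sum>k\<in>UNIV. cmod (Q $ i $ k) * cmod (Q $ j $ k))\<^sup>2"
      by (intro power_mono) auto
    also have "\<dots> \<le> n i * n j"
      unfolding n_def by (rule Cauchy_Schwarz_ineq_sum)
    finally show ?thesis .
  qed
  then have "S \<le> (\<Sum>i\<in>UNIV. \<Sum>j\<in>UNIV. n i * n j)"
    unfolding S_def by (intro sum_mono)
  also have "\<dots> = F\<^sup>2"
    unfolding F_def n_def[symmetric] power2_eq_square[of "\<Sum>i\<in>UNIV. n i"] sum_product ..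
  finally have 2: "S \<le> F\<^sup>2" .
  have "F\<^sup>2 = (\<Sum>i\<in>UNIV. n i)\<^sup>2" by (simp add: F_def n_def)
  also have "\<dots> \<le> (\<Sum>i\<in>UNIV. (n i)\<^sup>2) * real CARD('n)"
    by (rule sum_squared_le_sum_of_squares)
  also have "(\<Sum>i\<in>UNIV. (n i)\<^sup>2) \<le> S"
    unfolding S_def
  proof (intro sum_mono)
    fix i
    have "(n i)\<^sup>2 = (cmod (H i i))\<^sup>2" by (simp add: Hii)
    also have "\<dots> \<le> (\<Sum>j\<in>UNIV. (cmod (H i j))\<^sup>2)"
      by (rule member_le_sum) auto
    finally show "(n i)\<^sup>2 \<le> (\<Sum>j\<in>UNIV. (cmod (H i j))\<^sup>2)" .
  qed
  finally have 3: "F\<^sup>2 \<le> real CARD('n) * S" by (simp add: mult.commute)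
  show ?thesis by (rule that[OF 1 3 2])
qed

text \<open>The product P A cj(P) cj(A) is in general not Hermitian. Moving the factor D of P = D
  D^* cyclically to the end of the trace turns it into Q Q^* with Q = D^* A cj(D); symmetry of A
  enters in the formula for Q^*. The last claim makes the resulting norm definite.\<close>

lemma twisted_gram:
  fixes P A D :: "complex ^ 'n ^ 'n"
  assumes P: "P = D ** adj D" and sym: "transpose A = A" and NP: "N ** P = mat 1"
  obtains Q :: "complex ^ 'n ^ 'n" where "trace (P ** A ** cj P ** cj A) = trace (Q ** adj Q)"
    "trace (P ** A ** cj P ** cj A ** (P ** A ** cj P ** cj A)) = trace (Q ** adj Q ** (Q ** adj Q))"
    "Q = 0 \<Longrightarrow> A = 0"
proof -
  define Q where "Q = adj D ** A ** cj D"
  have aQ: "adj Q = transpose D ** cj A ** D"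
    by (simp add: Q_def cj_mult cj_transpose[symmetric] matrix_transpose_mul sym matrix_mul_assoc)
  have cP: "cj P = cj D ** transpose D"
    by (simp add: P cj_mult cj_transpose[symmetric])
  have X: "P ** A ** cj P ** cj A = D ** (Q ** transpose D ** cj A)"
    unfolding cP by (simp add: P Q_def matrix_mul_assoc)
  have QQ: "Q ** adj Q = (Q ** transpose D ** cj A) ** D"
    by (simp add: aQ matrix_mul_assoc)
  have 1: "trace (P ** A ** cj P ** cj A) = trace (Q ** adj Q)"
    unfolding X QQ by (rule trace_mul_sym)
  have "trace (D ** Y ** (D ** Y)) = trace (Y ** D ** (Y ** D))" for Y :: "complex ^ 'n ^ 'n"
    using trace_mul_sym[of D "Y ** D ** Y"] by (simp add: matrix_mul_assoc)
  then have 2: "trace (P ** A ** cj P ** cj A ** (P ** A ** cj P ** cj A)) = trace (Q ** adj Q ** (Q ** adj Q))"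
    unfolding X QQ by blast
  have 3: "A = 0" if "Q = 0"
  proof -
    have PN: "P ** N = mat 1" using NP matrix_left_right_inverse by blast
    have "P ** A ** cj P = D ** Q ** transpose D"
      unfolding cP by (simp add: P Q_def matrix_mul_assoc)
    then have 0: "P ** A ** cj P = 0"
      by (simp add: that matrix_matrix_mult_def vec_eq_iff)
    have cPN: "cj P ** cj N = mat 1"
      using PN by (simp add: cj_mult[symmetric])
    have "A = (N ** P) ** A ** (cj P ** cj N)"
      by (simp add: NP cPN matrix_mul_rid matrix_mul_lid)
    also have "\<dots> = N ** (P ** A ** cj P) ** cj N"
      by (simp add: matrix_mul_assoc)
    also have "\<dots> = 0"
      unfolding 0 by (simp add: matrix_matrix_mult_def vec_eq_iff)
    finally show ?thesis .
  qed
  show ?thesis by (rule that[OF 1 2 3])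
qed

section \<open>Jets of the potential along a quadratic curve\<close>

definition mscale :: "complex \<Rightarrow> complex ^ 'n ^ 'm \<Rightarrow> complex ^ 'n ^ 'm" where
  "mscale s X = (\<chi> i j. s * X $ i $ j)"

lemma mscale_mult_left: "mscale s X ** Y = mscale s (X ** Y)"
  by (simp add: mscale_def matrix_matrix_mult_def vec_eq_iff sum_distrib_left mult.assoc)

lemma mscale_mult_right: "X ** mscale s Y = mscale s (X ** Y)"
  by (simp add: mscale_def matrix_matrix_mult_def vec_eq_iff sum_distrib_left mult_ac)

lemma trace_mscale: "trace (mscale s X) = s * trace X"
  by (simp add: mscale_def trace_def sum_distrib_left)

lemma cj_mscale: "cj (mscale s X) = mscale (cnj s) (cj X)"
  by (simp add: mscale_def vec_eq_iff)

lemma transpose_mscale: "transpose (mscale s X) = mscale s (transpose X)"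
  by (simp add: mscale_def vec_eq_iff transpose_def)

lemma transpose_add: "transpose (X + Y) = transpose X + transpose (Y :: complex ^ 'n ^ 'm)"
  by (simp add: vec_eq_iff transpose_def)

lemma transpose_diff: "transpose (X - Y) = transpose X - transpose (Y :: complex ^ 'n ^ 'm)"
  by (simp add: vec_eq_iff transpose_def)

lemma matrix_mult_minus_left: "- X ** Y = - (X ** (Y :: complex ^ 'n ^ 'm))"
  by (simp add: matrix_matrix_mult_def vec_eq_iff sum_negf)

lemma matrix_mult_minus_right: "X ** - Y = - (X ** (Y :: complex ^ 'n ^ 'm))"
  by (simp add: matrix_matrix_mult_def vec_eq_iff sum_negf)

lemma matrix_mult_diff_left: "(X - Y) ** V = X ** V - Y ** (V :: complex ^ 'n ^ 'm)"
  by (simp add: matrix_matrix_mult_def vec_eq_iff sum_subtractf algebra_simps)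

lemma matrix_mult_diff_right: "V ** (X - Y) = V ** X - V ** (Y :: complex ^ 'n ^ 'm)"
  by (simp add: matrix_matrix_mult_def vec_eq_iff sum_subtractf algebra_simps)

lemma matrix_mult_zero: "0 ** (X :: complex ^ 'n ^ 'm) = 0" "(X :: complex ^ 'n ^ 'm) ** 0 = 0"
  by (simp_all add: matrix_matrix_mult_def vec_eq_iff)

lemma matrix_mult_add_left: "(X + Y) ** V = X ** V + Y ** (V :: complex ^ 'n ^ 'm)"
  by (simp add: matrix_matrix_mult_def vec_eq_iff sum.distrib algebra_simps)

text \<open>Here \<open>*\<close> is the entrywise product and the numeral \<open>2\<close> the
  matrix with all entries 2.\<close>

lemma two_mult_matrix: "2 * (X :: complex ^ 'n ^ 'm) = mscale 2 X"
  unfolding mult_2 by (simp add: mscale_def vec_eq_iff)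

lemma mscale_add: "mscale s (X + Y) = mscale s X + mscale s Y"
  by (simp add: mscale_def vec_eq_iff algebra_simps)

lemma mscale_mscale: "mscale s (mscale r X) = mscale (s * r) X"
  by (simp add: mscale_def vec_eq_iff)

lemma has_mwirt_mscale: "has_mwirt M P Q t \<Longrightarrow> has_mwirt (\<lambda>t. mscale s (M t)) (mscale s P) (mscale s Q) t"
  unfolding has_mwirt_def mscale_def by (auto intro!: has_wirt_rhs[OF has_wirt_mult[OF has_wirt_const]])

lemmas matrix_ring_simps = two_mult_matrix mscale_mult_left mscale_mult_right mscale_add matrix_add_ldistrib matrix_mult_add_left
  matrix_mult_minus_left matrix_mult_minus_right matrix_mult_zero

lemma trace_minus: "trace (- X) = - trace (X :: complex ^ 'n ^ 'n)"
  by (simp add: trace_def sum_negf)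

text \<open>For symmetric Z the conjugate of Z is its adjoint, so the matrix is Hermitian.\<close>

lemma det_I_minus_cj:
  assumes "transpose Z = (Z :: complex ^ 'n ^ 'n)"
  shows "cnj (det (mat 1 - Z ** cj Z)) = det (mat 1 - Z ** cj Z)"
proof -
  have "transpose (cj (mat 1 - Z ** cj Z)) = mat 1 - Z ** cj Z"
    by (simp add: cj_diff cj_mult transpose_diff matrix_transpose_mul cj_transpose[symmetric] assms)
  then have "det (cj (mat 1 - Z ** cj Z)) = det (mat 1 - Z ** cj Z)"
    by (metis det_transpose)
  then show ?thesis by (simp add: det_cj)
qed

text \<open>The push-through identity (1 - cj(Z) Z) cj(Z) = cj(Z) (1 - Z cj(Z)) and its mirror
  image, multiplied by the inverses on both sides. These rewritings keep the derivatives of the jets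
  within expressions in the two resolvents.\<close>

lemma resolvent_identities:
  fixes Z P R :: "complex ^ 'n ^ 'n"
  assumes P: "P ** (mat 1 - Z ** cj Z) = mat 1" and R: "R ** (mat 1 - cj Z ** Z) = mat 1"
  shows "cj Z ** P = R ** cj Z" "P ** Z = Z ** R" "cj P = R" "P = mat 1 + Z ** R ** cj Z"
proof -
  have P': "(mat 1 - Z ** cj Z) ** P = mat 1" and R': "(mat 1 - cj Z ** Z) ** R = mat 1"
    using P R matrix_left_right_inverse by blast+
  have "(mat 1 - cj Z ** Z) ** cj Z = cj Z ** (mat 1 - Z ** cj Z)"
    by (simp add: matrix_mult_diff_left matrix_mult_diff_right matrix_mul_assoc)
  then have "R ** ((mat 1 - cj Z ** Z) ** cj Z) ** P = R ** (cj Z ** (mat 1 - Z ** cj Z)) ** P"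
    by simp
  then have "(R ** (mat 1 - cj Z ** Z)) ** cj Z ** P = R ** cj Z ** ((mat 1 - Z ** cj Z) ** P)"
    by (simp add: matrix_mul_assoc)
  then show 1: "cj Z ** P = R ** cj Z"
    by (simp add: P' R)
  have "(mat 1 - Z ** cj Z) ** Z = Z ** (mat 1 - cj Z ** Z)"
    by (simp add: matrix_mult_diff_left matrix_mult_diff_right matrix_mul_assoc)
  then have "P ** ((mat 1 - Z ** cj Z) ** Z) ** R = P ** (Z ** (mat 1 - cj Z ** Z)) ** R"
    by simp
  then have "(P ** (mat 1 - Z ** cj Z)) ** Z ** R = P ** Z ** ((mat 1 - cj Z ** Z) ** R)"
    by (simp add: matrix_mul_assoc)
  then show 2: "P ** Z = Z ** R"
    by (simp add: P R')
  have "cj P ** (mat 1 - cj Z ** Z) = mat 1"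
    using arg_cong[OF P, of cj] by (simp add: cj_mult cj_diff)
  then show "cj P = R"
    using matrix_inv_unique[of "cj P"] matrix_inv_unique[OF R] by simp
  have "P - P ** Z ** cj Z = mat 1"
    using P by (simp add: matrix_mult_diff_right matrix_mul_assoc)
  then have "P = mat 1 + P ** Z ** cj Z"
    by (simp add: diff_eq_eq)
  then show "P = mat 1 + Z ** R ** cj Z"
    by (simp add: 2)
qed

definition ip :: "complex ^ 'n \<Rightarrow> complex ^ 'n \<Rightarrow> complex" where
  "ip x y = (\<Sum>j\<in>UNIV. x $ j * cnj (y $ j))"

lemma ip_add_left: "ip (x + x') y = ip x y + ip x' y"
  by (simp add: ip_def algebra_simps sum.distrib)

lemma ip_add_right: "ip x (y + y') = ip x y + ip x y'"
  by (simp add: ip_def algebra_simps sum.distrib)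

lemma ip_scale_left: "ip (s *s x) y = s * ip x y"
  by (simp add: ip_def sum_distrib_left mult.assoc)

lemma ip_scale_right: "ip x (s *s y) = cnj s * ip x y"
  by (simp add: ip_def sum_distrib_left mult_ac)

lemma ip_zero_left: "ip 0 y = 0"
  by (simp add: ip_def)

lemma ip_zero_right: "ip y 0 = 0"
  by (simp add: ip_def)

lemma cnj_ip: "cnj (ip x y) = ip y x"
  by (simp add: ip_def mult.commute)

lemma ip_self: "ip x x = of_real ((norm x)\<^sup>2)"
  by (simp add: ip_def norm_vec_def L2_set_def sum_nonneg complex_norm_square del: of_real_power)

definition has_vwirt :: "(complex \<Rightarrow> complex ^ 'n) \<Rightarrow> complex ^ 'n \<Rightarrow> complex ^ 'n \<Rightarrow> complex \<Rightarrow> bool" where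
  "has_vwirt x P Q t \<longleftrightarrow> (\<forall>j. has_wirt (\<lambda>t. x t $ j) (P $ j) (Q $ j) t)"

lemma has_vwirt_rhs: "has_vwirt f P Q t \<Longrightarrow> P = P' \<Longrightarrow> Q = Q' \<Longrightarrow> has_vwirt f P' Q' t"
  by simp

lemma has_vwirt_add:
  "has_vwirt x P Q t \<Longrightarrow> has_vwirt y P' Q' t \<Longrightarrow> has_vwirt (\<lambda>t. x t + y t) (P + P') (Q + Q') t"
  by (simp add: has_vwirt_def has_wirt_add)

lemma has_vwirt_const: "has_vwirt (\<lambda>t. x) 0 0 t"
  by (simp add: has_vwirt_def has_wirt_const)

lemma has_vwirt_scale:
  "has_wirt s P Q t \<Longrightarrow> has_vwirt y P' Q' t \<Longrightarrow>
    has_vwirt (\<lambda>t. s t *s y t) (P *s y t + s t *s P') (Q *s y t + s t *s Q') t"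
  unfolding has_vwirt_def by (auto intro: has_wirt_mult)

lemma has_wirt_ip:
  assumes "has_vwirt x P Q t" "has_vwirt y P' Q' t"
  shows "has_wirt (\<lambda>t. ip (x t) (y t)) (ip P (y t) + ip (x t) Q') (ip Q (y t) + ip (x t) P') t"
proof -
  have "has_wirt (\<lambda>t. \<Sum>j\<in>UNIV. x t $ j * cnj (y t $ j))
      (\<Sum>j\<in>UNIV. P $ j * cnj (y t $ j) + x t $ j * cnj (Q' $ j))
      (\<Sum>j\<in>UNIV. Q $ j * cnj (y t $ j) + x t $ j * cnj (P' $ j)) t"
    using assms unfolding has_vwirt_def
    by (intro has_wirt_sum has_wirt_mult has_wirt_cnj) auto
  then show ?thesis by (simp add: ip_def sum.distrib)
qed

text \<open>For a function that is real near \<open>t\<close>, only the derivative in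
  \<open>t\<close> has to be computed.\<close>

lemma has_wirt_real_bar:
  assumes "has_wirt f P Q t" "open U" "t \<in> U" "\<And>s. s \<in> U \<Longrightarrow> cnj (f s) = f s"
  shows "Q = cnj P"
  using has_wirt_unique(2)[OF assms(1) has_wirt_transform[OF has_wirt_cnj[OF assms(1)] assms(2,3)]] assms(4)
  by simp

text \<open>
  Write \<open>d\<close> and \<open>d'\<close> for the derivatives in \<open>t\<close> and \<open>cnj t\<close>.  Then \<open>f1\<close>, \<open>f2\<close>, \<open>F\<close>, \<open>F1\<close>, \<open>F2\<close> are
  \<open>d \<phi>\<close>, \<open>d d \<phi>\<close>, \<open>d d' \<phi>\<close>, \<open>d d d' \<phi>\<close>, \<open>d d d' d' \<phi>\<close>; the vectors \<open>\<alpha>\<close> and \<open>\<beta>\<close> are the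
  covariant derivatives \<open>(d + \<kappa> f1) w\<close> and \<open>(d + \<kappa> f1) \<alpha>\<close>; and \<open>\<psi>1\<close>, \<open>\<psi>2\<close>, \<open>\<psi>3\<close> and (below) \<open>\<psi>4\<close> are
  \<open>d' \<psi>\<close>, \<open>d d' \<psi>\<close>, \<open>d d d' \<psi>\<close>, \<open>d d d' d' \<psi>\<close>.
\<close>

locale jet_curve =
  fixes Z0 A B :: "complex ^ 'p ^ 'p" and w0 a b :: "complex ^ 'r" and \<kappa> :: real and U :: "complex set"
  assumes sym: "transpose Z0 = Z0" "transpose A = A" "transpose B = B"
    and U: "open U"
begin

definition Z :: "complex \<Rightarrow> complex ^ 'p ^ 'p" where
  "Z t = (\<chi> i j. Z0 $ i $ j + t * A $ i $ j + t\<^sup>2 / 2 * B $ i $ j)"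

definition Z1 :: "complex \<Rightarrow> complex ^ 'p ^ 'p" where
  "Z1 t = (\<chi> i j. A $ i $ j + t * B $ i $ j)"

definition w :: "complex \<Rightarrow> complex ^ 'r" where
  "w t = (\<chi> j. w0 $ j + t * a $ j + t\<^sup>2 / 2 * b $ j)"

definition w1 :: "complex \<Rightarrow> complex ^ 'r" where
  "w1 t = (\<chi> j. a $ j + t * b $ j)"

definition M :: "complex \<Rightarrow> complex ^ 'p ^ 'p" where "M t = mat 1 - Z t ** cj (Z t)"
definition P :: "complex \<Rightarrow> complex ^ 'p ^ 'p" where "P t = matrix_inv (M t)"
definition R :: "complex \<Rightarrow> complex ^ 'p ^ 'p" where "R t = matrix_inv (mat 1 - cj (Z t) ** Z t)"
definition N :: "complex \<Rightarrow> complex ^ 'p ^ 'p" where "N t = R t ** cj (Z t)"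
definition W :: "complex \<Rightarrow> complex ^ 'p ^ 'p" where "W t = R t ** cj (Z1 t) ** P t"
text \<open>The covariant second derivative of the curve for the metric with potential
  \<open>\<phi>\<close>: the derivative of \<open>F\<close> in \<open>t\<close> has the form of
  \<open>F\<close> with \<open>C\<close> in the place of the first \<open>Z1\<close>.\<close>

definition C :: "complex \<Rightarrow> complex ^ 'p ^ 'p" where
  "C t = B + mscale 2 (Z1 t ** N t ** Z1 t)"

definition \<phi> :: "complex \<Rightarrow> complex" where "\<phi> t = - Ln (det (M t))"
definition f1 :: "complex \<Rightarrow> complex" where "f1 t = trace (Z1 t ** N t)"
definition f2 :: "complex \<Rightarrow> complex" where "f2 t = trace ((B + Z1 t ** N t ** Z1 t) ** N t)"
definition F :: "complex \<Rightarrow> complex" where "F t = trace (Z1 t ** W t)"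
definition F1 :: "complex \<Rightarrow> complex" where "F1 t = trace (C t ** W t)"
definition S :: "complex \<Rightarrow> complex" where "S t = trace (Z1 t ** W t ** (Z1 t ** W t))"
text \<open>The first term is the squared norm of the covariant second derivative, the second one is
  the curvature contribution of the metric on the matrix part.\<close>

definition F2 :: "complex \<Rightarrow> complex" where
  "F2 t = trace (C t ** (R t ** cj (C t) ** P t)) + 2 * S t"

definition E :: "complex \<Rightarrow> complex" where "E t = exp (of_real \<kappa> * \<phi> t)"
definition \<alpha> :: "complex \<Rightarrow> complex ^ 'r" where "\<alpha> t = w1 t + (of_real \<kappa> * f1 t) *s w t"
definition \<beta> :: "complex \<Rightarrow> complex ^ 'r" where
  "\<beta> t = b + ((of_real \<kappa> * f2 t) *s w t + (of_real \<kappa> * f1 t) *s w1 t) + (of_real \<kappa> * f1 t) *s \<alpha> t"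
definition Y :: "complex \<Rightarrow> complex" where "Y t = E t * ip (w t) (w t)"
definition k :: "complex \<Rightarrow> complex" where "k t = E t * ip (\<alpha> t) (w t)"
definition \<nu> :: "complex \<Rightarrow> complex" where "\<nu> t = E t * ip (\<alpha> t) (\<alpha> t)"
definition l :: "complex \<Rightarrow> complex" where "l t = E t * ip (\<beta> t) (w t)"
definition lam :: "complex \<Rightarrow> complex" where "lam t = E t * ip (\<beta> t) (\<alpha> t)"
definition \<mu> :: "complex \<Rightarrow> complex" where "\<mu> t = E t * ip (\<beta> t) (\<beta> t)"
definition c :: "complex \<Rightarrow> complex" where "c t = inverse (1 - Y t)"

definition \<psi> :: "complex \<Rightarrow> complex" where "\<psi> t = of_real \<kappa> * \<phi> t - Ln (1 - Y t)"
definition \<psi>1 :: "complex \<Rightarrow> complex" where "\<psi>1 t = of_real \<kappa> * cnj (f1 t) + c t * cnj (k t)"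
definition \<psi>2 :: "complex \<Rightarrow> complex" where
  "\<psi>2 t = c t * (of_real \<kappa> * F t + \<nu> t) + (c t)\<^sup>2 * k t * cnj (k t)"
definition \<psi>3 :: "complex \<Rightarrow> complex" where
  "\<psi>3 t = 2 * c t * k t * \<psi>2 t + c t * (of_real \<kappa> * F1 t + lam t) + (c t)\<^sup>2 * l t * cnj (k t)"

lemma Z_0: "Z 0 = Z0" "Z1 0 = A" "w 0 = w0" "w1 0 = a"
  by (simp_all add: Z_def Z1_def w_def w1_def)

lemma sym_Z: "transpose (Z t) = Z t" "transpose (Z1 t) = Z1 t"
  using sym by (simp_all add: Z_def Z1_def transpose_def vec_eq_iff)

lemma has_wirt_square: "has_wirt (\<lambda>t. t\<^sup>2 / 2) t 0 t"
  by (rule has_wirt_rhs[OF has_wirt_chain[OF has_wirt_ident, of "\<lambda>t. t\<^sup>2 / 2" t]])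
     (auto intro!: derivative_eq_intros)

lemma has_wirt_quadratic: "has_wirt (\<lambda>t. x + t * y + t\<^sup>2 / 2 * z) (y + t * z) 0 t"
  by (rule has_wirt_rhs[OF has_wirt_add[OF has_wirt_add[OF has_wirt_const has_wirt_mult[OF has_wirt_ident has_wirt_const]]
        has_wirt_mult[OF has_wirt_square has_wirt_const]]]) simp_all

lemma has_wirt_affine: "has_wirt (\<lambda>t. x + t * y) y 0 t"
  by (rule has_wirt_rhs[OF has_wirt_add[OF has_wirt_const has_wirt_mult[OF has_wirt_ident has_wirt_const]]]) simp_all

lemma dZ: "has_mwirt Z (Z1 t) 0 t" "has_mwirt Z1 B 0 t"
  using has_wirt_quadratic has_wirt_affine by (simp_all add: has_mwirt_def Z_def Z1_def)

lemma dw: "has_vwirt w (w1 t) 0 t" "has_vwirt w1 b 0 t"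
  using has_wirt_quadratic has_wirt_affine by (simp_all add: has_vwirt_def w_def w1_def)

lemma dcjZ: "has_mwirt (\<lambda>t. cj (Z t)) 0 (cj (Z1 t)) t" "has_mwirt (\<lambda>t. cj (Z1 t)) 0 (cj B) t"
proof -
  have [simp]: "cj 0 = (0 :: complex ^ 'p ^ 'p)" by (simp add: vec_eq_iff)
  show "has_mwirt (\<lambda>t. cj (Z t)) 0 (cj (Z1 t)) t" "has_mwirt (\<lambda>t. cj (Z1 t)) 0 (cj B) t"
    using has_mwirt_cnj[OF dZ(1)[of t]] has_mwirt_cnj[OF dZ(2)[of t]] by simp_all
qed

lemma det_M_real: "cnj (det (M t)) = det (M t)"
  unfolding M_def by (rule det_I_minus_cj[OF sym_Z(1)])

end

text \<open>The second locale layer allows the positivity assumptions to speak about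
  \<open>M\<close> and \<open>Y\<close> of the curve. They place both arguments of \<open>Ln\<close>
  off its branch cut for every \<open>t\<close> in \<open>U\<close>.\<close>

locale good_jet_curve = jet_curve +
  assumes det_pos: "t \<in> U \<Longrightarrow> 0 < Re (det (M t))" and Y_lt: "t \<in> U \<Longrightarrow> Re (Y t) < 1"
begin

lemma det_M_nz: "t \<in> U \<Longrightarrow> det (M t) \<noteq> 0"
  using det_pos by force

lemma inv:
  assumes "t \<in> U"
  shows "P t ** (mat 1 - Z t ** cj (Z t)) = mat 1" "R t ** (mat 1 - cj (Z t) ** Z t) = mat 1"
proof -
  show "P t ** (mat 1 - Z t ** cj (Z t)) = mat 1"
    using matrix_inv_eq(1)[OF det_M_nz[OF assms]] by (simp add: P_def M_def)
  have "cj (M t) = mat 1 - cj (Z t) ** Z t"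
    by (simp add: M_def cj_diff cj_mult)
  then have "det (mat 1 - cj (Z t) ** Z t) \<noteq> 0"
    using det_M_nz[OF assms] by (metis det_cj complex_cnj_zero_iff)
  then show "R t ** (mat 1 - cj (Z t) ** Z t) = mat 1"
    unfolding R_def by (rule matrix_inv_eq)
qed

lemma res:
  assumes "t \<in> U"
  shows "cj (Z t) ** P t = R t ** cj (Z t)" "P t ** Z t = Z t ** R t" "cj (P t) = R t"
    "P t = mat 1 + Z t ** R t ** cj (Z t)"
  using resolvent_identities[OF inv[OF assms]] by blast+

lemma cj_R: "t \<in> U \<Longrightarrow> cj (R t) = P t"
  using res(3) by (metis cj_cj)

lemma dM: "has_mwirt M (- (Z1 t ** cj (Z t))) (- (Z t ** cj (Z1 t))) t"
  unfolding M_def [abs_def]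
  by (rule has_mwirt_rhs[OF has_mwirt_diff[OF has_mwirt_const has_mwirt_mult[OF dZ(1) dcjZ(1)]]])
     (simp_all add: matrix_ring_simps)

lemma dM': "has_mwirt (\<lambda>t. mat 1 - cj (Z t) ** Z t) (- (cj (Z t) ** Z1 t)) (- (cj (Z1 t) ** Z t)) t"
  by (rule has_mwirt_rhs[OF has_mwirt_diff[OF has_mwirt_const has_mwirt_mult[OF dcjZ(1) dZ(1)]]])
     (simp_all add: matrix_ring_simps)

lemma dP:
  assumes "t \<in> U"
  shows "has_mwirt P (P t ** Z1 t ** N t) (P t ** Z t ** cj (Z1 t) ** P t) t"
  unfolding P_def [abs_def]
proof (rule has_mwirt_rhs[OF has_mwirt_matrix_inv[OF dM U assms det_M_nz]])
  show "- (matrix_inv (M t) ** - (Z1 t ** cj (Z t)) ** matrix_inv (M t)) = matrix_inv (M t) ** Z1 t ** N t"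
    unfolding P_def[symmetric] N_def res(1)[OF assms, symmetric] by (simp add: matrix_ring_simps matrix_mul_assoc)
qed (simp_all add: matrix_ring_simps matrix_mul_assoc)

lemma dR:
  assumes "t \<in> U"
  shows "has_mwirt R (N t ** Z1 t ** R t) (R t ** cj (Z1 t) ** Z t ** R t) t"
  unfolding R_def [abs_def]
proof (rule has_mwirt_rhs[OF has_mwirt_matrix_inv[OF dM' U assms]])
  show "det (mat 1 - cj (Z s) ** Z s) \<noteq> 0" if "s \<in> U" for s
    using inv(2)[OF that] by (metis det_I det_mul mult_zero_right zero_neq_one)
qed (simp_all add: N_def R_def[symmetric] matrix_ring_simps matrix_mul_assoc)

lemma dN:
  assumes "t \<in> U"
  shows "has_mwirt N (N t ** Z1 t ** N t) (W t) t"
  unfolding N_def [abs_def]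
proof (rule has_mwirt_rhs[OF has_mwirt_mult[OF dR[OF assms] dcjZ(1)]])
  show "N t ** Z1 t ** R t ** cj (Z t) + R t ** 0 = R t ** cj (Z t) ** Z1 t ** (R t ** cj (Z t))"
    by (simp add: N_def matrix_ring_simps matrix_mul_assoc)
  \<comment> \<open>Expanding \<open>P t\<close> by the resolvent identity P = 1 + Z R cj(Z)
    reproduces the two terms of the product rule.\<close>
  have "W t = R t ** cj (Z1 t) ** (mat 1 + Z t ** R t ** cj (Z t))"
    unfolding W_def using res(4)[OF assms] by simp
  then show "R t ** cj (Z1 t) ** Z t ** R t ** cj (Z t) + R t ** cj (Z1 t) = W t"
    by (simp add: matrix_ring_simps matrix_mul_assoc)
qed

lemma cj_C:
  assumes "t \<in> U"
  shows "cj (C t) = cj B + mscale 2 (cj (Z1 t) ** Z t ** R t ** cj (Z1 t))"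
proof -
  have "cj (N t) = Z t ** R t"
    by (simp add: N_def cj_mult cj_R[OF assms] res(2)[OF assms])
  then show ?thesis
    by (simp add: C_def cj_add cj_mult cj_mscale matrix_mul_assoc)
qed

text \<open>Differentiating the three factors in \<open>cnj t\<close> turns \<open>cj (Z1 t)\<close>
  into \<open>cj (C t)\<close>: the derivatives of the two resolvents supply exactly the correction
  terms of the covariant derivative.\<close>

lemma dW:
  assumes "t \<in> U"
  shows "has_mwirt W (N t ** Z1 t ** W t + W t ** Z1 t ** N t) (R t ** cj (C t) ** P t) t"
  unfolding W_def [abs_def]
proof (rule has_mwirt_rhs[OF has_mwirt_mult[OF has_mwirt_mult[OF dR[OF assms] dcjZ(2)] dP[OF assms]]])
  show "(N t ** Z1 t ** R t ** cj (Z1 t) + R t ** 0) ** P t + R t ** cj (Z1 t) ** (P t ** Z1 t ** N t) =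
    N t ** Z1 t ** (R t ** cj (Z1 t) ** P t) + R t ** cj (Z1 t) ** P t ** Z1 t ** N t"
    by (simp add: matrix_ring_simps matrix_mul_assoc)
  have "R t ** cj (Z1 t) ** (P t ** Z t ** cj (Z1 t) ** P t) = R t ** cj (Z1 t) ** (Z t ** R t ** cj (Z1 t) ** P t)"
    by (simp add: res(2)[OF assms])
  then show "(R t ** cj (Z1 t) ** Z t ** R t ** cj (Z1 t) + R t ** cj B) ** P t +
      R t ** cj (Z1 t) ** (P t ** Z t ** cj (Z1 t) ** P t) = R t ** cj (C t) ** P t"
    by (simp add: cj_C[OF assms] matrix_ring_simps matrix_mul_assoc add_ac)
qed

lemma \<phi>_real: "t \<in> U \<Longrightarrow> cnj (\<phi> t) = \<phi> t"
proof -
  assume t: "t \<in> U"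
  have "det (M t) = of_real (Re (det (M t)))"
    using det_M_real[of t] by (simp add: complex_eq_iff)
  moreover have "Ln (of_real (Re (det (M t)))) = of_real (ln (Re (det (M t))))"
    using Ln_of_real[OF det_pos[OF t]] .
  ultimately show ?thesis
    unfolding \<phi>_def by (metis complex_cnj_complex_of_real complex_cnj_minus)
qed

lemma d\<phi>:
  assumes "t \<in> U"
  shows "has_wirt \<phi> (f1 t) (cnj (f1 t)) t"
proof -
  have notin: "det (M t) \<notin> \<real>\<^sub>\<le>\<^sub>0"
    using det_pos[OF assms] complex_nonpos_Reals_iff by auto
  have "has_wirt \<phi> (- (inverse (det (M t)) * (det (M t) * trace (P t ** - (Z1 t ** cj (Z t))))))
      (- (inverse (det (M t)) * (det (M t) * trace (P t ** - (Z t ** cj (Z1 t)))))) t"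
    unfolding \<phi>_def [abs_def]
    by (intro has_wirt_minus has_wirt_chain[OF has_wirt_det[OF dM]] has_field_derivative_Ln notin)
       (use inv(1)[OF assms] in \<open>simp add: M_def\<close>)
  moreover have "trace (P t ** (Z1 t ** cj (Z t))) = f1 t"
    unfolding f1_def N_def res(1)[OF assms, symmetric]
    by (subst trace_mul_sym) (simp add: matrix_mul_assoc)
  ultimately have 1: "has_wirt \<phi> (f1 t) (- (inverse (det (M t)) * (det (M t) * trace (P t ** - (Z t ** cj (Z1 t)))))) t"
    using det_M_nz[OF assms]
    by (elim has_wirt_rhs) (simp_all add: matrix_ring_simps trace_minus field_simps)
  then show ?thesis
    using has_wirt_real_bar[OF 1 U assms \<phi>_real] by simp
qed

lemma dZ1N:
  assumes "t \<in> U"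
  shows "has_mwirt (\<lambda>t. Z1 t ** N t) (B ** N t + Z1 t ** (N t ** Z1 t ** N t)) (Z1 t ** W t) t"
  by (rule has_mwirt_rhs[OF has_mwirt_mult[OF dZ(2) dN[OF assms]]]) (simp_all add: matrix_ring_simps)

lemma df1:
  assumes "t \<in> U"
  shows "has_wirt f1 (f2 t) (F t) t"
  unfolding f1_def [abs_def]
  by (rule has_wirt_rhs[OF has_wirt_trace[OF dZ1N[OF assms]]])
     (simp_all add: f2_def F_def matrix_ring_simps matrix_mul_assoc)

text \<open>Here and below, a derivative left existential is one that does not occur in the mixed
  jets; differentiability is still recorded for the product rule.\<close>

lemma dX:
  assumes "t \<in> U"
  shows "\<exists>X. has_mwirt (\<lambda>t. Z1 t ** N t ** Z1 t) X (Z1 t ** W t ** Z1 t) t"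
  by (rule exI, rule has_mwirt_rhs[OF has_mwirt_mult[OF dZ1N[OF assms] dZ(2)] refl]) (simp add: matrix_ring_simps)

lemma df2:
  assumes "t \<in> U"
  shows "\<exists>x. has_wirt f2 x (F1 t) t"
proof -
  obtain X where X: "has_mwirt (\<lambda>t. Z1 t ** N t ** Z1 t) X (Z1 t ** W t ** Z1 t) t"
    using dX[OF assms] by blast
  have "trace (Z1 t ** W t ** Z1 t ** N t) = trace (Z1 t ** N t ** Z1 t ** W t)"
    using trace_mul_sym[of "Z1 t ** W t" "Z1 t ** N t"] by (simp add: matrix_mul_assoc)
  then have "trace ((0 + Z1 t ** W t ** Z1 t) ** N t + (B + Z1 t ** N t ** Z1 t) ** W t) = F1 t"
    by (simp add: F1_def C_def matrix_ring_simps trace_add trace_mscale)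
  with has_wirt_trace[OF has_mwirt_mult[OF has_mwirt_add[OF has_mwirt_const[of B] X] dN[OF assms]]]
  show ?thesis unfolding f2_def [abs_def] by metis
qed

lemma F_real: "t \<in> U \<Longrightarrow> cnj (F t) = F t"
proof -
  assume t: "t \<in> U"
  have "cnj (F t) = trace (cj (Z1 t) ** P t ** (Z1 t ** R t))"
    by (simp add: F_def W_def trace_cj[symmetric] cj_mult cj_R[OF t] res(3)[OF t] matrix_mul_assoc)
  also have "\<dots> = trace (Z1 t ** R t ** (cj (Z1 t) ** P t))"
    by (rule trace_mul_sym)
  finally show ?thesis by (simp add: F_def W_def matrix_mul_assoc)
qed

lemma cnj_F1: "t \<in> U \<Longrightarrow> cnj (F1 t) = trace (Z1 t ** (R t ** cj (C t) ** P t))"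
proof -
  assume t: "t \<in> U"
  have "cnj (F1 t) = trace (cj (C t) ** P t ** (Z1 t ** R t))"
    by (simp add: F1_def W_def trace_cj[symmetric] cj_mult cj_R[OF t] res(3)[OF t] matrix_mul_assoc)
  also have "\<dots> = trace (Z1 t ** R t ** (cj (C t) ** P t))"
    by (rule trace_mul_sym)
  finally show ?thesis by (simp add: matrix_mul_assoc)
qed

lemma dF:
  assumes "t \<in> U"
  shows "has_wirt F (F1 t) (cnj (F1 t)) t"
proof -
  have "trace (Z1 t ** W t ** Z1 t ** N t) = trace (Z1 t ** N t ** Z1 t ** W t)"
    using trace_mul_sym[of "Z1 t ** W t" "Z1 t ** N t"] by (simp add: matrix_mul_assoc)
  then have "trace (B ** W t + Z1 t ** (N t ** Z1 t ** W t + W t ** Z1 t ** N t)) = F1 t"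
    by (simp add: F1_def C_def matrix_ring_simps trace_add trace_mscale matrix_mul_assoc)
  with has_wirt_trace[OF has_mwirt_mult[OF dZ(2) dW[OF assms]]]
  have "has_wirt F (F1 t) (trace (0 ** W t + Z1 t ** (R t ** cj (C t) ** P t))) t"
    unfolding F_def [abs_def] by simp
  then show ?thesis
    by (rule has_wirt_rhs) (simp_all add: cnj_F1[OF assms] matrix_mult_zero)
qed

lemma dF1:
  assumes "t \<in> U"
  shows "\<exists>x. has_wirt F1 x (F2 t) t"
proof -
  obtain X where X: "has_mwirt (\<lambda>t. Z1 t ** N t ** Z1 t) X (Z1 t ** W t ** Z1 t) t"
    using dX[OF assms] by blast
  have "has_mwirt C (0 + mscale 2 X) (0 + mscale 2 (Z1 t ** W t ** Z1 t)) t"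
    unfolding C_def [abs_def] by (intro has_mwirt_add has_mwirt_mscale has_mwirt_const X)
  from has_wirt_trace[OF has_mwirt_mult[OF this dW[OF assms]]]
  have "has_wirt F1 (trace ((0 + mscale 2 X) ** W t + C t ** (N t ** Z1 t ** W t + W t ** Z1 t ** N t))) (F2 t) t"
    unfolding F1_def [abs_def]
    by (rule has_wirt_rhs) (simp_all add: F2_def S_def matrix_ring_simps trace_add trace_mscale matrix_mul_assoc)
  then show ?thesis by blast
qed

end

section \<open>Jets of the fibre norm and of the full potential\<close>

context good_jet_curve
begin

lemma E_real: "t \<in> U \<Longrightarrow> cnj (E t) = E t"
  by (simp add: E_def exp_cnj \<phi>_real)

lemma dE:
  assumes "t \<in> U"
  shows "has_wirt E (of_real \<kappa> * f1 t * E t) (of_real \<kappa> * cnj (f1 t) * E t) t"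
proof -
  have "has_wirt (\<lambda>t. of_real \<kappa> * \<phi> t) (of_real \<kappa> * f1 t) (of_real \<kappa> * cnj (f1 t)) t"
    by (rule has_wirt_rhs[OF has_wirt_mult[OF has_wirt_const d\<phi>[OF assms]]]) simp_all
  then show ?thesis
    unfolding E_def [abs_def]
    by (rule has_wirt_rhs[OF has_wirt_chain[OF _ DERIV_exp]]) (simp_all add: mult.commute)
qed

text \<open>In the product rule the factor \<open>E\<close> turns \<open>d\<close> into the covariant derivative
  \<open>d + \<kappa> f1\<close> and leaves the conjugate derivative alone.\<close>

lemma dEip:
  assumes t: "t \<in> U" and x: "has_vwirt x x' x'' t" and y: "has_vwirt y y' y'' t"
  shows "has_wirt (\<lambda>t. E t * ip (x t) (y t))
    (E t * ip (x' + (of_real \<kappa> * f1 t) *s x t) (y t) + E t * ip (x t) y'')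
    (E t * ip x'' (y t) + E t * ip (x t) (y' + (of_real \<kappa> * f1 t) *s y t)) t"
  by (rule has_wirt_rhs[OF has_wirt_mult[OF dE[OF t] has_wirt_ip[OF x y]]])
     (simp_all add: ip_add_left ip_add_right ip_scale_left ip_scale_right algebra_simps)

lemma d\<kappa>f:
  assumes "t \<in> U"
  shows "has_wirt (\<lambda>t. of_real \<kappa> * f1 t) (of_real \<kappa> * f2 t) (of_real \<kappa> * F t) t"
    "\<exists>x. has_wirt (\<lambda>t. of_real \<kappa> * f2 t) x (of_real \<kappa> * F1 t) t"
proof -
  show "has_wirt (\<lambda>t. of_real \<kappa> * f1 t) (of_real \<kappa> * f2 t) (of_real \<kappa> * F t) t"
    by (rule has_wirt_rhs[OF has_wirt_mult[OF has_wirt_const df1[OF assms]]]) simp_all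
  obtain x where "has_wirt f2 x (F1 t) t" using df2[OF assms] by blast
  from has_wirt_mult[OF has_wirt_const this, of "of_real \<kappa>"]
  show "\<exists>x. has_wirt (\<lambda>t. of_real \<kappa> * f2 t) x (of_real \<kappa> * F1 t) t" by auto
qed

lemma d\<alpha>:
  assumes "t \<in> U"
  shows "has_vwirt \<alpha> (b + ((of_real \<kappa> * f2 t) *s w t + (of_real \<kappa> * f1 t) *s w1 t)) ((of_real \<kappa> * F t) *s w t) t"
  unfolding \<alpha>_def [abs_def]
  by (rule has_vwirt_rhs[OF has_vwirt_add[OF dw(2) has_vwirt_scale[OF d\<kappa>f(1)[OF assms] dw(1)]]]) simp_all

text \<open>The derivative in \<open>cnj t\<close> of \<open>\<kappa> f1\<close> is
  \<open>\<kappa> F\<close>, so this derivative commutes with the covariant derivative up to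
  multiplication by \<open>\<kappa> F\<close>. For \<open>w\<close> it gives
  \<open>\<kappa> F w\<close> as the conjugate derivative of \<open>\<alpha>\<close>; applied once
  more it gives \<open>\<kappa> F1 w\<close>, and \<open>\<kappa> F \<alpha>\<close> twice.\<close>

lemma d\<beta>:
  assumes "t \<in> U"
  shows "\<exists>x. has_vwirt \<beta> x ((of_real \<kappa> * F1 t) *s w t + (2 * of_real \<kappa> * F t) *s \<alpha> t) t"
proof -
  obtain x where x: "has_wirt (\<lambda>t. of_real \<kappa> * f2 t) x (of_real \<kappa> * F1 t) t"
    using d\<kappa>f(2)[OF assms] by blast
  show ?thesis
    unfolding \<beta>_def [abs_def]
    by (rule exI, rule has_vwirt_rhs[OF has_vwirt_add[OF has_vwirt_add[OF has_vwirt_const has_vwirt_add[OF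
        has_vwirt_scale[OF x dw(1)] has_vwirt_scale[OF d\<kappa>f(1)[OF assms] dw(2)]]]
        has_vwirt_scale[OF d\<kappa>f(1)[OF assms] d\<alpha>[OF assms]]] refl])
       (simp add: \<alpha>_def vec_eq_iff algebra_simps)
qed

lemma D\<alpha>: "b + ((of_real \<kappa> * f2 t) *s w t + (of_real \<kappa> * f1 t) *s w1 t) + (of_real \<kappa> * f1 t) *s \<alpha> t = \<beta> t"
  by (simp add: \<beta>_def)

lemma Dw: "w1 t + (of_real \<kappa> * f1 t) *s w t = \<alpha> t"
  by (simp add: \<alpha>_def)

lemma cnj_Eip: "t \<in> U \<Longrightarrow> cnj (E t * ip x y) = E t * ip y x"
  by (simp add: E_real cnj_ip)

lemma Y_real: "t \<in> U \<Longrightarrow> cnj (Y t) = Y t"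
  by (simp add: Y_def cnj_Eip del: complex_cnj_mult)

lemma \<nu>_real: "t \<in> U \<Longrightarrow> cnj (\<nu> t) = \<nu> t"
  by (simp add: \<nu>_def cnj_Eip del: complex_cnj_mult)

lemma cnj_k: "t \<in> U \<Longrightarrow> cnj (k t) = E t * ip (w t) (\<alpha> t)"
  by (simp add: k_def cnj_Eip del: complex_cnj_mult)

lemma dY:
  assumes "t \<in> U"
  shows "has_wirt Y (k t) (cnj (k t)) t"
  unfolding Y_def [abs_def]
  by (rule has_wirt_rhs[OF dEip[OF assms dw(1) dw(1)]])
     (simp_all add: Dw ip_zero_left ip_zero_right cnj_k assms k_def[symmetric])

lemma dk:
  assumes "t \<in> U"
  shows "has_wirt k (l t) (\<nu> t + of_real \<kappa> * F t * Y t) t"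
  unfolding k_def [abs_def]
  by (rule has_wirt_rhs[OF dEip[OF assms d\<alpha>[OF assms] dw(1)]])
     (simp_all add: D\<alpha> Dw ip_zero_left ip_zero_right ip_scale_left l_def \<nu>_def Y_def)

lemma d\<nu>:
  assumes "t \<in> U"
  shows "has_wirt \<nu> (lam t + of_real \<kappa> * F t * k t) (cnj (lam t + of_real \<kappa> * F t * k t)) t"
proof -
  have 1: "has_wirt \<nu> (lam t + of_real \<kappa> * F t * k t)
    (E t * ip ((of_real \<kappa> * F t) *s w t) (\<alpha> t) +
      E t * ip (\<alpha> t) (b + ((of_real \<kappa> * f2 t) *s w t + (of_real \<kappa> * f1 t) *s w1 t) + (of_real \<kappa> * f1 t) *s \<alpha> t)) t"
    unfolding \<nu>_def [abs_def]
    by (rule has_wirt_rhs[OF dEip[OF assms d\<alpha>[OF assms] d\<alpha>[OF assms]]])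
       (simp_all add: D\<alpha> ip_scale_right lam_def k_def F_real[OF assms])
  then show ?thesis
    using has_wirt_real_bar[OF 1 U assms \<nu>_real] by simp
qed

lemma dlam:
  assumes "t \<in> U"
  shows "\<exists>x. has_wirt lam x (of_real \<kappa> * F1 t * cnj (k t) + 2 * of_real \<kappa> * F t * \<nu> t + \<mu> t) t"
proof -
  obtain x where x: "has_vwirt \<beta> x ((of_real \<kappa> * F1 t) *s w t + (2 * of_real \<kappa> * F t) *s \<alpha> t) t"
    using d\<beta>[OF assms] by blast
  show ?thesis
    unfolding lam_def [abs_def]
    by (rule exI, rule has_wirt_rhs[OF dEip[OF assms x d\<alpha>[OF assms]] refl])
       (unfold D\<alpha>, simp add: ip_scale_left ip_add_left cnj_k[OF assms] \<nu>_def \<mu>_def algebra_simps)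
qed

lemma dl:
  assumes "t \<in> U"
  shows "\<exists>x. has_wirt l x (of_real \<kappa> * F1 t * Y t + 2 * of_real \<kappa> * F t * k t + lam t) t"
proof -
  obtain x where x: "has_vwirt \<beta> x ((of_real \<kappa> * F1 t) *s w t + (2 * of_real \<kappa> * F t) *s \<alpha> t) t"
    using d\<beta>[OF assms] by blast
  show ?thesis
    unfolding l_def [abs_def]
    by (rule exI, rule has_wirt_rhs[OF dEip[OF assms x dw(1)] refl])
       (simp add: Dw ip_scale_left ip_add_left Y_def k_def lam_def algebra_simps)
qed

lemma one_minus_Y_nz: "t \<in> U \<Longrightarrow> 1 - Y t \<noteq> 0"
  using Y_lt by force

lemma dc:
  assumes "t \<in> U"
  shows "has_wirt c ((c t)\<^sup>2 * k t) ((c t)\<^sup>2 * cnj (k t)) t"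
  unfolding c_def [abs_def]
  by (rule has_wirt_rhs[OF has_wirt_chain[OF has_wirt_diff[OF has_wirt_const dY[OF assms]] DERIV_inverse[OF one_minus_Y_nz[OF assms]]]])
     (simp_all add: power2_eq_square numeral_2_eq_2)

lemma c_real: "t \<in> U \<Longrightarrow> cnj (c t) = c t"
  by (simp add: c_def Y_real)

lemma c_nz: "t \<in> U \<Longrightarrow> c t \<noteq> 0"
  using one_minus_Y_nz by (simp add: c_def)

text \<open>Eliminating \<open>Y\<close> in favour of \<open>c\<close> turns the comparisons of jets
  below into rational identities with only powers of \<open>c\<close> in the denominators.\<close>

lemma Y_eq: "t \<in> U \<Longrightarrow> Y t = 1 - 1 / c t"
  using one_minus_Y_nz by (simp add: c_def inverse_eq_divide)

lemma d\<psi>: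
  assumes "t \<in> U"
  shows "\<exists>x. has_wirt \<psi> x (\<psi>1 t) t"
proof -
  have notin: "1 - Y t \<notin> \<real>\<^sub>\<le>\<^sub>0"
    using Y_lt[OF assms] complex_nonpos_Reals_iff by auto
  show ?thesis
    unfolding \<psi>_def [abs_def]
    by (rule exI, rule has_wirt_rhs[OF has_wirt_diff[OF has_wirt_mult[OF has_wirt_const d\<phi>[OF assms]]
          has_wirt_chain[OF has_wirt_diff[OF has_wirt_const dY[OF assms]] has_field_derivative_Ln[OF notin]]] refl])
       (simp add: \<psi>1_def c_def)
qed

lemma d\<psi>1:
  assumes "t \<in> U"
  shows "\<exists>x. has_wirt \<psi>1 (\<psi>2 t) x t"
proof -
  have "has_wirt \<psi>1 (\<psi>2 t) (0 * cnj (f1 t) + of_real \<kappa> * cnj (f2 t) + ((c t)\<^sup>2 * cnj (k t) * cnj (k t) + c t * cnj (l t))) t"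
    unfolding \<psi>1_def [abs_def]
    by (rule has_wirt_rhs[OF has_wirt_add[OF has_wirt_mult[OF has_wirt_const has_wirt_cnj[OF df1[OF assms]]]
         has_wirt_mult[OF dc[OF assms] has_wirt_cnj[OF dk[OF assms]]]]])
       (use c_nz[OF assms] in \<open>simp_all add: \<psi>2_def F_real assms \<nu>_real Y_real, simp add: Y_eq[OF assms] field_simps power2_eq_square\<close>)
  then show ?thesis by blast
qed

lemma \<psi>2_real: "t \<in> U \<Longrightarrow> cnj (\<psi>2 t) = \<psi>2 t"
  by (simp add: \<psi>2_def F_real \<nu>_real c_real)

lemma d\<psi>2:
  assumes "t \<in> U"
  shows "has_wirt \<psi>2 (\<psi>3 t) (cnj (\<psi>3 t)) t"
proof -
  have "\<exists>x. has_wirt \<psi>2 (\<psi>3 t) x t"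
    unfolding \<psi>2_def [abs_def] power2_eq_square
    by (rule exI, rule has_wirt_rhs[OF has_wirt_add[OF
        has_wirt_mult[OF dc[OF assms] has_wirt_add[OF has_wirt_mult[OF has_wirt_const dF[OF assms]] d\<nu>[OF assms]]]
        has_wirt_mult[OF has_wirt_mult[OF has_wirt_mult[OF dc[OF assms] dc[OF assms]] dk[OF assms]] has_wirt_cnj[OF dk[OF assms]]]] _ refl])
       (use c_nz[OF assms] in \<open>simp add: \<psi>3_def \<psi>2_def F_real assms \<nu>_real Y_real, simp add: Y_eq[OF assms] field_simps power2_eq_square\<close>)
  then obtain x where 1: "has_wirt \<psi>2 (\<psi>3 t) x t" by blast
  then show ?thesis
    using has_wirt_real_bar[OF 1 U assms \<psi>2_real] by simp
qed

text \<open>Grouped for the completion of the square: the first two terms depend on point and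
  velocity alone, and every other term is part of a Hermitian square in the second-order data
  \<open>C\<close>, \<open>\<beta>\<close> and \<open>l\<close>, shifted by first-order
  ones.\<close>

definition \<psi>4 :: "complex \<Rightarrow> complex" where
  "\<psi>4 t = 2 * (\<psi>2 t)\<^sup>2 + 2 * c t * (of_real \<kappa> * S t - (of_real \<kappa> * F t)\<^sup>2)
    + c t * (of_real \<kappa> * trace (C t ** (R t ** cj (C t) ** P t)) + \<mu> t
        + 2 * c t * (k t * cnj (of_real \<kappa> * F1 t + lam t) + cnj (k t) * (of_real \<kappa> * F1 t + lam t))
        + 4 * (c t)\<^sup>2 * k t * cnj (k t) * (of_real \<kappa> * F t + \<nu> t))
    + (c t)\<^sup>2 * (l t + 2 * c t * (k t)\<^sup>2) * cnj (l t + 2 * c t * (k t)\<^sup>2)"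

lemma d\<psi>3:
  assumes "t \<in> U"
  shows "\<exists>x. has_wirt \<psi>3 x (\<psi>4 t) t"
proof -
  obtain xl where xl: "has_wirt l xl (of_real \<kappa> * F1 t * Y t + 2 * of_real \<kappa> * F t * k t + lam t) t"
    using dl[OF assms] by blast
  obtain xm where xm: "has_wirt lam xm (of_real \<kappa> * F1 t * cnj (k t) + 2 * of_real \<kappa> * F t * \<nu> t + \<mu> t) t"
    using dlam[OF assms] by blast
  obtain xF where xF: "has_wirt F1 xF (F2 t) t"
    using dF1[OF assms] by blast
  show ?thesis
    unfolding \<psi>3_def [abs_def] power2_eq_square
    apply (rule exI, rule has_wirt_rhs[OF has_wirt_add[OF has_wirt_add[OF
        has_wirt_mult[OF has_wirt_mult[OF has_wirt_mult[OF has_wirt_const dc[OF assms]] dk[OF assms]] d\<psi>2[OF assms]]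
        has_wirt_mult[OF dc[OF assms] has_wirt_add[OF has_wirt_mult[OF has_wirt_const xF] xm]]]
        has_wirt_mult[OF has_wirt_mult[OF has_wirt_mult[OF dc[OF assms] dc[OF assms]] xl] has_wirt_cnj[OF dk[OF assms]]]] refl])
    apply (simp add: \<psi>4_def F2_def \<psi>3_def \<psi>2_def F_real \<nu>_real c_real assms)
    using c_nz[OF assms]
    apply (simp add: Y_eq[OF assms] divide_simps)
    apply (simp add: algebra_simps power2_eq_square)
    done
qed

end

context good_jet_curve
begin

lemma trace_twisted_square:
  assumes "t \<in> U"
  shows "trace ((C t + mscale s (Z1 t)) ** (R t ** cj (C t + mscale s (Z1 t)) ** P t))
    = trace (C t ** (R t ** cj (C t) ** P t)) + s * cnj (F1 t) + cnj s * F1 t + s * cnj s * F t"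
  using cnj_F1[OF assms]
  by (simp add: cj_add cj_mscale matrix_ring_simps trace_add trace_mscale F1_def F_def W_def mscale_mscale matrix_mul_assoc
      algebra_simps)

text \<open>The shift by s = 2 c k absorbs all the linear terms at once: the mixed terms with
  \<open>cnj (k t)\<close> and \<open>k t\<close> are the cross terms of the shift in
  \<open>C\<close> and \<open>\<beta>\<close>, the term with 4 c^2 |k|^2 is its square, and l + 2 c
  k^2 = l + s k is the pairing of the shifted \<open>\<beta>\<close> with \<open>w\<close>.\<close>

lemma \<psi>4_eq:
  assumes "t \<in> U"
  defines "s \<equiv> 2 * c t * k t"
  defines "C' \<equiv> C t + mscale s (Z1 t)" and "\<beta>' \<equiv> \<beta> t + s *s \<alpha> t"
  shows "\<psi>4 t = 2 * (\<psi>2 t)\<^sup>2 + 2 * c t * (of_real \<kappa> * S t - (of_real \<kappa> * F t)\<^sup>2)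
    + c t * (of_real \<kappa> * trace (C' ** (R t ** cj C' ** P t)) + E t * ip \<beta>' \<beta>')
    + (c t)\<^sup>2 * (E t * ip \<beta>' (w t)) * cnj (E t * ip \<beta>' (w t))"
proof -
  have 1: "E t * ip \<beta>' \<beta>' = \<mu> t + s * cnj (lam t) + cnj s * lam t + s * cnj s * \<nu> t"
    by (simp add: \<beta>'_def ip_add_left ip_add_right ip_scale_left ip_scale_right \<mu>_def lam_def \<nu>_def E_real[OF assms(1)]
        cnj_ip algebra_simps)
  have 2: "E t * ip \<beta>' (w t) = l t + s * k t"
    by (simp add: \<beta>'_def ip_add_left ip_scale_left l_def k_def algebra_simps)
  show ?thesis
    unfolding 1 2 C'_def trace_twisted_square[OF assms(1)]
    by (simp add: s_def \<psi>4_def c_real[OF assms(1)] algebra_simps power2_eq_square)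
qed

end

section \<open>Smoothness in several variables\<close>

text \<open>The total real derivative, written in Wirtinger form. \<open>wirt\<close> and
  \<open>wirt_bar\<close> are built from partial derivatives; the chain rule along curves needs the
  total one.\<close>

definition has_wderiv :: "(complex ^ 'n \<Rightarrow> complex) \<Rightarrow> ('n \<Rightarrow> complex) \<Rightarrow> ('n \<Rightarrow> complex) \<Rightarrow> complex ^ 'n::finite \<Rightarrow> bool" where
  "has_wderiv f a b \<zeta> \<longleftrightarrow> (f has_derivative (\<lambda>h. \<Sum>\<alpha>\<in>UNIV. a \<alpha> * h $ \<alpha> + b \<alpha> * cnj (h $ \<alpha>))) (at \<zeta>)"

lemma has_wderiv_real_partial:
  assumes "has_wderiv f a b \<zeta>"
  shows "real_partial z \<alpha> f \<zeta> = a \<alpha> * z + b \<alpha> * cnj z"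
proof -
  have "((\<lambda>t::real. \<zeta> + t *\<^sub>R axis \<alpha> z) has_derivative (\<lambda>t. t *\<^sub>R axis \<alpha> z)) (at 0)"
    by (auto intro!: derivative_eq_intros)
  moreover have "(f has_derivative (\<lambda>h. \<Sum>\<beta>\<in>UNIV. a \<beta> * h $ \<beta> + b \<beta> * cnj (h $ \<beta>))) (at (\<zeta> + (0::real) *\<^sub>R axis \<alpha> z))"
    using assms by (simp add: has_wderiv_def)
  ultimately have "((\<lambda>t::real. f (\<zeta> + t *\<^sub>R axis \<alpha> z)) has_derivative
     (\<lambda>t. \<Sum>\<beta>\<in>UNIV. a \<beta> * (t *\<^sub>R axis \<alpha> z) $ \<beta> + b \<beta> * cnj ((t *\<^sub>R axis \<alpha> z) $ \<beta>))) (at 0)"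
    by (rule has_derivative_compose)
  moreover have "(\<Sum>\<beta>\<in>UNIV. a \<beta> * (t *\<^sub>R axis \<alpha> z) $ \<beta> + b \<beta> * cnj ((t *\<^sub>R axis \<alpha> z) $ \<beta>)) = t *\<^sub>R (a \<alpha> * z + b \<alpha> * cnj z)" for t
  proof -
    have "(\<Sum>\<beta>\<in>UNIV. a \<beta> * (t *\<^sub>R axis \<alpha> z) $ \<beta> + b \<beta> * cnj ((t *\<^sub>R axis \<alpha> z) $ \<beta>))
      = (\<Sum>\<beta>\<in>UNIV. if \<beta> = \<alpha> then t *\<^sub>R (a \<alpha> * z + b \<alpha> * cnj z) else 0)"
    proof (rule sum.cong)
      fix \<beta>
      have "(t *\<^sub>R axis \<alpha> z) $ \<beta> = (if \<beta> = \<alpha> then t *\<^sub>R z else 0)" by (simp add: axis_def)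
      then show "a \<beta> * (t *\<^sub>R axis \<alpha> z) $ \<beta> + b \<beta> * cnj ((t *\<^sub>R axis \<alpha> z) $ \<beta>)
          = (if \<beta> = \<alpha> then t *\<^sub>R (a \<alpha> * z + b \<alpha> * cnj z) else 0)"
        by (simp add: scaleR_add_right)
    qed simp
    then show ?thesis by simp
  qed
  ultimately show ?thesis
    unfolding real_partial_def by (intro vector_derivative_at) (simp add: has_vector_derivative_def)
qed

lemma has_wderiv_wirt:
  assumes "has_wderiv f a b \<zeta>"
  shows "wirt \<alpha> f \<zeta> = a \<alpha>" "wirt_bar \<alpha> f \<zeta> = b \<alpha>"
  by (simp_all add: wirt_def wirt_bar_def has_wderiv_real_partial[OF assms] algebra_simps)

lemma has_wderiv_transform:
  assumes "has_wderiv f a b \<zeta>" "open S" "\<zeta> \<in> S" "\<And>\<xi>. \<xi> \<in> S \<Longrightarrow> f \<xi> = g \<xi>"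
  shows "has_wderiv g a b \<zeta>"
  using has_derivative_transform_within_open[OF assms(1)[unfolded has_wderiv_def] assms(2-4)]
  unfolding has_wderiv_def by simp

lemma has_wderiv_const: "has_wderiv (\<lambda>\<xi>. z) (\<lambda>\<alpha>. 0) (\<lambda>\<alpha>. 0) \<zeta>"
  unfolding has_wderiv_def by simp

lemma has_wderiv_coord: "has_wderiv (\<lambda>\<xi>. \<xi> $ \<gamma>) (\<lambda>\<alpha>. if \<alpha> = \<gamma> then 1 else 0) (\<lambda>\<alpha>. 0) \<zeta>"
proof -
  have "((\<lambda>\<xi>. \<xi> $ \<gamma>) has_derivative (\<lambda>h. h $ \<gamma>)) (at \<zeta>)"
    by (rule bounded_linear_imp_has_derivative[OF bounded_linear_vec_nth])
  then show ?thesis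
    unfolding has_wderiv_def by (simp add: if_distrib[of "\<lambda>x. x * _"] cong: if_cong)
qed

lemma has_wderiv_add:
  assumes "has_wderiv f a b \<zeta>" "has_wderiv g a' b' \<zeta>"
  shows "has_wderiv (\<lambda>\<xi>. f \<xi> + g \<xi>) (\<lambda>\<alpha>. a \<alpha> + a' \<alpha>) (\<lambda>\<alpha>. b \<alpha> + b' \<alpha>) \<zeta>"
  using has_derivative_add[OF assms[unfolded has_wderiv_def]]
  unfolding has_wderiv_def by (simp add: algebra_simps sum.distrib)

lemma has_wderiv_mult:
  assumes "has_wderiv f a b \<zeta>" "has_wderiv g a' b' \<zeta>"
  shows "has_wderiv (\<lambda>\<xi>. f \<xi> * g \<xi>) (\<lambda>\<alpha>. f \<zeta> * a' \<alpha> + a \<alpha> * g \<zeta>) (\<lambda>\<alpha>. f \<zeta> * b' \<alpha> + b \<alpha> * g \<zeta>) \<zeta>"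
  using has_derivative_mult[OF assms[unfolded has_wderiv_def]]
  unfolding has_wderiv_def
  by (simp add: algebra_simps sum.distrib sum_distrib_left sum_distrib_right)

lemma has_wderiv_cnj:
  assumes "has_wderiv f a b \<zeta>"
  shows "has_wderiv (\<lambda>\<xi>. cnj (f \<xi>)) (\<lambda>\<alpha>. cnj (b \<alpha>)) (\<lambda>\<alpha>. cnj (a \<alpha>)) \<zeta>"
  using has_derivative_cnj[OF assms[unfolded has_wderiv_def]]
  unfolding has_wderiv_def by (simp add: algebra_simps)

lemma has_wderiv_chain:
  assumes "has_wderiv f a b \<zeta>" "(g has_field_derivative g') (at (f \<zeta>))"
  shows "has_wderiv (\<lambda>\<xi>. g (f \<xi>)) (\<lambda>\<alpha>. g' * a \<alpha>) (\<lambda>\<alpha>. g' * b \<alpha>) \<zeta>"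
  using has_derivative_compose[OF assms(1)[unfolded has_wderiv_def] assms(2)[unfolded has_field_derivative_def]]
  unfolding has_wderiv_def by (simp add: algebra_simps sum_distrib_left)

text \<open>Differentiability to order \<open>n\<close> on \<open>S\<close>, with recursion on the
  coefficient functions. One predicate thus covers all iterated mixtures of \<open>wirt\<close> and
  \<open>wirt_bar\<close>, and closure under each operation is a single induction on the
  order.\<close>

primrec wsmooth :: "nat \<Rightarrow> (complex ^ 'n::finite) set \<Rightarrow> (complex ^ 'n \<Rightarrow> complex) \<Rightarrow> bool" where
  "wsmooth 0 S f \<longleftrightarrow> True"
| "wsmooth (Suc n) S f \<longleftrightarrow> (\<exists>a b. (\<forall>\<zeta>\<in>S. has_wderiv f (\<lambda>\<alpha>. a \<alpha> \<zeta>) (\<lambda>\<alpha>. b \<alpha> \<zeta>) \<zeta>) \<and>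
      (\<forall>\<alpha>. wsmooth n S (a \<alpha>) \<and> wsmooth n S (b \<alpha>)))"

lemma wsmooth_SucI:
  assumes "\<And>\<zeta>. \<zeta> \<in> S \<Longrightarrow> has_wderiv f (\<lambda>\<alpha>. a \<alpha> \<zeta>) (\<lambda>\<alpha>. b \<alpha> \<zeta>) \<zeta>"
    and "\<And>\<alpha>. wsmooth n S (a \<alpha>)" "\<And>\<alpha>. wsmooth n S (b \<alpha>)"
  shows "wsmooth (Suc n) S f"
  unfolding wsmooth.simps by (rule exI[of _ a], rule exI[of _ b]) (simp add: assms)

lemma wsmooth_SucE:
  assumes "wsmooth (Suc n) S f"
  obtains a b where "\<And>\<zeta>. \<zeta> \<in> S \<Longrightarrow> has_wderiv f (\<lambda>\<alpha>. a \<alpha> \<zeta>) (\<lambda>\<alpha>. b \<alpha> \<zeta>) \<zeta>"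
    "\<And>\<alpha>. wsmooth n S (a \<alpha>)" "\<And>\<alpha>. wsmooth n S (b \<alpha>)"
  using assms by auto

declare wsmooth.simps(2) [simp del]

lemma wsmooth_Suc_mono: "wsmooth (Suc n) S f \<Longrightarrow> wsmooth n S f"
proof (induction n arbitrary: f)
  case (Suc n)
  obtain a b where f: "\<And>\<zeta>. \<zeta> \<in> S \<Longrightarrow> has_wderiv f (\<lambda>\<alpha>. a \<alpha> \<zeta>) (\<lambda>\<alpha>. b \<alpha> \<zeta>) \<zeta>"
    "\<And>\<alpha>. wsmooth (Suc n) S (a \<alpha>)" "\<And>\<alpha>. wsmooth (Suc n) S (b \<alpha>)" by (rule wsmooth_SucE[OF Suc.prems]) (rule that)
  show ?case
    by (rule wsmooth_SucI[where a = a and b = b]) (rule f Suc.IH | assumption)+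
qed simp

lemma wsmooth_cong:
  assumes "open S" "wsmooth n S f" "\<And>\<zeta>. \<zeta> \<in> S \<Longrightarrow> f \<zeta> = g \<zeta>"
  shows "wsmooth n S g"
proof (cases n)
  case (Suc m)
  obtain a b where f: "\<And>\<zeta>. \<zeta> \<in> S \<Longrightarrow> has_wderiv f (\<lambda>\<alpha>. a \<alpha> \<zeta>) (\<lambda>\<alpha>. b \<alpha> \<zeta>) \<zeta>"
    "\<And>\<alpha>. wsmooth m S (a \<alpha>)" "\<And>\<alpha>. wsmooth m S (b \<alpha>)" by (rule wsmooth_SucE[OF assms(2)[unfolded Suc]]) (rule that)
  show ?thesis unfolding Suc
    by (rule wsmooth_SucI[where a = a and b = b])
       (rule has_wderiv_transform[OF f(1) assms(1) _ assms(3)] f(2,3) | assumption)+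
qed simp

lemma wsmooth_const: "wsmooth n S (\<lambda>\<xi>. z)"
proof (induction n arbitrary: z)
  case (Suc n)
  show ?case by (rule wsmooth_SucI[where a = "\<lambda>_ _. 0" and b = "\<lambda>_ _. 0", OF has_wderiv_const Suc.IH Suc.IH])
qed simp

lemma wsmooth_coord: "wsmooth n S (\<lambda>\<xi>. \<xi> $ \<gamma>)"
proof (cases n)
  case (Suc m)
  show ?thesis unfolding Suc
    by (rule wsmooth_SucI[where a = "\<lambda>\<alpha> _. if \<alpha> = \<gamma> then 1 else 0" and b = "\<lambda>_ _. 0",
          OF has_wderiv_coord wsmooth_const wsmooth_const])
qed simp

lemma wsmooth_add: "wsmooth n S f \<Longrightarrow> wsmooth n S g \<Longrightarrow> wsmooth n S (\<lambda>\<xi>. f \<xi> + g \<xi>)"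
proof (induction n arbitrary: f g)
  case (Suc n)
  obtain a b where f: "\<And>\<zeta>. \<zeta> \<in> S \<Longrightarrow> has_wderiv f (\<lambda>\<alpha>. a \<alpha> \<zeta>) (\<lambda>\<alpha>. b \<alpha> \<zeta>) \<zeta>"
    "\<And>\<alpha>. wsmooth n S (a \<alpha>)" "\<And>\<alpha>. wsmooth n S (b \<alpha>)" by (rule wsmooth_SucE[OF Suc.prems(1)]) (rule that)
  obtain a' b' where g: "\<And>\<zeta>. \<zeta> \<in> S \<Longrightarrow> has_wderiv g (\<lambda>\<alpha>. a' \<alpha> \<zeta>) (\<lambda>\<alpha>. b' \<alpha> \<zeta>) \<zeta>"
    "\<And>\<alpha>. wsmooth n S (a' \<alpha>)" "\<And>\<alpha>. wsmooth n S (b' \<alpha>)" by (rule wsmooth_SucE[OF Suc.prems(2)]) (rule that)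
  show ?case
    by (rule wsmooth_SucI[where a = "\<lambda>\<alpha> \<zeta>. a \<alpha> \<zeta> + a' \<alpha> \<zeta>" and b = "\<lambda>\<alpha> \<zeta>. b \<alpha> \<zeta> + b' \<alpha> \<zeta>"])
       (rule has_wderiv_add f g Suc.IH | assumption)+
qed simp

lemma wsmooth_mult: "wsmooth n S f \<Longrightarrow> wsmooth n S g \<Longrightarrow> wsmooth n S (\<lambda>\<xi>. f \<xi> * g \<xi>)"
proof (induction n arbitrary: f g)
  case (Suc n)
  obtain a b where f: "\<And>\<zeta>. \<zeta> \<in> S \<Longrightarrow> has_wderiv f (\<lambda>\<alpha>. a \<alpha> \<zeta>) (\<lambda>\<alpha>. b \<alpha> \<zeta>) \<zeta>"
    "\<And>\<alpha>. wsmooth n S (a \<alpha>)" "\<And>\<alpha>. wsmooth n S (b \<alpha>)" by (rule wsmooth_SucE[OF Suc.prems(1)]) (rule that)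
  obtain a' b' where g: "\<And>\<zeta>. \<zeta> \<in> S \<Longrightarrow> has_wderiv g (\<lambda>\<alpha>. a' \<alpha> \<zeta>) (\<lambda>\<alpha>. b' \<alpha> \<zeta>) \<zeta>"
    "\<And>\<alpha>. wsmooth n S (a' \<alpha>)" "\<And>\<alpha>. wsmooth n S (b' \<alpha>)" by (rule wsmooth_SucE[OF Suc.prems(2)]) (rule that)
  have fg: "wsmooth n S f" "wsmooth n S g" using Suc.prems by (simp_all add: wsmooth_Suc_mono)
  show ?case
    by (rule wsmooth_SucI[where a = "\<lambda>\<alpha> \<zeta>. f \<zeta> * a' \<alpha> \<zeta> + a \<alpha> \<zeta> * g \<zeta>" and b = "\<lambda>\<alpha> \<zeta>. f \<zeta> * b' \<alpha> \<zeta> + b \<alpha> \<zeta> * g \<zeta>"])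
       (rule has_wderiv_mult wsmooth_add f g fg Suc.IH | assumption)+
qed simp

lemma wsmooth_cnj: "wsmooth n S f \<Longrightarrow> wsmooth n S (\<lambda>\<xi>. cnj (f \<xi>))"
proof (induction n arbitrary: f)
  case (Suc n)
  obtain a b where f: "\<And>\<zeta>. \<zeta> \<in> S \<Longrightarrow> has_wderiv f (\<lambda>\<alpha>. a \<alpha> \<zeta>) (\<lambda>\<alpha>. b \<alpha> \<zeta>) \<zeta>"
    "\<And>\<alpha>. wsmooth n S (a \<alpha>)" "\<And>\<alpha>. wsmooth n S (b \<alpha>)" by (rule wsmooth_SucE[OF Suc.prems(1)]) (rule that)
  show ?case
    by (rule wsmooth_SucI[where a = "\<lambda>\<alpha> \<zeta>. cnj (b \<alpha> \<zeta>)" and b = "\<lambda>\<alpha> \<zeta>. cnj (a \<alpha> \<zeta>)"])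
       (rule has_wderiv_cnj f Suc.IH | assumption)+
qed simp

lemma wsmooth_sum: "(\<And>i. i \<in> I \<Longrightarrow> wsmooth n S (f i)) \<Longrightarrow> wsmooth n S (\<lambda>\<xi>. \<Sum>i\<in>I. f i \<xi>)"
  by (induction I rule: infinite_finite_induct) (auto intro: wsmooth_const wsmooth_add)

lemma wsmooth_prod: "(\<And>i. i \<in> I \<Longrightarrow> wsmooth n S (f i)) \<Longrightarrow> wsmooth n S (\<lambda>\<xi>. \<Prod>i\<in>I. f i \<xi>)"
  by (induction I rule: infinite_finite_induct) (auto intro: wsmooth_const wsmooth_mult)

lemma wsmooth_minus: "wsmooth n S f \<Longrightarrow> wsmooth n S (\<lambda>\<xi>. - f \<xi>)"
  using wsmooth_mult[OF wsmooth_const[of n S "-1"]] by simp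

lemma wsmooth_diff: "wsmooth n S f \<Longrightarrow> wsmooth n S g \<Longrightarrow> wsmooth n S (\<lambda>\<xi>. f \<xi> - g \<xi>)"
  using wsmooth_add[OF _ wsmooth_minus] by force

text \<open>The derivative of the outer function is asked for one order less, so \<open>exp\<close>
  and \<open>inverse\<close>, whose derivatives are expressed by themselves, can be treated by
  induction on the order.\<close>

lemma wsmooth_chain:
  assumes f: "wsmooth (Suc n) S f" and g: "\<And>\<zeta>. \<zeta> \<in> S \<Longrightarrow> (g has_field_derivative g' (f \<zeta>)) (at (f \<zeta>))"
    and g': "wsmooth n S (\<lambda>\<xi>. g' (f \<xi>))"
  shows "wsmooth (Suc n) S (\<lambda>\<xi>. g (f \<xi>))"
proof -
  obtain a b where f: "\<And>\<zeta>. \<zeta> \<in> S \<Longrightarrow> has_wderiv f (\<lambda>\<alpha>. a \<alpha> \<zeta>) (\<lambda>\<alpha>. b \<alpha> \<zeta>) \<zeta>"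
    "\<And>\<alpha>. wsmooth n S (a \<alpha>)" "\<And>\<alpha>. wsmooth n S (b \<alpha>)" by (rule wsmooth_SucE[OF f]) (rule that)
  show ?thesis
    by (rule wsmooth_SucI[where a = "\<lambda>\<alpha> \<zeta>. g' (f \<zeta>) * a \<alpha> \<zeta>" and b = "\<lambda>\<alpha> \<zeta>. g' (f \<zeta>) * b \<alpha> \<zeta>"])
       (rule has_wderiv_chain wsmooth_mult f g g' | assumption)+
qed

lemma wsmooth_exp: "wsmooth n S f \<Longrightarrow> wsmooth n S (\<lambda>\<xi>. exp (f \<xi>))"
proof (induction n arbitrary: f)
  case (Suc n)
  show ?case
    by (rule wsmooth_chain[OF Suc.prems DERIV_exp Suc.IH[OF wsmooth_Suc_mono[OF Suc.prems]]])
qed simp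

lemma wsmooth_inverse:
  "wsmooth n S f \<Longrightarrow> (\<And>\<zeta>. \<zeta> \<in> S \<Longrightarrow> f \<zeta> \<noteq> 0) \<Longrightarrow> wsmooth n S (\<lambda>\<xi>. inverse (f \<xi>))"
proof (induction n arbitrary: f)
  case (Suc n)
  have "wsmooth n S (\<lambda>\<xi>. inverse (f \<xi>))" by (rule Suc.IH[OF wsmooth_Suc_mono[OF Suc.prems(1)] Suc.prems(2)])
  then have "wsmooth n S (\<lambda>\<xi>. - (inverse (f \<xi>) ^ Suc (Suc 0)))"
    by (simp add: wsmooth_minus wsmooth_mult)
  show ?case
    by (rule wsmooth_chain[OF Suc.prems(1), where g' = "\<lambda>z. - (inverse z ^ Suc (Suc 0))"])
       (rule DERIV_inverse Suc.prems \<open>wsmooth n S (\<lambda>\<xi>. - (inverse (f \<xi>) ^ Suc (Suc 0)))\<close> | assumption)+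
qed simp

lemma wsmooth_Ln:
  assumes f: "wsmooth n S f" and pos: "\<And>\<zeta>. \<zeta> \<in> S \<Longrightarrow> 0 < Re (f \<zeta>)"
  shows "wsmooth n S (\<lambda>\<xi>. Ln (f \<xi>))"
proof (cases n)
  case (Suc m)
  have nz: "f \<zeta> \<noteq> 0" and nr: "f \<zeta> \<notin> \<real>\<^sub>\<le>\<^sub>0" if "\<zeta> \<in> S" for \<zeta>
    using pos[OF that] by (auto simp: complex_nonpos_Reals_iff)
  have "wsmooth m S (\<lambda>\<xi>. inverse (f \<xi>))"
    by (rule wsmooth_inverse[OF wsmooth_Suc_mono[OF f[unfolded Suc]] nz])
  from wsmooth_chain[OF f[unfolded Suc] has_field_derivative_Ln[OF nr] this]
  show ?thesis unfolding Suc .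
qed simp

lemma wsmooth_det:
  fixes M :: "complex ^ 'n::finite \<Rightarrow> complex ^ 'm ^ 'm"
  assumes "\<And>i j. wsmooth n S (\<lambda>\<xi>. M \<xi> $ i $ j)"
  shows "wsmooth n S (\<lambda>\<xi>. det (M \<xi>))"
  unfolding det_def by (intro wsmooth_sum wsmooth_mult wsmooth_const wsmooth_prod assms)

text \<open>The coefficients in \<open>wsmooth\<close> are existential; by
  \<open>has_wderiv_wirt\<close> they agree on \<open>S\<close> with \<open>wirt\<close> and
  \<open>wirt_bar\<close>, and openness of \<open>S\<close> carries smoothness across this
  agreement.\<close>

lemma wsmooth_wirt:
  assumes S: "open S" and f: "wsmooth (Suc n) S f"
  shows "wsmooth n S (wirt \<alpha> f)" "wsmooth n S (wirt_bar \<alpha> f)"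
    "\<zeta> \<in> S \<Longrightarrow> has_wderiv f (\<lambda>\<alpha>. wirt \<alpha> f \<zeta>) (\<lambda>\<alpha>. wirt_bar \<alpha> f \<zeta>) \<zeta>"
proof -
  obtain a b where ab: "\<And>\<zeta>. \<zeta> \<in> S \<Longrightarrow> has_wderiv f (\<lambda>\<alpha>. a \<alpha> \<zeta>) (\<lambda>\<alpha>. b \<alpha> \<zeta>) \<zeta>"
    "\<And>\<alpha>. wsmooth n S (a \<alpha>)" "\<And>\<alpha>. wsmooth n S (b \<alpha>)" by (rule wsmooth_SucE[OF f]) (rule that)
  have eq: "wirt \<alpha> f \<zeta> = a \<alpha> \<zeta>" "wirt_bar \<alpha> f \<zeta> = b \<alpha> \<zeta>" if "\<zeta> \<in> S" for \<alpha> \<zeta>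
    using has_wderiv_wirt[OF ab(1)[OF that]] by auto
  show "wsmooth n S (wirt \<alpha> f)"
    by (rule wsmooth_cong[OF S ab(2)]) (simp add: eq)
  show "wsmooth n S (wirt_bar \<alpha> f)"
    by (rule wsmooth_cong[OF S ab(3)]) (simp add: eq)
  show "has_wderiv f (\<lambda>\<alpha>. wirt \<alpha> f \<zeta>) (\<lambda>\<alpha>. wirt_bar \<alpha> f \<zeta>) \<zeta>" if "\<zeta> \<in> S"
    using ab(1)[OF that] by (simp add: eq[OF that])
qed

section \<open>Derivatives of functions along holomorphic curves\<close>

lemma has_derivative_vec:
  fixes x :: "'a::real_normed_vector \<Rightarrow> complex ^ 'n::finite"
  assumes "\<And>j. ((\<lambda>t. x t $ j) has_derivative (\<lambda>h. x' h $ j)) (at t)"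
  shows "(x has_derivative x') (at t)"
proof -
  have ax: "bounded_linear (axis j :: complex \<Rightarrow> complex ^ 'n)" for j
    unfolding linear_conv_bounded_linear[symmetric]
    by (rule linearI) (simp_all add: axis_def vec_eq_iff)
  have sum_ax: "(\<Sum>j\<in>UNIV. axis j (y $ j)) = (y :: complex ^ 'n)" for y
  proof -
    have "(\<Sum>j\<in>UNIV. axis j (y $ j)) $ i = (\<Sum>j\<in>UNIV. if j = i then y $ i else 0)" for i
      unfolding sum_component by (rule sum.cong) (auto simp: axis_def)
    then show ?thesis by (simp add: vec_eq_iff)
  qed
  have "((\<lambda>t. \<Sum>j\<in>UNIV. axis j (x t $ j)) has_derivative (\<lambda>h. \<Sum>j\<in>UNIV. axis j (x' h $ j))) (at t)"
    by (intro has_derivative_sum bounded_linear.has_derivative[OF ax] assms)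
  then show ?thesis by (simp add: sum_ax)
qed

text \<open>Because the curve is holomorphic, the derivatives in \<open>t\<close> and in
  \<open>cnj t\<close> pick up \<open>wirt\<close> and \<open>wirt_bar\<close> separately.\<close>

lemma has_wirt_along_curve:
  assumes f: "has_wderiv f a b (x t)" and x: "has_vwirt x x' 0 t"
  shows "has_wirt (\<lambda>t. f (x t)) (\<Sum>\<alpha>\<in>UNIV. a \<alpha> * x' $ \<alpha>) (\<Sum>\<alpha>\<in>UNIV. b \<alpha> * cnj (x' $ \<alpha>)) t"
proof -
  have "(x has_derivative (\<lambda>\<tau>. \<tau> *s x')) (at t)"
    using x unfolding has_vwirt_def has_wirt_def by (intro has_derivative_vec) (simp add: mult.commute)
  from has_derivative_compose[OF this f[unfolded has_wderiv_def]]
  show ?thesis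
    unfolding has_wirt_def
    by (simp add: sum.distrib sum_distrib_left sum_distrib_right mult_ac)
qed

lemma has_mwirt_along_curve:
  fixes G :: "complex ^ 'n::finite \<Rightarrow> complex ^ 'm ^ 'k"
  assumes S: "open S" and G: "\<And>i j. wsmooth (Suc 0) S (\<lambda>\<xi>. G \<xi> $ i $ j)"
    and x: "has_vwirt x x' 0 t" "x t \<in> S"
  shows "has_mwirt (\<lambda>t. G (x t)) (d_op x' G (x t)) (dbar_op x' G (x t)) t"
  unfolding has_mwirt_def d_op_def dbar_op_def
  using has_wirt_along_curve[OF wsmooth_wirt(3)[OF S G x(2)] x(1)] by simp

lemma has_wirt_sesq:
  assumes "has_mwirt M P Q t" "has_vwirt x x' x'' t" "has_vwirt y y' y'' t"
  shows "has_wirt (\<lambda>t. sesq (M t) (x t) (y t))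
     (sesq P (x t) (y t) + sesq (M t) x' (y t) + sesq (M t) (x t) y'')
     (sesq Q (x t) (y t) + sesq (M t) x'' (y t) + sesq (M t) (x t) y') t"
proof -
  have "has_wirt (\<lambda>t. \<Sum>i\<in>UNIV. \<Sum>j\<in>UNIV. x t $ i * M t $ i $ j * cnj (y t $ j))
    (\<Sum>i\<in>UNIV. \<Sum>j\<in>UNIV. (x' $ i * M t $ i $ j + x t $ i * P $ i $ j) * cnj (y t $ j) + x t $ i * M t $ i $ j * cnj (y'' $ j))
    (\<Sum>i\<in>UNIV. \<Sum>j\<in>UNIV. (x'' $ i * M t $ i $ j + x t $ i * Q $ i $ j) * cnj (y t $ j) + x t $ i * M t $ i $ j * cnj (y' $ j)) t"
    using assms unfolding has_vwirt_def has_mwirt_def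
    by (intro has_wirt_sum has_wirt_mult has_wirt_cnj) auto
  then show ?thesis
    unfolding sesq_def by (rule has_wirt_rhs) (simp_all add: sum.distrib algebra_simps)
qed

text \<open>The jets of a potential along a quadratic holomorphic curve determine the metric, and
  the numerator of its curvature as a quadratic polynomial in the second derivative of the curve.\<close>

lemma jets_along_curve:
  fixes f :: "complex ^ 'n::finite \<Rightarrow> complex"
  defines "T \<equiv> \<lambda>\<xi>. \<chi> \<alpha> \<beta>. wirt \<alpha> (wirt_bar \<beta> f) \<xi>"
  assumes S: "open S" and f: "wsmooth 4 S f"
    and x: "\<And>t. t \<in> U \<Longrightarrow> has_vwirt x (x1 t) 0 t" and x1: "\<And>t. t \<in> U \<Longrightarrow> has_vwirt x1 b 0 t"
    and U: "open U" "\<And>t. t \<in> U \<Longrightarrow> x t \<in> S"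
    and g0: "\<And>t. t \<in> U \<Longrightarrow> \<exists>y. has_wirt (\<lambda>t. f (x t)) y (g1 t) t"
    and g1: "\<And>t. t \<in> U \<Longrightarrow> \<exists>y. has_wirt g1 (g2 t) y t"
    and g2: "\<And>t. t \<in> U \<Longrightarrow> \<exists>y. has_wirt g2 (g3 t) y t"
    and g3: "\<And>t. t \<in> U \<Longrightarrow> \<exists>y. has_wirt g3 y (g4 t) t"
    and t: "t \<in> U"
  shows "sesq (T (x t)) (x1 t) (x1 t) = g2 t"
    and "g4 t = sesq (dbar_op (x1 t) (d_op (x1 t) T) (x t)) (x1 t) (x1 t) + sesq (d_op (x1 t) T (x t)) (x1 t) b
       + sesq (dbar_op (x1 t) T (x t)) b (x1 t) + sesq (T (x t)) b b"
proof -
  have f4: "wsmooth (Suc 3) S f" using f by (simp add: numeral_eq_Suc)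
  have fb: "wsmooth 3 S (wirt_bar \<beta> f)" for \<beta> by (rule wsmooth_wirt(2)[OF S f4])
  have Ts: "wsmooth 2 S (\<lambda>\<xi>. T \<xi> $ i $ j)" for i j
    unfolding T_def using wsmooth_wirt(1)[OF S, of 2 "wirt_bar j f" i] fb[of j] by (simp add: numeral_eq_Suc)
  have T1: "wsmooth (Suc 0) S (\<lambda>\<xi>. T \<xi> $ i $ j)" for i j
    using wsmooth_Suc_mono[of "Suc 0"] Ts[of i j] by (simp add: numeral_eq_Suc)
  have W: "wsmooth (Suc 0) S (wirt \<gamma> (\<lambda>\<xi>. T \<xi> $ i $ j))" for \<gamma> i j
    using wsmooth_wirt(1)[OF S, of "Suc 0"] Ts[of i j] by (simp add: numeral_eq_Suc)
  \<comment> \<open>Each jet is identified by uniqueness: the given function and the chain rule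
    formula are derivatives of the same function, equal near \<open>t\<close>.\<close>
  have 1: "g1 t = (\<Sum>\<beta>\<in>UNIV. wirt_bar \<beta> f (x t) * cnj (x1 t $ \<beta>))" if "t \<in> U" for t
    using g0[OF that] has_wirt_unique(2)[OF _ has_wirt_along_curve[OF wsmooth_wirt(3)[OF S f4 U(2)] x], OF _ that that] by blast
  have 2: "g2 t = sesq (T (x t)) (x1 t) (x1 t)" if t: "t \<in> U" for t
  proof -
    have fb': "wsmooth (Suc 2) S (wirt_bar \<beta> f)" for \<beta> using fb by (simp add: numeral_eq_Suc)
    have "has_wirt (\<lambda>t. \<Sum>\<beta>\<in>UNIV. wirt_bar \<beta> f (x t) * cnj (x1 t $ \<beta>))
      (\<Sum>\<beta>\<in>UNIV. (\<Sum>\<alpha>\<in>UNIV. wirt \<alpha> (wirt_bar \<beta> f) (x t) * x1 t $ \<alpha>) * cnj (x1 t $ \<beta>) + wirt_bar \<beta> f (x t) * cnj (0 $ \<beta>))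
      (\<Sum>\<beta>\<in>UNIV. (\<Sum>\<alpha>\<in>UNIV. wirt_bar \<alpha> (wirt_bar \<beta> f) (x t) * cnj (x1 t $ \<alpha>)) * cnj (x1 t $ \<beta>) + wirt_bar \<beta> f (x t) * cnj (b $ \<beta>)) t"
      using x1[OF t] unfolding has_vwirt_def
      by (intro has_wirt_sum has_wirt_mult has_wirt_along_curve[OF wsmooth_wirt(3)[OF S fb' U(2)[OF t]] x[OF t]] has_wirt_cnj) auto
    from has_wirt_transform[OF this U(1) t, of g1] 1
    have "has_wirt g1 (\<Sum>\<beta>\<in>UNIV. (\<Sum>\<alpha>\<in>UNIV. wirt \<alpha> (wirt_bar \<beta> f) (x t) * x1 t $ \<alpha>) * cnj (x1 t $ \<beta>) + wirt_bar \<beta> f (x t) * cnj (0 $ \<beta>))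
      (\<Sum>\<beta>\<in>UNIV. (\<Sum>\<alpha>\<in>UNIV. wirt_bar \<alpha> (wirt_bar \<beta> f) (x t) * cnj (x1 t $ \<alpha>)) * cnj (x1 t $ \<beta>) + wirt_bar \<beta> f (x t) * cnj (b $ \<beta>)) t"
      by simp
    with g1[OF t] have "g2 t = (\<Sum>\<beta>\<in>UNIV. (\<Sum>\<alpha>\<in>UNIV. wirt \<alpha> (wirt_bar \<beta> f) (x t) * x1 t $ \<alpha>) * cnj (x1 t $ \<beta>) + wirt_bar \<beta> f (x t) * cnj (0 $ \<beta>))"
      using has_wirt_unique(1) by blast
    also have "\<dots> = sesq (T (x t)) (x1 t) (x1 t)"
    proof -
      have "sesq (T (x t)) (x1 t) (x1 t) = (\<Sum>\<beta>\<in>UNIV. \<Sum>\<alpha>\<in>UNIV. x1 t $ \<alpha> * wirt \<alpha> (wirt_bar \<beta> f) (x t) * cnj (x1 t $ \<beta>))"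
        unfolding sesq_def T_def by (subst sum.swap) simp
      then show ?thesis by (simp add: sum_distrib_left sum_distrib_right mult_ac)
    qed
    finally show ?thesis .
  qed
  then show "sesq (T (x t)) (x1 t) (x1 t) = g2 t" using t by simp
  \<comment> \<open>The curve \<open>x1\<close> is holomorphic, so its conjugate has zero derivative
    in \<open>t\<close> and \<open>b\<close> appears in the left argument only.\<close>
  have 3: "g3 t = sesq (d_op (x1 t) T (x t)) (x1 t) (x1 t) + sesq (T (x t)) b (x1 t)" if t: "t \<in> U" for t
  proof -
    have "has_wirt g2
      (sesq (d_op (x1 t) T (x t)) (x1 t) (x1 t) + sesq (T (x t)) b (x1 t) + sesq (T (x t)) (x1 t) 0)
      (sesq (dbar_op (x1 t) T (x t)) (x1 t) (x1 t) + sesq (T (x t)) 0 (x1 t) + sesq (T (x t)) (x1 t) b) t"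
      by (rule has_wirt_transform[OF has_wirt_sesq[OF has_mwirt_along_curve[OF S T1 x U(2)] x1 x1] U(1)])
         (simp_all add: t 2)
    with g2[OF t] show ?thesis
      using has_wirt_unique(1) by (fastforce simp: sesq_def)
  qed
  have "\<exists>y. has_mwirt (\<lambda>t. d_op (x1 t) T (x t)) y (dbar_op (x1 t) (d_op (x1 t) T) (x t)) t"
  proof -
    \<comment> \<open>In \<open>dbar_op (x1 t) (d_op (x1 t) T)\<close> the direction is frozen,
      whereas along the curve it moves. The two agree for the derivative in \<open>cnj t\<close>
      because \<open>x1\<close> is holomorphic.\<close>
    define u where "u = x1 t"
    define y1 where "y1 i j = (\<Sum>\<gamma>\<in>UNIV. (\<Sum>\<delta>\<in>UNIV. wirt \<delta> (wirt \<gamma> (\<lambda>\<xi>. T \<xi> $ i $ j)) (x t) * x1 t $ \<delta>) * x1 t $ \<gamma>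
         + wirt \<gamma> (\<lambda>\<xi>. T \<xi> $ i $ j) (x t) * b $ \<gamma>)" for i j
    have A: "has_wirt (\<lambda>t. d_op (x1 t) T (x t) $ i $ j) (y1 i j)
      (\<Sum>\<gamma>\<in>UNIV. (\<Sum>\<delta>\<in>UNIV. wirt_bar \<delta> (wirt \<gamma> (\<lambda>\<xi>. T \<xi> $ i $ j)) (x t) * cnj (x1 t $ \<delta>)) * x1 t $ \<gamma>
         + wirt \<gamma> (\<lambda>\<xi>. T \<xi> $ i $ j) (x t) * 0 $ \<gamma>) t" for i j
      unfolding d_op_def y1_def using x1[OF t] unfolding has_vwirt_def
      by (simp del: mult_zero_right zero_index)
         (intro has_wirt_sum has_wirt_mult has_wirt_along_curve[OF wsmooth_wirt(3)[OF S W U(2)[OF t]] x[OF t]], auto)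
    have B: "wirt_bar \<delta> (\<lambda>\<xi>. d_op u T \<xi> $ i $ j) (x t) = (\<Sum>\<gamma>\<in>UNIV. wirt_bar \<delta> (wirt \<gamma> (\<lambda>\<xi>. T \<xi> $ i $ j)) (x t) * u $ \<gamma>)" for \<delta> i j
    proof -
      have "((\<lambda>\<xi>. \<Sum>\<gamma>\<in>UNIV. wirt \<gamma> (\<lambda>\<xi>. T \<xi> $ i $ j) \<xi> * u $ \<gamma>) has_derivative
        (\<lambda>h. \<Sum>\<gamma>\<in>UNIV. (\<Sum>\<delta>\<in>UNIV. wirt \<delta> (wirt \<gamma> (\<lambda>\<xi>. T \<xi> $ i $ j)) (x t) * h $ \<delta> +
            wirt_bar \<delta> (wirt \<gamma> (\<lambda>\<xi>. T \<xi> $ i $ j)) (x t) * cnj (h $ \<delta>)) * u $ \<gamma>)) (at (x t))"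
        using wsmooth_wirt(3)[OF S W U(2)[OF t]] unfolding has_wderiv_def
        by (intro has_derivative_sum has_derivative_mult_left) auto
      also have "(\<lambda>h. \<Sum>\<gamma>\<in>UNIV. (\<Sum>\<delta>\<in>UNIV. wirt \<delta> (wirt \<gamma> (\<lambda>\<xi>. T \<xi> $ i $ j)) (x t) * h $ \<delta> +
            wirt_bar \<delta> (wirt \<gamma> (\<lambda>\<xi>. T \<xi> $ i $ j)) (x t) * cnj (h $ \<delta>)) * u $ \<gamma>) =
          (\<lambda>h. \<Sum>\<delta>\<in>UNIV. (\<Sum>\<gamma>\<in>UNIV. wirt \<delta> (wirt \<gamma> (\<lambda>\<xi>. T \<xi> $ i $ j)) (x t) * u $ \<gamma>) * h $ \<delta> +
            (\<Sum>\<gamma>\<in>UNIV. wirt_bar \<delta> (wirt \<gamma> (\<lambda>\<xi>. T \<xi> $ i $ j)) (x t) * u $ \<gamma>) * cnj (h $ \<delta>))"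
        unfolding sum_distrib_right sum.distrib[symmetric]
        by (rule ext, subst sum.swap) (simp add: algebra_simps)
      finally have "has_wderiv (\<lambda>\<xi>. d_op u T \<xi> $ i $ j)
          (\<lambda>\<delta>. \<Sum>\<gamma>\<in>UNIV. wirt \<delta> (wirt \<gamma> (\<lambda>\<xi>. T \<xi> $ i $ j)) (x t) * u $ \<gamma>)
          (\<lambda>\<delta>. \<Sum>\<gamma>\<in>UNIV. wirt_bar \<delta> (wirt \<gamma> (\<lambda>\<xi>. T \<xi> $ i $ j)) (x t) * u $ \<gamma>) (x t)"
        unfolding has_wderiv_def d_op_def by simp
      then show ?thesis by (rule has_wderiv_wirt)
    qed
    have "has_wirt (\<lambda>t. d_op (x1 t) T (x t) $ i $ j) (y1 i j) (dbar_op u (d_op u T) (x t) $ i $ j) t" for i j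
    proof (rule has_wirt_rhs[OF A refl])
      show "(\<Sum>\<gamma>\<in>UNIV. (\<Sum>\<delta>\<in>UNIV. wirt_bar \<delta> (wirt \<gamma> (\<lambda>\<xi>. T \<xi> $ i $ j)) (x t) * cnj (x1 t $ \<delta>)) * x1 t $ \<gamma>
         + wirt \<gamma> (\<lambda>\<xi>. T \<xi> $ i $ j) (x t) * 0 $ \<gamma>) = dbar_op u (d_op u T) (x t) $ i $ j"
        unfolding dbar_op_def vec_lambda_beta B u_def[symmetric]
        by (simp add: sum_distrib_right) (subst sum.swap, simp add: mult_ac)
    qed
    then show ?thesis
      unfolding has_mwirt_def u_def by (intro exI[of _ "\<chi> i j. y1 i j"]) simp
  qed
  then obtain y where y: "has_mwirt (\<lambda>t. d_op (x1 t) T (x t)) y (dbar_op (x1 t) (d_op (x1 t) T) (x t)) t" by blast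
  have cb: "has_vwirt (\<lambda>_. b) 0 0 t" by (rule has_vwirt_const)
  note D = has_wirt_add[OF has_wirt_sesq[OF y x1[OF t] x1[OF t]]
      has_wirt_sesq[OF has_mwirt_along_curve[OF S T1 x[OF t] U(2)[OF t]] cb x1[OF t]]]
  have "\<exists>y. has_wirt g3 y (sesq (dbar_op (x1 t) (d_op (x1 t) T) (x t)) (x1 t) (x1 t) + sesq (d_op (x1 t) T (x t)) 0 (x1 t)
     + sesq (d_op (x1 t) T (x t)) (x1 t) b
     + (sesq (dbar_op (x1 t) T (x t)) b (x1 t) + sesq (T (x t)) 0 (x1 t) + sesq (T (x t)) b b)) t"
    by (rule exI, rule has_wirt_transform[OF D U(1) t]) (simp add: 3)
  with g3[OF t] have "g4 t = sesq (dbar_op (x1 t) (d_op (x1 t) T) (x t)) (x1 t) (x1 t) + sesq (d_op (x1 t) T (x t)) 0 (x1 t)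
     + sesq (d_op (x1 t) T (x t)) (x1 t) b
     + (sesq (dbar_op (x1 t) T (x t)) b (x1 t) + sesq (T (x t)) 0 (x1 t) + sesq (T (x t)) b b)"
    using has_wirt_unique(2) by blast
  then show "g4 t = sesq (dbar_op (x1 t) (d_op (x1 t) T) (x t)) (x1 t) (x1 t) + sesq (d_op (x1 t) T (x t)) (x1 t) b
       + sesq (dbar_op (x1 t) T (x t)) b (x1 t) + sesq (T (x t)) b b"
    by (simp add: sesq_def add_ac)
qed

section \<open>Curvature at a point of the domain\<close>

text \<open>The constants with suffix \<open>_at\<close> are the jets at t = 0, written without the
  curve: they visibly depend on the base point and the velocity but not on the second derivative,
  which is varied later.\<close>

definition R_at :: "complex ^ 'p ^ 'p \<Rightarrow> complex ^ 'p ^ 'p" where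
  "R_at Z = matrix_inv (mat 1 - cj Z ** Z)"

definition P_at :: "complex ^ 'p ^ 'p \<Rightarrow> complex ^ 'p ^ 'p" where
  "P_at Z = matrix_inv (mat 1 - Z ** cj Z)"

definition W_at :: "complex ^ 'p ^ 'p \<Rightarrow> complex ^ 'p ^ 'p \<Rightarrow> complex ^ 'p ^ 'p" where
  "W_at Z A = R_at Z ** cj A ** P_at Z"

definition E_at :: "real \<Rightarrow> complex ^ 'p ^ 'p \<Rightarrow> complex" where
  "E_at \<kappa> Z = exp (of_real \<kappa> * - Ln (det (mat 1 - Z ** cj Z)))"

definition f_at :: "complex ^ 'p ^ 'p \<Rightarrow> complex ^ 'p ^ 'p \<Rightarrow> complex" where
  "f_at Z A = trace (A ** (R_at Z ** cj Z))"

definition \<alpha>_at :: "real \<Rightarrow> complex ^ 'p ^ 'p \<Rightarrow> complex ^ 'r \<Rightarrow> complex ^ 'p ^ 'p \<Rightarrow> complex ^ 'r \<Rightarrow> complex ^ 'r" where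
  "\<alpha>_at \<kappa> Z w A a = a + (of_real \<kappa> * f_at Z A) *s w"

definition c_at :: "real \<Rightarrow> complex ^ 'p ^ 'p \<Rightarrow> complex ^ 'r \<Rightarrow> complex" where
  "c_at \<kappa> Z w = inverse (1 - E_at \<kappa> Z * ip w w)"

definition k_at :: "real \<Rightarrow> complex ^ 'p ^ 'p \<Rightarrow> complex ^ 'r \<Rightarrow> complex ^ 'p ^ 'p \<Rightarrow> complex ^ 'r \<Rightarrow> complex" where
  "k_at \<kappa> Z w A a = E_at \<kappa> Z * ip (\<alpha>_at \<kappa> Z w A a) w"

definition G_at :: "real \<Rightarrow> complex ^ 'p ^ 'p \<Rightarrow> complex ^ 'r \<Rightarrow> complex ^ 'p ^ 'p \<Rightarrow> complex ^ 'r \<Rightarrow> complex" where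
  "G_at \<kappa> Z w A a =
     c_at \<kappa> Z w * (of_real \<kappa> * trace (A ** W_at Z A) + E_at \<kappa> Z * ip (\<alpha>_at \<kappa> Z w A a) (\<alpha>_at \<kappa> Z w A a))
     + (c_at \<kappa> Z w)\<^sup>2 * k_at \<kappa> Z w A a * cnj (k_at \<kappa> Z w A a)"

text \<open>The minimum of the fourth-order jet over all second derivatives of the curve, that is,
  minus the numerator of the curvature.\<close>

definition m_at :: "real \<Rightarrow> complex ^ 'p ^ 'p \<Rightarrow> complex ^ 'r \<Rightarrow> complex ^ 'p ^ 'p \<Rightarrow> complex ^ 'r \<Rightarrow> complex" where
  "m_at \<kappa> Z w A a = 2 * (G_at \<kappa> Z w A a)\<^sup>2 + 2 * c_at \<kappa> Z w *
     (of_real \<kappa> * trace (A ** W_at Z A ** (A ** W_at Z A)) - (of_real \<kappa> * trace (A ** W_at Z A))\<^sup>2)"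

context jet_curve
begin

lemma at_0:
  "M 0 = mat 1 - Z0 ** cj Z0" "P 0 = P_at Z0" "R 0 = R_at Z0" "N 0 = R_at Z0 ** cj Z0" "W 0 = W_at Z0 A"
  "E 0 = E_at \<kappa> Z0" "f1 0 = f_at Z0 A" "\<alpha> 0 = \<alpha>_at \<kappa> Z0 w0 A a" "Y 0 = E_at \<kappa> Z0 * ip w0 w0"
  "c 0 = c_at \<kappa> Z0 w0" "k 0 = k_at \<kappa> Z0 w0 A a" "F 0 = trace (A ** W_at Z0 A)"
  "S 0 = trace (A ** W_at Z0 A ** (A ** W_at Z0 A))" "\<psi>2 0 = G_at \<kappa> Z0 w0 A a"
proof -
  show M: "M 0 = mat 1 - Z0 ** cj Z0" by (simp add: M_def Z_0)
  then show P: "P 0 = P_at Z0" by (simp add: P_def P_at_def)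
  show R: "R 0 = R_at Z0" by (simp add: R_def R_at_def Z_0)
  then show N: "N 0 = R_at Z0 ** cj Z0" by (simp add: N_def Z_0)
  show W: "W 0 = W_at Z0 A" by (simp add: W_def W_at_def P R Z_0)
  show E: "E 0 = E_at \<kappa> Z0" by (simp add: E_def E_at_def \<phi>_def M)
  show f1: "f1 0 = f_at Z0 A" by (simp add: f1_def f_at_def N Z_0)
  then show \<alpha>: "\<alpha> 0 = \<alpha>_at \<kappa> Z0 w0 A a" by (simp add: \<alpha>_def \<alpha>_at_def Z_0)
  show Y: "Y 0 = E_at \<kappa> Z0 * ip w0 w0" by (simp add: Y_def E Z_0)
  show c: "c 0 = c_at \<kappa> Z0 w0" by (simp add: c_def c_at_def Y)
  show k: "k 0 = k_at \<kappa> Z0 w0 A a" by (simp add: k_def k_at_def E \<alpha> Z_0)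
  show F: "F 0 = trace (A ** W_at Z0 A)" by (simp add: F_def W Z_0)
  show "S 0 = trace (A ** W_at Z0 A ** (A ** W_at Z0 A))" by (simp add: S_def W Z_0)
  show "\<psi>2 0 = G_at \<kappa> Z0 w0 A a" by (simp add: \<psi>2_def G_at_def c k F \<nu>_def E \<alpha>)
qed

end

lemma positive_definite_resolvent:
  fixes Z :: "complex ^ 'p ^ 'p"
  assumes sym: "transpose Z = Z" and pd: "positive_definite (mat 1 - Z ** cj Z)"
  shows "0 < Re (det (mat 1 - Z ** cj Z))" "cj (P_at Z) = R_at Z" "transpose (R_at Z) = P_at Z"
    "cj Z ** P_at Z = R_at Z ** cj Z" "(mat 1 - Z ** cj Z) ** P_at Z = mat 1"
    "\<exists>D :: complex ^ 'p ^ 'p. P_at Z = D ** adj D"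
proof -
  let ?M = "mat 1 - Z ** cj Z"
  obtain C :: "complex ^ 'p ^ 'p" where C: "?M = C ** adj C" "det C \<noteq> 0"
    using positive_definite_factor[OF pd] by blast
  have det: "det ?M = of_real ((cmod (det C))\<^sup>2)"
    unfolding C(1) det_mul det_transpose det_cj complex_norm_square ..
  then show "0 < Re (det ?M)" using C(2) by simp
  have nz: "det ?M \<noteq> 0" using det C(2) by simp
  have cM: "cj ?M = mat 1 - cj Z ** Z" by (simp add: cj_diff cj_mult)
  have nz': "det (mat 1 - cj Z ** Z) \<noteq> 0" using nz by (metis cM det_cj complex_cnj_zero_iff)
  have inv: "P_at Z ** ?M = mat 1" "R_at Z ** (mat 1 - cj Z ** Z) = mat 1"
    unfolding P_at_def R_at_def using matrix_inv_eq(1) nz nz' by blast+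
  show "cj (P_at Z) = R_at Z" "cj Z ** P_at Z = R_at Z ** cj Z"
    using resolvent_identities[OF inv] by auto
  show MP: "?M ** P_at Z = mat 1"
    using inv(1) matrix_left_right_inverse by blast
  have "transpose (mat 1 - cj Z ** Z) = ?M"
    by (simp add: transpose_diff matrix_transpose_mul cj_transpose[symmetric] sym)
  then have "?M ** transpose (R_at Z) = mat 1"
    using arg_cong[OF inv(2), of transpose] by (simp add: matrix_transpose_mul)
  then have "P_at Z ** (?M ** transpose (R_at Z)) = P_at Z ** mat 1"
    by simp
  then show "transpose (R_at Z) = P_at Z"
    by (simp add: matrix_mul_assoc inv(1))
  \<comment> \<open>Inverting M = C C^* gives the factorisation of the inverse as C^{-1 *}
    C^{-1}.\<close>
  define D where "D = adj (matrix_inv C)"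
  have "adj D = matrix_inv C" by (simp add: D_def cj_transpose)
  have "(D ** adj D) ** ?M = D ** (matrix_inv C ** C) ** adj C"
    unfolding \<open>adj D = matrix_inv C\<close> C(1) by (simp add: matrix_mul_assoc)
  also have "\<dots> = D ** adj C" by (simp add: matrix_inv_eq[OF C(2)])
  also have "\<dots> = adj (C ** matrix_inv C)"
    by (simp add: D_def cj_mult matrix_transpose_mul)
  also have "\<dots> = mat 1" by (simp add: matrix_inv_eq[OF C(2)])
  finally have "P_at Z = D ** adj D"
    unfolding P_at_def by (rule matrix_inv_unique)
  then show "\<exists>D :: complex ^ 'p ^ 'p. P_at Z = D ** adj D" by blast
qed

text \<open>\<open>twisted_gram\<close> with cj(P) = R, followed by cyclic permutations under the
  trace. It serves twice: for the velocity it provides F and S, and for the shifted covariant second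
  derivative it provides nonnegativity.\<close>

lemma twisted_norm:
  fixes Z A :: "complex ^ 'p ^ 'p"
  assumes "transpose Z = Z" "positive_definite (mat 1 - Z ** cj Z)" and sym: "transpose A = A"
  obtains F S where "trace (A ** (R_at Z ** cj A ** P_at Z)) = of_real F"
    "trace (A ** W_at Z A ** (A ** W_at Z A)) = of_real S"
    "0 \<le> F" "F = 0 \<Longrightarrow> A = 0" "F\<^sup>2 \<le> real CARD('p) * S" "S \<le> F\<^sup>2"
proof -
  note pd = positive_definite_resolvent[OF assms(1,2)]
  obtain D :: "complex ^ 'p ^ 'p" where D: "P_at Z = D ** adj D" using pd(6) by blast
  obtain Q :: "complex ^ 'p ^ 'p" where Q:
    "trace (P_at Z ** A ** R_at Z ** cj A) = trace (Q ** adj Q)"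
    "trace (P_at Z ** A ** R_at Z ** cj A ** (P_at Z ** A ** R_at Z ** cj A)) = trace (Q ** adj Q ** (Q ** adj Q))"
    "Q = 0 \<Longrightarrow> A = 0"
    using twisted_gram[OF D sym pd(5)] unfolding pd(2) by blast
  define F where "F = (\<Sum>i\<in>UNIV. \<Sum>j\<in>UNIV. (cmod (Q $ i $ j))\<^sup>2)"
  obtain S where S: "trace (Q ** adj Q ** (Q ** adj Q)) = of_real S" "F\<^sup>2 \<le> real CARD('p) * S" "S \<le> F\<^sup>2"
    unfolding F_def by (rule trace_gram_square_bounds)
  have 1: "trace (A ** (R_at Z ** cj A ** P_at Z)) = of_real F"
    using trace_mul_sym[of "A ** R_at Z ** cj A" "P_at Z"] Q(1)
    by (simp add: F_def trace_mult_adj matrix_mul_assoc)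
  have 2: "trace (A ** W_at Z A ** (A ** W_at Z A)) = of_real S"
    using trace_mul_sym[of "A ** R_at Z ** cj A ** P_at Z ** A ** R_at Z ** cj A" "P_at Z"] Q(2) S(1)
    by (simp add: W_at_def matrix_mul_assoc)
  have 3: "0 \<le> F" by (simp add: F_def sum_nonneg)
  have 4: "A = 0" if "F = 0"
  proof (rule Q(3))
    have "\<forall>i\<in>UNIV. (\<Sum>j\<in>UNIV. (cmod (Q $ i $ j))\<^sup>2) = 0"
      using that unfolding F_def by (subst (asm) sum_nonneg_eq_0_iff) (auto intro: sum_nonneg)
    then have "(cmod (Q $ i $ j))\<^sup>2 = 0" for i j
      by (subst (asm) sum_nonneg_eq_0_iff) auto
    then show "Q = 0" by (simp add: vec_eq_iff)
  qed
  show ?thesis by (rule that[OF 1 2 3 4 S(2,3)])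
qed

section \<open>Smoothness of the potential near the domain\<close>

definition detC :: "complex ^ ('p::finite uprod + 'r::finite) \<Rightarrow> complex" where
  "detC \<zeta> = det (mat 1 - Zmat \<zeta> ** cj (Zmat \<zeta>))"

definition YC :: "real \<Rightarrow> complex ^ ('p::finite uprod + 'r::finite) \<Rightarrow> complex" where
  "YC \<kappa> \<zeta> = exp (of_real \<kappa> * - Ln (detC \<zeta>)) * ip (wvec \<zeta>) (wvec \<zeta>)"

text \<open>An open set on which the potential is smooth; positive definiteness is needed at the base
  point of a curve only, so \<open>R_II\<close> itself need not be shown open.\<close>

definition nbhd :: "real \<Rightarrow> (complex ^ ('p::finite uprod + 'r::finite)) set" where
  "nbhd \<kappa> = {\<zeta>. 0 < Re (detC \<zeta>) \<and> Re (YC \<kappa> \<zeta>) < 1}"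

lemma sym_Zmat: "transpose (Zmat \<zeta>) = Zmat \<zeta>"
  by (auto simp: Zmat_def transpose_def vec_eq_iff Upair_inject intro!: arg_cong[of _ _ "\<lambda>u. \<zeta> $ Inl u"])

text \<open>Lets the second derivative of a curve be prescribed freely as a symmetric matrix and a
  vector, which is how the minimum is attained.\<close>

lemma ex_coordinates:
  assumes "transpose B = B"
  shows "\<exists>\<zeta> :: complex ^ ('p::finite uprod + 'r::finite). Zmat \<zeta> = B \<and> wvec \<zeta> = b"
proof -
  have "(B, b) \<in> range (point_of :: complex ^ ('p uprod + 'r) \<Rightarrow> _)"
    using bij_betw_point_of assms unfolding bij_betw_def by blast
  then show ?thesis by (auto simp: point_of_def)
qed

lemma detC_real: "detC \<zeta> = of_real (Re (detC \<zeta>))"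
  using det_I_minus_cj[OF sym_Zmat, of \<zeta>] unfolding detC_def by (simp add: complex_eq_iff)

lemma detI_eq: "detI (Zmat \<zeta>) = Re (detC \<zeta>)"
  by (simp add: detI_def detC_def)

lemma exp_Ln_detC:
  assumes "0 < Re (detC \<zeta>)"
  shows "exp (of_real \<kappa> * - Ln (detC \<zeta>)) = of_real (Re (detC \<zeta>) powr (- \<kappa>))"
proof -
  have "Ln (detC \<zeta>) = of_real (ln (Re (detC \<zeta>)))"
    using Ln_of_real[OF assms] detC_real[of \<zeta>] by metis
  moreover have "Re (detC \<zeta>) \<noteq> 0" using assms by simp
  ultimately show ?thesis using assms by (simp add: powr_def flip: exp_of_real)
qed

lemma YC_eq:
  assumes "0 < Re (detC \<zeta>)"
  shows "YC (1 / K) \<zeta> = of_real (Xfun K \<zeta>)"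
  unfolding YC_def exp_Ln_detC[OF assms] Xfun_def detI_eq ip_self by simp

text \<open>On \<open>nbhd\<close> the arguments of the logarithms are positive reals, so
  \<open>ln\<close> may be replaced by \<open>Ln\<close>, for which the holomorphic chain rule is
  available. The power of \<open>K\<close> in the potential becomes an additive constant.\<close>

lemma gfun_eq:
  fixes \<zeta> :: "complex ^ ('p::finite uprod + 'r::finite)"
  assumes "\<zeta> \<in> nbhd (1 / K)" "0 < K"
  shows "complex_of_real (gfun K \<zeta>) = of_real (1 / K) * - Ln (detC \<zeta>) - Ln (1 - YC (1 / K) \<zeta>)
    + of_real (ln (K powr ((real CARD('r) - real CARD('p uprod + 'r)) / (1 + real CARD('p uprod + 'r)))))"
proof -
  define d X e where "d = Re (detC \<zeta>)" and "X = Xfun K \<zeta>"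
    and "e = K powr ((real CARD('r) - real CARD('p uprod + 'r)) / (1 + real CARD('p uprod + 'r)))"
  have d: "0 < d" using assms by (simp add: nbhd_def d_def)
  have Y: "YC (1 / K) \<zeta> = of_real X" using YC_eq d by (simp add: X_def d_def)
  have X: "X < 1" using assms Y by (simp add: nbhd_def)
  have "Ln (detC \<zeta>) = of_real (ln d)"
    using Ln_of_real[OF d] detC_real[of \<zeta>] by (simp add: d_def)
  moreover have "Ln (1 - YC (1 / K) \<zeta>) = of_real (ln (1 - X))"
    using Ln_of_real[of "1 - X"] X by (simp add: Y)
  moreover have "gfun K \<zeta> = ln (1 / (1 - X) * d powr (- 1 / K) * e)"
    by (simp add: gfun_def Let_def X_def d_def e_def detI_eq)
  moreover have "ln (1 / (1 - X) * d powr (- 1 / K) * e) = - ln (1 - X) - ln d / K + ln e"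
    using d X assms(2) by (simp add: ln_mult ln_div ln_powr e_def)
  ultimately show ?thesis by (simp add: e_def)
qed

lemma wsmooth_detC: "wsmooth n S (detC :: complex ^ ('p::finite uprod + 'r::finite) \<Rightarrow> complex)"
proof -
  have Z: "wsmooth n S (\<lambda>\<zeta> :: complex ^ ('p uprod + 'r). Zmat \<zeta> $ i $ j)" for i j :: 'p
    unfolding Zmat_def by (cases "i = j") (simp_all add: wsmooth_coord wsmooth_mult wsmooth_const del: times_divide_eq_left)
  have "wsmooth n S (\<lambda>\<zeta> :: complex ^ ('p uprod + 'r). mat 1 $ i $ j - (\<Sum>k\<in>UNIV. Zmat \<zeta> $ i $ k * cnj (Zmat \<zeta> $ k $ j)))" for i j :: 'p
    by (intro wsmooth_diff wsmooth_const wsmooth_sum wsmooth_mult Z wsmooth_cnj)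
  then show ?thesis
    unfolding detC_def [abs_def] by (intro wsmooth_det) (simp add: matrix_matrix_mult_def)
qed

lemma wsmooth_YC:
  assumes "\<And>\<zeta>. \<zeta> \<in> S \<Longrightarrow> 0 < Re (detC \<zeta>)"
  shows "wsmooth n S (YC \<kappa> :: complex ^ ('p::finite uprod + 'r::finite) \<Rightarrow> complex)"
proof -
  have "wsmooth n S (\<lambda>\<zeta> :: complex ^ ('p uprod + 'r). ip (wvec \<zeta>) (wvec \<zeta>))"
    unfolding ip_def wvec_def by (simp, intro wsmooth_sum wsmooth_mult wsmooth_coord wsmooth_cnj)
  then show ?thesis
    unfolding YC_def [abs_def]
    by (intro wsmooth_mult wsmooth_exp wsmooth_const wsmooth_minus wsmooth_Ln wsmooth_detC assms)
qed

lemma wsmooth_continuous_on: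
  assumes "wsmooth (Suc 0) S f"
  shows "continuous_on S f"
proof -
  obtain a b where "\<And>\<zeta>. \<zeta> \<in> S \<Longrightarrow> has_wderiv f (\<lambda>\<alpha>. a \<alpha> \<zeta>) (\<lambda>\<alpha>. b \<alpha> \<zeta>) \<zeta>"
    by (rule wsmooth_SucE[OF assms]) (rule that)
  then show ?thesis
    unfolding has_wderiv_def
    by (intro continuous_at_imp_continuous_on ballI has_derivative_continuous) blast
qed

text \<open>In two stages: \<open>YC\<close> is shown to be continuous on the set where the
  determinant has positive real part, and this set is open first.\<close>

lemma open_nbhd: "open (nbhd \<kappa> :: (complex ^ ('p::finite uprod + 'r::finite)) set)"
proof -
  define S0 where "S0 = {\<zeta> :: complex ^ ('p uprod + 'r). 0 < Re (detC \<zeta>)}"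
  have "continuous_on UNIV (detC :: complex ^ ('p uprod + 'r) \<Rightarrow> complex)"
    by (rule wsmooth_continuous_on[OF wsmooth_detC])
  then have S0: "open S0"
    unfolding S0_def by (intro open_Collect_less continuous_on_const continuous_on_Re)
  have "continuous_on S0 (\<lambda>\<zeta>. Re (YC \<kappa> \<zeta>))"
    by (intro continuous_on_Re wsmooth_continuous_on wsmooth_YC) (simp add: S0_def)
  then have "open (S0 \<inter> (\<lambda>\<zeta>. Re (YC \<kappa> \<zeta>)) -` {..<1})"
    by (rule continuous_open_preimage) (auto simp: S0)
  also have "S0 \<inter> (\<lambda>\<zeta>. Re (YC \<kappa> \<zeta>)) -` {..<1} = nbhd \<kappa>"
    by (auto simp: S0_def nbhd_def)
  finally show ?thesis .
qed

lemma wsmooth_gfun: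
  assumes "0 < K"
  shows "wsmooth n (nbhd (1 / K)) (\<lambda>\<zeta> :: complex ^ ('p::finite uprod + 'r::finite). complex_of_real (gfun K \<zeta>))"
proof (rule wsmooth_cong[OF open_nbhd _ gfun_eq[OF _ assms, symmetric]])
  show "wsmooth n (nbhd (1 / K)) (\<lambda>\<zeta> :: complex ^ ('p uprod + 'r). of_real (1 / K) * - Ln (detC \<zeta>) - Ln (1 - YC (1 / K) \<zeta>)
    + of_real (ln (K powr ((real CARD('r) - real CARD('p uprod + 'r)) / (1 + real CARD('p uprod + 'r))))))"
    by (intro wsmooth_add wsmooth_diff wsmooth_mult wsmooth_const wsmooth_minus wsmooth_Ln wsmooth_detC wsmooth_YC)
       (simp_all add: nbhd_def)
qed

text \<open>\<open>D bb\<close> is the fourth-order jet of the potential along the curve with second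
  derivative \<open>bb\<close>. By \<open>\<psi>4_eq\<close> it is \<open>m_at\<close> plus
  nonnegative squares in a symmetric matrix C' and a vector \<beta>', both affine in
  \<open>bb\<close>; a suitable \<open>bb\<close> makes the two vanish together.\<close>

lemma curvature_polynomial:
  fixes \<zeta> v bb :: "complex ^ ('p::finite uprod + 'r::finite)"
  assumes K: "0 < K" and \<zeta>: "\<zeta> \<in> nbhd (1 / K)"
    and pd: "positive_definite (mat 1 - Zmat \<zeta> ** cj (Zmat \<zeta>))"
  defines "\<kappa> \<equiv> 1 / K" and "Z \<equiv> Zmat \<zeta>" and "w \<equiv> wvec \<zeta>" and "A \<equiv> Zmat v" and "a \<equiv> wvec v"
  defines "D \<equiv> \<lambda>bb. sesq (dbar_op v (d_op v (Tmat K)) \<zeta>) v v + sesq (d_op v (Tmat K) \<zeta>) v bb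
       + sesq (dbar_op v (Tmat K) \<zeta>) bb v + sesq (Tmat K \<zeta>) bb bb"
  shows "sesq (Tmat K \<zeta>) v v = G_at \<kappa> Z w A a"
    and "\<exists>q. 0 \<le> q \<and> D bb = m_at \<kappa> Z w A a + of_real q"
    and "\<exists>bb. D bb = m_at \<kappa> Z w A a"
proof -
  note res = positive_definite_resolvent[OF sym_Zmat pd, folded Z_def]
  define e where "e = Re (detC \<zeta>) powr (- \<kappa>)"
  have dpos: "0 < Re (detC \<zeta>)" using \<zeta> by (simp add: nbhd_def)
  have e: "E_at \<kappa> Z = of_real e" "0 < e"
    using exp_Ln_detC[OF dpos, of \<kappa>] dpos by (simp_all add: E_at_def e_def Z_def detC_def)
  have Y: "E_at \<kappa> Z * ip w w = of_real (e * (norm w)\<^sup>2)" by (simp add: e ip_self)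
  have "YC \<kappa> \<zeta> = of_real (e * (norm w)\<^sup>2)"
    unfolding Y[symmetric] by (simp add: YC_def E_at_def detC_def Z_def w_def)
  moreover have "Re (YC \<kappa> \<zeta>) < 1" using \<zeta> by (simp add: nbhd_def \<kappa>_def)
  ultimately have Y1: "e * (norm w)\<^sup>2 < 1" by (metis Re_complex_of_real)
  define cr where "cr = inverse (1 - e * (norm w)\<^sup>2)"
  have c: "c_at \<kappa> Z w = of_real cr" "0 < cr"
    using Y1 by (simp_all only: c_at_def Y cr_def of_real_inverse of_real_diff of_real_1 positive_imp_inverse_positive diff_gt_0_iff_gt)
  \<comment> \<open>The shifted data are parameters fixed by equations, so that the last claim can
    substitute 0 for both of them.\<close>
  have main: "sesq (Tmat K \<zeta>) v v = G_at \<kappa> Z w A a \<and>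
     D bb = m_at \<kappa> Z w A a
       + c_at \<kappa> Z w * (of_real \<kappa> * trace (C' ** (R_at Z ** cj C' ** P_at Z)) + E_at \<kappa> Z * ip \<beta>' \<beta>')
       + (c_at \<kappa> Z w)\<^sup>2 * (E_at \<kappa> Z * ip \<beta>' w) * cnj (E_at \<kappa> Z * ip \<beta>' w)"
    if C': "C' = Zmat bb + mscale 2 (A ** (R_at Z ** cj Z) ** A) + mscale (2 * c_at \<kappa> Z w * k_at \<kappa> Z w A a) A"
      and \<beta>': "\<beta>' = wvec bb + ((of_real \<kappa> * trace ((Zmat bb + A ** (R_at Z ** cj Z) ** A) ** (R_at Z ** cj Z))) *s w
           + (of_real \<kappa> * f_at Z A) *s a) + (of_real \<kappa> * f_at Z A) *s \<alpha>_at \<kappa> Z w A a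
           + (2 * c_at \<kappa> Z w * k_at \<kappa> Z w A a) *s \<alpha>_at \<kappa> Z w A a"
    for bb C' \<beta>'
  proof -
    \<comment> \<open>The curve through \<open>\<zeta>\<close> with velocity \<open>v\<close> and
      second derivative \<open>bb\<close>; the preimage of the open set \<open>nbhd \<kappa>\<close>
      under it serves as parameter domain.\<close>
    define x where "x t = (\<chi> i. \<zeta> $ i + t * v $ i + t\<^sup>2 / 2 * bb $ i)" for t :: complex
    define x1 where "x1 t = (\<chi> i. v $ i + t * bb $ i)" for t :: complex
    define U where "U = x -` nbhd \<kappa>"
    have "continuous_on UNIV x"
      unfolding x_def by (intro continuous_on_vec_lambda continuous_intros) auto
    then have U: "open U"
      unfolding U_def by (rule open_vimage[OF open_nbhd])
    have x0: "x 0 = \<zeta>" "x1 0 = v" by (simp_all add: x_def x1_def)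
    have U0: "0 \<in> U" using \<zeta> by (simp add: U_def x0 \<kappa>_def)
    interpret jc: jet_curve Z A "Zmat bb" w a "wvec bb" \<kappa> U
      by unfold_locales (simp_all add: Z_def A_def sym_Zmat U)
    have Zx: "Zmat (x t) = jc.Z t" for t
      unfolding jc.Z_def unfolding Z_def A_def by (simp add: Zmat_def x_def vec_eq_iff algebra_simps)
    have wx: "wvec (x t) = jc.w t" for t
      unfolding jc.w_def unfolding w_def a_def by (simp add: wvec_def x_def vec_eq_iff)
    have Mx: "det (jc.M t) = detC (x t)" for t
      by (simp add: jc.M_def detC_def Zx)
    have Yx: "jc.Y t = YC \<kappa> (x t)" for t
      by (simp add: jc.Y_def YC_def jc.E_def jc.\<phi>_def Mx wx)
    interpret jc: good_jet_curve Z A "Zmat bb" w a "wvec bb" \<kappa> U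
      by unfold_locales (simp_all add: Mx Yx U_def nbhd_def)
    define const where "const = complex_of_real (ln (K powr ((real CARD('r) - real CARD('p uprod + 'r)) / (1 + real CARD('p uprod + 'r)))))"
    have gx: "jc.\<psi> t + const = complex_of_real (gfun K (x t))" if "t \<in> U" for t
      using gfun_eq[OF _ K, of "x t"] that
      unfolding jc.\<psi>_def jc.\<phi>_def Mx Yx by (simp add: const_def U_def \<kappa>_def)
    have g0: "\<exists>y. has_wirt (\<lambda>t. complex_of_real (gfun K (x t))) y (jc.\<psi>1 t) t" if t: "t \<in> U" for t
    proof -
      obtain y where "has_wirt jc.\<psi> y (jc.\<psi>1 t) t" using jc.d\<psi>[OF t] by blast
      from has_wirt_add[OF this has_wirt_const[of const]]
      have "has_wirt (\<lambda>t. jc.\<psi> t + const) y (jc.\<psi>1 t) t" by simp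
      from has_wirt_transform[OF this U t gx] show ?thesis by blast
    qed
    have x': "has_vwirt x (x1 t) 0 t" "has_vwirt x1 bb 0 t" for t
      unfolding has_vwirt_def x_def x1_def using jc.has_wirt_quadratic jc.has_wirt_affine by simp_all
    have T: "Tmat K = (\<lambda>\<xi>. \<chi> \<alpha> \<beta>. wirt \<alpha> (wirt_bar \<beta> (\<lambda>\<xi>. complex_of_real (gfun K \<xi>))) \<xi>)"
      by (simp add: Tmat_def fun_eq_iff)
    note J = jets_along_curve[OF open_nbhd wsmooth_gfun[OF K] x' U _ g0 jc.d\<psi>1 _ jc.d\<psi>3 U0, unfolded x0]
    have xU: "x t \<in> nbhd (1 / K)" if "t \<in> U" for t using that by (simp add: U_def \<kappa>_def)
    have d2: "\<exists>y. has_wirt jc.\<psi>2 (jc.\<psi>3 t) y t" if "t \<in> U" for t using jc.d\<psi>2[OF that] by blast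
    have "sesq (Tmat K \<zeta>) v v = jc.\<psi>2 0" "jc.\<psi>4 0 = D bb"
      unfolding D_def T by (rule J; (rule xU d2 | assumption)+; assumption?)+
    moreover have "jc.C 0 + mscale (2 * jc.c 0 * jc.k 0) (jc.Z1 0) = C'"
      unfolding C' by (simp add: jc.C_def jc.at_0 jc.Z_0)
    moreover have "jc.\<beta> 0 + (2 * jc.c 0 * jc.k 0) *s jc.\<alpha> 0 = \<beta>'"
      unfolding \<beta>' by (simp add: jc.\<beta>_def jc.f2_def jc.at_0 jc.Z_0)
    ultimately show ?thesis
      using jc.\<psi>4_eq[OF U0] by (simp add: jc.at_0 jc.Z_0 m_at_def)
  qed
  show "sesq (Tmat K \<zeta>) v v = G_at \<kappa> Z w A a" using main[OF refl refl] by blast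
  \<comment> \<open>Nonnegativity of the trace term comes from \<open>twisted_norm\<close>, which is
    about symmetric matrices. The shifted matrix is symmetric because \<open>R_at Z ** cj Z\<close>
    is.\<close>
  have symC: "transpose (B + mscale 2 (A ** (R_at Z ** cj Z) ** A) + mscale s A) = B + mscale 2 (A ** (R_at Z ** cj Z) ** A) + mscale s A"
    if "transpose B = B" for s B
  proof -
    have "transpose (R_at Z ** cj Z) = R_at Z ** cj Z"
      by (simp add: matrix_transpose_mul cj_transpose[symmetric] sym_Zmat Z_def res(3,4)[unfolded Z_def])
    then show ?thesis
      by (simp add: transpose_add transpose_mscale matrix_transpose_mul sym_Zmat A_def that matrix_mul_assoc)
  qed
  show "\<exists>q. 0 \<le> q \<and> D bb = m_at \<kappa> Z w A a + of_real q"
  proof -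
    define C' where "C' = Zmat bb + mscale 2 (A ** (R_at Z ** cj Z) ** A) + mscale (2 * c_at \<kappa> Z w * k_at \<kappa> Z w A a) A"
    define \<beta>' where "\<beta>' = wvec bb + ((of_real \<kappa> * trace ((Zmat bb + A ** (R_at Z ** cj Z) ** A) ** (R_at Z ** cj Z))) *s w
           + (of_real \<kappa> * f_at Z A) *s a) + (of_real \<kappa> * f_at Z A) *s \<alpha>_at \<kappa> Z w A a
           + (2 * c_at \<kappa> Z w * k_at \<kappa> Z w A a) *s \<alpha>_at \<kappa> Z w A a"
    have "transpose C' = C'" unfolding C'_def by (rule symC[OF sym_Zmat])
    then obtain F where F: "trace (C' ** (R_at Z ** cj C' ** P_at Z)) = of_real F" "0 \<le> F"
      using twisted_norm[OF sym_Zmat pd, folded Z_def] by metis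
    define y where "y = E_at \<kappa> Z * ip \<beta>' w"
    have yy: "y * cnj y = of_real ((cmod y)\<^sup>2)" by (rule complex_norm_square[symmetric])
    have "D bb = m_at \<kappa> Z w A a
       + c_at \<kappa> Z w * (of_real \<kappa> * trace (C' ** (R_at Z ** cj C' ** P_at Z)) + E_at \<kappa> Z * ip \<beta>' \<beta>')
       + (c_at \<kappa> Z w)\<^sup>2 * (y * cnj y)"
      using main[OF C'_def \<beta>'_def] by (simp only: y_def mult.assoc)
    then have "D bb = m_at \<kappa> Z w A a + of_real (cr * (\<kappa> * F + e * (norm \<beta>')\<^sup>2) + cr\<^sup>2 * (cmod y)\<^sup>2)"
      unfolding yy c(1) F(1) e(1) ip_self by simp
    moreover have "0 \<le> cr * (\<kappa> * F + e * (norm \<beta>')\<^sup>2) + cr\<^sup>2 * (cmod y)\<^sup>2"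
      using c e F K by (simp add: \<kappa>_def)
    ultimately show ?thesis by blast
  qed
  show "\<exists>bb. D bb = m_at \<kappa> Z w A a"
  proof -
    \<comment> \<open>\<open>B\<close> solves C' = 0 and, with this \<open>B\<close>,
      \<open>b\<close> solves \<beta>' = 0. Since \<open>B\<close> is symmetric, the pair comes from
      a coordinate vector.\<close>
    define s where "s = 2 * c_at \<kappa> Z w * k_at \<kappa> Z w A a"
    define B where "B = - (mscale 2 (A ** (R_at Z ** cj Z) ** A) + mscale s A)"
    define b where "b = - (((of_real \<kappa> * trace ((B + A ** (R_at Z ** cj Z) ** A) ** (R_at Z ** cj Z))) *s w
           + (of_real \<kappa> * f_at Z A) *s a) + (of_real \<kappa> * f_at Z A) *s \<alpha>_at \<kappa> Z w A a
           + s *s \<alpha>_at \<kappa> Z w A a)"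
    have "transpose B = B"
    proof -
      have "transpose (- X) = - transpose X" for X :: "complex ^ 'p ^ 'p"
        by (simp add: transpose_def vec_eq_iff)
      moreover have "transpose (0 :: complex ^ 'p ^ 'p) = 0"
        by (simp add: transpose_def vec_eq_iff)
      ultimately show ?thesis
        using symC[of 0 s] by (simp only: B_def add_0)
    qed
    then obtain bb :: "complex ^ ('p uprod + 'r)" where bb: "Zmat bb = B" "wvec bb = b"
      using ex_coordinates by blast
    have "D bb = m_at \<kappa> Z w A a
       + c_at \<kappa> Z w * (of_real \<kappa> * trace ((0 :: complex ^ 'p ^ 'p) ** (R_at Z ** cj 0 ** P_at Z)) + E_at \<kappa> Z * ip (0 :: complex ^ 'r) 0)
       + (c_at \<kappa> Z w)\<^sup>2 * (E_at \<kappa> Z * ip 0 w) * cnj (E_at \<kappa> Z * ip 0 w)"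
      by (rule conjunct2[OF main]) (simp_all add: bb B_def b_def flip: s_def)
    then show ?thesis by (auto simp: matrix_mult_zero ip_zero_left trace_def)
  qed
qed

section \<open>From the quadratic polynomial to the curvature on \<open>Y_II\<close>\<close>

lemma Y_II_base_point:
  fixes \<zeta> :: "complex ^ ('p::finite uprod + 'r::finite)"
  assumes K: "0 < K" and \<zeta>: "point_of \<zeta> \<in> Y_II K"
  shows "positive_definite (mat 1 - Zmat \<zeta> ** cj (Zmat \<zeta>))" "\<zeta> \<in> nbhd (1 / K)"
    "\<exists>e y. E_at (1 / K) (Zmat \<zeta>) = of_real e \<and> 0 < e \<and> E_at (1 / K) (Zmat \<zeta>) * ip (wvec \<zeta>) (wvec \<zeta>) = of_real y
       \<and> 0 \<le> y \<and> y < 1"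
proof -
  show pd: "positive_definite (mat 1 - Zmat \<zeta> ** cj (Zmat \<zeta>))"
    using \<zeta> by (simp add: Y_II_def point_of_def R_II_def)
  define d where "d = Re (detC \<zeta>)"
  have d: "0 < d" using positive_definite_resolvent(1)[OF sym_Zmat pd] by (simp add: d_def detC_def)
  define y where "y = d powr - (1 / K) * (norm (wvec \<zeta>))\<^sup>2"
  have E: "E_at (1 / K) (Zmat \<zeta>) = of_real (d powr - (1 / K))"
    using exp_Ln_detC[of \<zeta> "1 / K"] d by (simp only: E_at_def detC_def d_def)
  have Y: "E_at (1 / K) (Zmat \<zeta>) * ip (wvec \<zeta>) (wvec \<zeta>) = of_real y"
    by (simp add: E y_def ip_self)
  have "(norm (wvec \<zeta>))\<^sup>2 < d powr (1 / K)"
    using \<zeta> by (simp add: Y_II_def point_of_def detI_eq d_def)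
  then have "y < d powr - (1 / K) * d powr (1 / K)"
    unfolding y_def using d by (intro mult_strict_left_mono) auto
  also have "\<dots> = 1" using d by (simp flip: powr_add)
  finally have y: "y < 1" .
  have "YC (1 / K) \<zeta> = of_real y"
    using Y by (simp only: YC_def E_at_def detC_def)
  then show "\<zeta> \<in> nbhd (1 / K)" using d y by (simp add: nbhd_def d_def)
  show "\<exists>e y. E_at (1 / K) (Zmat \<zeta>) = of_real e \<and> 0 < e \<and> E_at (1 / K) (Zmat \<zeta>) * ip (wvec \<zeta>) (wvec \<zeta>) = of_real y
       \<and> 0 \<le> y \<and> y < 1"
    by (rule exI[of _ "d powr - (1 / K)"], rule exI[of _ y]) (use E Y y d in \<open>simp add: y_def\<close>)
qed

text \<open>Dropping nonnegative terms of \<open>G_at\<close> leaves the bound by c F / K. For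
  positivity, either the matrix part of \<open>v\<close> is nonzero and then F > 0, or it vanishes;
  in that case \<alpha> is the vector part of \<open>v\<close>, which is nonzero because the
  coordinates determine \<open>v\<close>.\<close>

lemma G_at_values:
  fixes \<zeta> v :: "complex ^ ('p::finite uprod + 'r::finite)"
  assumes K: "0 < K" and \<zeta>: "point_of \<zeta> \<in> Y_II K"
  obtains F S c G where
    "trace (Zmat v ** W_at (Zmat \<zeta>) (Zmat v)) = of_real F"
    "trace (Zmat v ** W_at (Zmat \<zeta>) (Zmat v) ** (Zmat v ** W_at (Zmat \<zeta>) (Zmat v))) = of_real S"
    "c_at (1 / K) (Zmat \<zeta>) (wvec \<zeta>) = of_real c"
    "G_at (1 / K) (Zmat \<zeta>) (wvec \<zeta>) (Zmat v) (wvec v) = of_real G"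
    "1 \<le> c" "0 \<le> F" "c * (F / K) \<le> G" "F\<^sup>2 \<le> real CARD('p) * S" "S \<le> F\<^sup>2" "v \<noteq> 0 \<Longrightarrow> 0 < G"
proof -
  let ?Z = "Zmat \<zeta>" and ?A = "Zmat v" and ?w = "wvec \<zeta>" and ?a = "wvec v" and ?\<kappa> = "1 / K"
  note base = Y_II_base_point[OF K \<zeta>]
  obtain e y where e: "E_at ?\<kappa> ?Z = of_real e" "0 < e" and y: "E_at ?\<kappa> ?Z * ip ?w ?w = of_real y" "0 \<le> y" "y < 1"
    using base(3) by blast
  obtain F S where F: "trace (?A ** (R_at ?Z ** cj ?A ** P_at ?Z)) = of_real F"
    and S: "trace (?A ** W_at ?Z ?A ** (?A ** W_at ?Z ?A)) = of_real S"
    and FS: "0 \<le> F" "F = 0 \<Longrightarrow> ?A = 0" "F\<^sup>2 \<le> real CARD('p) * S" "S \<le> F\<^sup>2"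
    using twisted_norm[OF sym_Zmat base(1) sym_Zmat] by metis
  define c where "c = inverse (1 - y)"
  have c: "c_at ?\<kappa> ?Z ?w = of_real c"
    by (simp add: c_at_def y(1) c_def)
  have c1: "1 \<le> c" using y by (simp add: c_def one_le_inverse)
  define \<alpha> where "\<alpha> = \<alpha>_at ?\<kappa> ?Z ?w ?A ?a"
  define k where "k = k_at ?\<kappa> ?Z ?w ?A ?a"
  define G where "G = c * (F / K + e * (norm \<alpha>)\<^sup>2) + c\<^sup>2 * (cmod k)\<^sup>2"
  have kk: "k * cnj k = of_real ((cmod k)\<^sup>2)" by (rule complex_norm_square[symmetric])
  have "G_at ?\<kappa> ?Z ?w ?A ?a = of_real c * (of_real ?\<kappa> * of_real F + of_real e * of_real ((norm \<alpha>)\<^sup>2)) + (of_real c)\<^sup>2 * (k * cnj k)"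
    unfolding G_at_def c e(1) \<alpha>_def[symmetric] k_def[symmetric] ip_self W_at_def F by (simp only: mult.assoc)
  then have G: "G_at ?\<kappa> ?Z ?w ?A ?a = of_real G"
    unfolding kk by (simp add: G_def)
  have le: "c * (F / K) \<le> G"
    using c1 e by (simp add: G_def distrib_left)
  have pos: "0 < G" if "v \<noteq> 0"
  proof (cases "?A = 0")
    case False
    then have "0 < F" using FS by force
    then have "0 < c * (F / K)" using c1 K by simp
    then show ?thesis using le by simp
  next
    case True
    then have "f_at ?Z ?A = 0" by (simp add: f_at_def matrix_mult_zero trace_def)
    then have \<alpha>: "\<alpha> = ?a" by (simp add: \<alpha>_def \<alpha>_at_def)
    have "?a \<noteq> 0"
    proof
      assume "?a = 0"
      with True have "point_of v = point_of (0 :: complex ^ ('p uprod + 'r))"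
        by (simp add: point_of_def Zmat_def wvec_def vec_eq_iff)
      then have "v = 0"
        using bij_betw_point_of unfolding bij_betw_def inj_on_def by blast
      then show False using that by simp
    qed
    then have "0 < c * (e * (norm \<alpha>)\<^sup>2)" using c1 e \<alpha> by simp
    moreover have "c * (e * (norm \<alpha>)\<^sup>2) \<le> G"
      using c1 K FS by (simp add: G_def distrib_left)
    ultimately show ?thesis by simp
  qed
  show ?thesis
    by (rule that[of F S c G]) (use F S c G c1 FS le pos in \<open>auto simp: W_at_def\<close>)
qed

text \<open>Turns v dT T^{-1} dT^* v^* into the form of the inverse at v dT.\<close>

lemma sesq_congruence:
  fixes A B :: "complex ^ 'n ^ 'n"
  shows "sesq (A ** B ** adj A) v u = sesq B (v v* A) (u v* A)"
proof -
  have "(\<chi> i. cnj ((u v* A) $ i)) = adj A *v (\<chi> i. cnj (u $ i))"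
    by (simp add: vec_eq_iff vector_matrix_mult_def matrix_vector_mult_def transpose_def mult.commute)
  moreover have "sesq M v u = (\<Sum>i\<in>UNIV. v $ i * (M *v (\<chi> j. cnj (u $ j))) $ i)" for M :: "complex ^ 'n ^ 'n" and v u
    by (rule sesq_eq_matrix_vector)
  moreover have "(\<Sum>i\<in>UNIV. v $ i * (A *v x) $ i) = (\<Sum>i\<in>UNIV. (v v* A) $ i * x $ i)" for x
    unfolding matrix_vector_mult_def vector_matrix_mult_def
    by (simp add: sum_distrib_left sum_distrib_right, subst sum.swap) (simp add: mult_ac)
  ultimately show ?thesis by (simp add: matrix_vector_mul_assoc[symmetric])
qed

text \<open>\<open>hermitian_quadratic_min\<close> with \<xi> = v dT and X = v (dbar d T) v^*.
  Positivity of \<open>Tmat\<close> is positivity of G, and the bound \<open>m_at\<close> together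
  with its attainment is \<open>curvature_polynomial\<close>; the conclusion is the numerator of
  \<open>omega\<close>.\<close>

lemma omega_eq:
  fixes \<zeta> v :: "complex ^ ('p::finite uprod + 'r::finite)"
  assumes K: "0 < K" and \<zeta>: "point_of \<zeta> \<in> Y_II K"
  shows "omega K \<zeta> v = - m_at (1 / K) (Zmat \<zeta>) (wvec \<zeta>) (Zmat v) (wvec v)
     / (G_at (1 / K) (Zmat \<zeta>) (wvec \<zeta>) (Zmat v) (wvec v))\<^sup>2"
proof -
  note base = Y_II_base_point[OF K \<zeta>]
  note cp = curvature_polynomial[OF K base(2,1)]
  define m where "m = m_at (1 / K) (Zmat \<zeta>) (wvec \<zeta>) (Zmat v) (wvec v)"
  have m: "m = of_real (Re m)"
  proof -
    obtain F S c G where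
      "trace (Zmat v ** W_at (Zmat \<zeta>) (Zmat v)) = of_real F"
      "trace (Zmat v ** W_at (Zmat \<zeta>) (Zmat v) ** (Zmat v ** W_at (Zmat \<zeta>) (Zmat v))) = of_real S"
      "c_at (1 / K) (Zmat \<zeta>) (wvec \<zeta>) = of_real c"
      "G_at (1 / K) (Zmat \<zeta>) (wvec \<zeta>) (Zmat v) (wvec v) = of_real G"
      using G_at_values[OF K \<zeta>, of v] by metis
    then have "m = of_real (2 * G\<^sup>2 + 2 * c * (1 / K * S - (1 / K * F)\<^sup>2))"
      by (simp add: m_def m_at_def)
    then show ?thesis by (metis Re_complex_of_real)
  qed
  define \<xi> where "\<xi> = v v* d_op v (Tmat K) \<zeta>"
  define \<eta> where "\<eta> = dbar_op v (Tmat K) \<zeta> *v (\<chi> j. cnj (v $ j))"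
  define X where "X = sesq (dbar_op v (d_op v (Tmat K)) \<zeta>) v v"
  define D where "D b = X + sesq (d_op v (Tmat K) \<zeta>) v b + sesq (dbar_op v (Tmat K) \<zeta>) b v + sesq (Tmat K \<zeta>) b b" for b
  have "sesq (matrix_inv (Tmat K \<zeta>)) \<xi> \<xi> - X = - of_real (Re m)"
  proof (rule hermitian_quadratic_min[where D = D and \<eta> = \<eta>])
    show "sesq (Tmat K \<zeta>) b b \<in> \<real> \<and> 0 < Re (sesq (Tmat K \<zeta>) b b)" if "b \<noteq> 0" for b
      using cp(1)[of b] G_at_values[OF K \<zeta>, of b] that by (metis Re_complex_of_real Reals_of_real)
    show "D b = X + (\<Sum>j\<in>UNIV. \<xi> $ j * cnj (b $ j)) + (\<Sum>i\<in>UNIV. b $ i * \<eta> $ i) + sesq (Tmat K \<zeta>) b b" for b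
      by (simp only: D_def \<xi>_def \<eta>_def sesq_eq_vector_matrix[of "d_op v (Tmat K) \<zeta>"] sesq_eq_matrix_vector[of "dbar_op v (Tmat K) \<zeta>"])
    show "D b \<in> \<real> \<and> Re m \<le> Re (D b)" for b
    proof -
      obtain q where "0 \<le> q" "D b = m + of_real q"
        using cp(2)[of v b] unfolding D_def X_def m_def by blast
      then have "D b = of_real (Re m + q)" by (simp add: m[symmetric])
      with \<open>0 \<le> q\<close> show ?thesis by simp
    qed
    show "\<exists>b. D b = of_real (Re m)"
      using cp(3)[of v] unfolding D_def X_def m[symmetric] unfolding m_def by blast
  qed
  moreover have "row_form v (- dbar_op v (d_op v (Tmat K)) \<zeta> + d_op v (Tmat K) \<zeta> ** matrix_inv (Tmat K \<zeta>)
      ** transpose (map_matrix cnj (d_op v (Tmat K) \<zeta>))) = sesq (matrix_inv (Tmat K \<zeta>)) \<xi> \<xi> - X"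
  proof -
    have "sesq (d_op v (Tmat K) \<zeta> ** matrix_inv (Tmat K \<zeta>) ** adj (d_op v (Tmat K) \<zeta>)) v v
       = sesq (matrix_inv (Tmat K \<zeta>)) \<xi> \<xi>"
      by (simp add: \<xi>_def sesq_congruence)
    then show ?thesis unfolding row_form_eq_sesq sesq_matrix_add sesq_matrix_minus by (simp add: X_def)
  qed
  ultimately show ?thesis
    by (simp add: omega_def Let_def row_form_eq_sesq[of v "Tmat K \<zeta>"] cp(1) m_def[symmetric] m[symmetric])
qed

section \<open>Extremal directions at the origin and the final estimate\<close>

lemma positive_definite_mat_1: "positive_definite (mat 1 :: complex ^ 'n ^ 'n)"
  unfolding positive_definite_def
proof (intro conjI allI impI)
  show "transpose (map_matrix cnj (mat 1)) = (mat 1 :: complex ^ 'n ^ 'n)" by simp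
  fix v :: "complex ^ 'n" assume "v \<noteq> 0"
  have "(\<Sum>j\<in>UNIV. v $ i * mat 1 $ i $ j * cnj (v $ j)) = v $ i * cnj (v $ i)" for i
  proof -
    have "(\<Sum>j\<in>UNIV. v $ i * mat 1 $ i $ j * cnj (v $ j)) = (\<Sum>j\<in>UNIV. if j = i then v $ i * cnj (v $ i) else 0)"
      by (rule sum.cong) (auto simp: mat_def)
    then show ?thesis by simp
  qed
  then have "(\<Sum>i\<in>UNIV. \<Sum>j\<in>UNIV. v $ i * mat 1 $ i $ j * cnj (v $ j)) = ip v v"
    by (simp add: ip_def)
  then show "0 < Re (\<Sum>i\<in>UNIV. \<Sum>j\<in>UNIV. v $ i * mat 1 $ i $ j * cnj (v $ j))"
    using \<open>v \<noteq> 0\<close> by (simp add: ip_self)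
qed

lemma Zmat_wvec_0: "Zmat 0 = 0" "wvec 0 = 0"
  by (simp_all add: Zmat_def wvec_def vec_eq_iff)

lemma origin_in_Y_II: "point_of (0 :: complex ^ ('p::finite uprod + 'r::finite)) \<in> Y_II K"
proof -
  have "transpose (0 :: complex ^ 'p ^ 'p) = 0" by (simp add: transpose_def vec_eq_iff)
  then show ?thesis
    by (simp add: point_of_def Zmat_wvec_0 Y_II_def R_II_def matrix_mult_zero positive_definite_mat_1 detI_def)
qed

text \<open>For a real symmetric projection of rank n all corrections vanish at the origin: c = 1,
  \<alpha> = 0, F = S = n and G = n / K, hence -2 - 2 (K / n - 1) = - 2 K / n.\<close>

lemma omega_origin:
  fixes v :: "complex ^ ('p::finite uprod + 'r::finite)"
  assumes K: "0 < K" and A: "cj (Zmat v) = Zmat v" "Zmat v ** Zmat v = Zmat v" and a: "wvec v = 0"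
    and n: "trace (Zmat v) = of_nat n" "0 < n"
  shows "omega K 0 v = of_real (- (2 * K / real n))"
proof -
  let ?A = "Zmat v"
  have inv: "matrix_inv (mat 1 :: complex ^ 'p ^ 'p) = mat 1"
    by (rule matrix_inv_unique) (simp add: matrix_mul_lid)
  have W: "W_at 0 ?A = ?A"
    by (simp add: W_at_def R_at_def P_at_def matrix_mult_zero inv A matrix_mul_lid matrix_mul_rid)
  have c: "c_at (1 / K) (0 :: complex ^ 'p ^ 'p) (0 :: complex ^ 'r) = 1" by (simp add: c_at_def ip_zero_left)
  have \<alpha>: "\<alpha>_at (1 / K) 0 (0 :: complex ^ 'r) ?A 0 = 0" by (simp add: \<alpha>_at_def)
  have G: "G_at (1 / K) 0 0 ?A (0 :: complex ^ 'r) = of_nat n / of_real K"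
    by (simp add: G_at_def c \<alpha> k_at_def ip_zero_left W A n)
  have m: "m_at (1 / K) 0 0 ?A (0 :: complex ^ 'r) = 2 * (of_nat n / of_real K)"
    by (simp add: m_at_def G c W A n)
  show ?thesis
    unfolding omega_eq[OF K origin_in_Y_II] Zmat_wvec_0 a G m
    using K n(2) by (simp add: field_simps power2_eq_square)
qed

theorem mainTheorem2:
  fixes K :: real
  assumes p: "CARD('p::finite) > 1"
    and K: "K = real CARD('p) / 2 + 1 / (real CARD('p) + 1)"
  shows
    "(\<forall>\<zeta> v :: complex ^ ('p uprod + 'r::finite).
        point_of \<zeta> \<in> Y_II K \<longrightarrow> v \<noteq> 0 \<longrightarrow>
          omega K \<zeta> v \<in> \<real> \<and>
          - 2 * K \<le> Re (omega K \<zeta> v) \<and>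
          Re (omega K \<zeta> v) \<le> - (2 * K / real CARD('p))) \<and>
     (\<exists>\<zeta> v :: complex ^ ('p uprod + 'r).
        point_of \<zeta> \<in> Y_II K \<and> v \<noteq> 0 \<and>
        omega K \<zeta> v = complex_of_real (- 2 * K)) \<and>
     (\<exists>\<zeta> v :: complex ^ ('p uprod + 'r).
        point_of \<zeta> \<in> Y_II K \<and> v \<noteq> 0 \<and>
        omega K \<zeta> v = complex_of_real (- (2 * K / real CARD('p))))"
proof -
  define n where "n = real CARD('p)"
  have n2: "2 \<le> n" using p by (simp add: n_def)
  \<comment> \<open>Two bounds on \<open>K\<close> follow from n \<ge> 2: n / 2 \<ge> 1 gives K
    \<ge> 1, and 1 / (n + 1) \<le> 1 / 2 \<le> n / 2 gives K \<le> n. They fix the signs of K - 1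
    and 1 - K / n in the two estimates.\<close>
  have "0 < 1 / (n + 1)" using n2 by simp
  then have K1: "1 \<le> K" using n2 unfolding K n_def[symmetric] by linarith
  have "1 / (n + 1) \<le> 1 / 2" using n2 by (intro divide_left_mono) auto
  then have Kn: "K \<le> n" using n2 unfolding K n_def[symmetric] by linarith
  have K0: "0 < K" using K1 by simp
  show ?thesis
  proof (intro conjI allI impI)
    fix \<zeta> v :: "complex ^ ('p uprod + 'r)"
    assume \<zeta>: "point_of \<zeta> \<in> Y_II K" and v: "v \<noteq> 0"
    obtain F S c G where
      F: "trace (Zmat v ** W_at (Zmat \<zeta>) (Zmat v)) = of_real F" and
      S: "trace (Zmat v ** W_at (Zmat \<zeta>) (Zmat v) ** (Zmat v ** W_at (Zmat \<zeta>) (Zmat v))) = of_real S" and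
      c: "c_at (1 / K) (Zmat \<zeta>) (wvec \<zeta>) = of_real c" and
      G: "G_at (1 / K) (Zmat \<zeta>) (wvec \<zeta>) (Zmat v) (wvec v) = of_real G" and
      bounds: "1 \<le> c" "0 \<le> F" "c * (F / K) \<le> G" "F\<^sup>2 \<le> real CARD('p) * S" "S \<le> F\<^sup>2" "v \<noteq> 0 \<Longrightarrow> 0 < G"
      by (rule G_at_values[OF K0 \<zeta>, of v]) (rule that)
    note bounds = bounds[folded n_def]
    define f where "f = F / K"
    have G0: "0 < G" using bounds v by simp
    have "omega K \<zeta> v = of_real (- (2 * G\<^sup>2 + 2 * c * (S / K - f\<^sup>2)) / G\<^sup>2)"
      unfolding omega_eq[OF K0 \<zeta>] m_at_def F S c G by (simp add: f_def)
    then have \<omega>: "omega K \<zeta> v = of_real (- 2 - 2 * c * (S / K - f\<^sup>2) / G\<^sup>2)"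
      using G0 by (simp add: field_simps)
    have f0: "0 \<le> f" using bounds K0 by (simp add: f_def)
    have Ff: "F\<^sup>2 = K\<^sup>2 * f\<^sup>2" using K0 by (simp add: f_def power_divide)
    have S_upper: "S / K \<le> K * f\<^sup>2"
      using bounds(5) K0 unfolding Ff by (simp add: field_simps power2_eq_square)
    have S_lower: "K / n * f\<^sup>2 \<le> S / K"
      using bounds(4) K0 n2 unfolding Ff by (simp add: field_simps power2_eq_square)
    \<comment> \<open>The metric G is at least c f, and c \<ge> 1 allows one factor c to be
      discarded after squaring.\<close>
    have cf: "c * f\<^sup>2 \<le> G\<^sup>2"
    proof -
      have "c * f\<^sup>2 \<le> c\<^sup>2 * f\<^sup>2"
        using bounds(1) by (intro mult_right_mono) (auto simp: power2_eq_square)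
      also have "\<dots> = (c * f)\<^sup>2" by (simp add: power_mult_distrib)
      also have "\<dots> \<le> G\<^sup>2"
        using bounds(1) f0 by (intro power_mono bounds(3)[folded f_def]) simp
      finally show ?thesis .
    qed
    show "omega K \<zeta> v \<in> \<real>" unfolding \<omega> by simp
    \<comment> \<open>Lower curvature bound: the upper bound on S leaves the factor K - 1, which is
      nonnegative, so c f^2 may be enlarged to G^2.\<close>
    have "c * (S / K - f\<^sup>2) \<le> c * ((K - 1) * f\<^sup>2)"
      using S_upper bounds(1) by (intro mult_left_mono) (auto simp: algebra_simps)
    also have "\<dots> = (K - 1) * (c * f\<^sup>2)" by simp
    also have "\<dots> \<le> (K - 1) * G\<^sup>2" using cf K1 by (intro mult_left_mono) auto
    finally have "c * (S / K - f\<^sup>2) / G\<^sup>2 \<le> K - 1"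
      using G0 by (simp add: pos_divide_le_eq)
    then show "- 2 * K \<le> Re (omega K \<zeta> v)" unfolding \<omega> by simp
    \<comment> \<open>Upper curvature bound: the coefficient K / n - 1 is nonpositive, so replacing
      c f^2 by the larger G^2 makes the product smaller.\<close>
    have "(1 - K / n) * (c * f\<^sup>2) \<le> (1 - K / n) * G\<^sup>2"
      using cf Kn n2 by (intro mult_left_mono) auto
    then have "(K / n - 1) * G\<^sup>2 \<le> (K / n - 1) * (c * f\<^sup>2)" by (simp add: algebra_simps)
    also have "\<dots> = c * ((K / n - 1) * f\<^sup>2)" by simp
    also have "\<dots> \<le> c * (S / K - f\<^sup>2)"
      using S_lower bounds(1) by (intro mult_left_mono) (auto simp: left_diff_distrib)
    finally have "K / n - 1 \<le> c * (S / K - f\<^sup>2) / G\<^sup>2"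
      using G0 by (simp add: pos_le_divide_eq)
    then show "Re (omega K \<zeta> v) \<le> - (2 * K / real CARD('p))" unfolding \<omega> n_def by simp
  next
    obtain i :: 'p where "i \<in> UNIV" by blast
    \<comment> \<open>A coordinate projection of rank one, the case n = 1 of
      \<open>omega_origin\<close>.\<close>
    define A :: "complex ^ 'p ^ 'p" where "A = (\<chi> k l. if k = i \<and> l = i then 1 else 0)"
    have "transpose A = A" by (auto simp: A_def transpose_def vec_eq_iff)
    then obtain v :: "complex ^ ('p uprod + 'r)" where v: "Zmat v = A" "wvec v = 0"
      using ex_coordinates by blast
    have "trace A = (\<Sum>k\<in>UNIV. if k = i then 1 else 0)"
      unfolding trace_def A_def by (rule sum.cong) auto
    then have trA: "trace A = of_nat 1" by simp
    have "(\<Sum>m\<in>UNIV. A $ k $ m * A $ m $ l) = (\<Sum>m\<in>UNIV. if m = i then A $ k $ l else 0)" for k l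
      by (rule sum.cong) (auto simp: A_def)
    then have AA: "A ** A = A" by (simp add: matrix_matrix_mult_def vec_eq_iff)
    have cA: "cj A = A" by (simp add: A_def vec_eq_iff)
    have "v \<noteq> 0" using trA v Zmat_wvec_0(1) by (metis (no_types, lifting) of_nat_1 sum.neutral trace_def zero_index zero_neq_one)
    moreover have "omega K 0 v = complex_of_real (- 2 * K)"
      using omega_origin[OF K0, of v 1] by (simp add: v trA AA cA)
    ultimately show "\<exists>\<zeta> v :: complex ^ ('p uprod + 'r).
        point_of \<zeta> \<in> Y_II K \<and> v \<noteq> 0 \<and> omega K \<zeta> v = complex_of_real (- 2 * K)"
      using origin_in_Y_II by blast
  next
    \<comment> \<open>The identity matrix has trace p, the opposite extreme in
      \<open>omega_origin\<close>.\<close>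
    obtain v :: "complex ^ ('p uprod + 'r)" where v: "Zmat v = mat 1" "wvec v = 0"
      using ex_coordinates[OF transpose_mat] by blast
    have "v \<noteq> 0" using v Zmat_wvec_0(1) by (metis trace_0 trace_I mat_0 of_nat_eq_0_iff zero_less_card_finite less_irrefl)
    moreover have "omega K 0 v = complex_of_real (- (2 * K / real CARD('p)))"
      using omega_origin[OF K0, of v "CARD('p)"] by (simp add: v trace_I matrix_mul_lid)
    ultimately show "\<exists>\<zeta> v :: complex ^ ('p uprod + 'r).
        point_of \<zeta> \<in> Y_II K \<and> v \<noteq> 0 \<and> omega K \<zeta> v = complex_of_real (- (2 * K / real CARD('p)))"
      using origin_in_Y_II by blast
  qed
qed

end
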